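(* Let $\Phi:\mathcal{K}^2\to\mathcal{K}^2$ be an operator in $\mathbf{MAdd}^{s,+}$. Then $\Phi$ satisfies (VC) if and only if there exist a continuous and strictly positive function $\rho:\mathrm{Gr}(2,1)\to\mathbb{R}$ and a bijective bi-Lipschitz map $\pi:\mathrm{Gr}(2,1)\to\mathrm{Gr}(2,1)$ such that for every $K\in\mathcal{K}^2$, $$h(\Phi(K),u)=\int_{\mathbb{S}^1}\rho(\overline{v})\,V_1\big([-u,u]\,|\,\pi(\overline{v})\big)\,dS_1(K,v)\quad\text{for all }u\in\mathbb{S}^1.$$
   Context: $\mathcal{K}^2$ is the set of (nonempty) compact convex subsets of $\mathbb{R}^2$ with Minkowski addition and the Hausdorff metric $d_H$; $V_2$ is area. $\mathbf{MAdd}^{s,+}$ (for $n=2$) is the set of operators $\Phi:\mathcal{K}^2\to\mathcal{K}^2$ that are Minkowski additive ($\Phi(K+L)=\Phi(K)+\Phi(L)$), continuous in the Hausdorff metric, translation invariant ($\Phi(K+t)=\Phi(K)$ for $t\in\mathbb{R}^2$), and satisfy $\Phi(-K)=\Phi(K)=-\Phi(K)$ for all $K$. $\Phi$ satisfies (VC) if there are constants $c_\Phi,C_\Phi>0$ with $c_\Phi V_2(K)\leq V_2(\Phi(K))\leq C_\Phi V_2(K)$ for all $K\in\mathcal{K}^2$. $\mathrm{Gr}(2,1)$ is the set of lines through the origin in $\mathbb{R}^2$ with the metric $d(E,F)=d_H(E\cap\mathbb{S}^1,F\cap\mathbb{S}^1)$. A bijection $\pi$ is bi-Lipschitz if there are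 $c,C>0$ with $c\,d(E,F)\leq d(\pi(E),\pi(F))\leq C\,d(E,F)$ for all $E,F$. For $v=(v_1,v_2)\in\mathbb{S}^1$, $\overline{v}=(-v_2,v_1)$; $\rho(\overline v)$ and $\pi(\overline v)$ mean $\rho$ and $\pi$ evaluated at the line $\mathrm{span}\{\overline v\}$. For a set $A$ and a subspace $E$, $A|E$ is the orthogonal projection of $A$ onto $E$, and $V_1$ is length. $h(K,u)=\max_{x\in K}\langle u,x\rangle$ is the support function. $S_1(K,\cdot)$ is the surface area measure (of order 1) of $K\in\mathcal{K}^2$: the finite Borel measure on $\mathbb{S}^1$ with $V(K,L)=\frac12\int_{\mathbb{S}^1}h(L,v)\,dS_1(K,v)$ for all $L\in\mathcal{K}^2$, where $V(\cdot,\cdot)$ is the mixed area (so $V(K,K)=V_2(K)$). *)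

theory Defs
  imports "HOL-Analysis.Analysis"
begin

section \<open>The Hausdorff metric\<close>

text \<open>
  The value 0 outside the nonempty bounded sets is a convention: \<^const>\<open>Metric_space\<close> asks
  for nonnegativity on the whole type, and suprema of unbounded or empty sets are unspecified.
\<close>

definition hausdorff_dist :: "'a::metric_space set \<Rightarrow> 'a set \<Rightarrow> real" where
  "hausdorff_dist A B =
     (if A \<noteq> {} \<and> bounded A \<and> B \<noteq> {} \<and> bounded B
      then max (SUP x\<in>A. infdist x B) (SUP y\<in>B. infdist y A) else 0)"

lemma bdd_above_infdist:
  assumes "bounded A"
  shows "bdd_above ((\<lambda>x. infdist x B) ` A)"
proof (cases "B = {}")
  case True
  then show ?thesis by (intro bdd_aboveI2[of _ _ 0]) (simp add: infdist_def)
next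
  case False
  then obtain b where b: "b \<in> B" by auto
  obtain e where "\<And>x. x \<in> A \<Longrightarrow> dist b x \<le> e"
    using assms bounded_any_center[of A b] by auto
  then show ?thesis
    using b by (intro bdd_aboveI2[of _ _ e]) (auto intro: infdist_le2 simp: dist_commute)
qed

lemma hausdorff_dist_le_iff:
  assumes "A \<noteq> {}" "bounded A" "B \<noteq> {}" "bounded B"
  shows "hausdorff_dist A B \<le> e \<longleftrightarrow> (\<forall>x\<in>A. infdist x B \<le> e) \<and> (\<forall>y\<in>B. infdist y A \<le> e)"
  using assms by (simp add: hausdorff_dist_def cSUP_le_iff bdd_above_infdist)

lemma hausdorff_dist_commute: "hausdorff_dist A B = hausdorff_dist B A"
  by (auto simp: hausdorff_dist_def max.commute)

lemma hausdorff_dist_nonneg: "0 \<le> hausdorff_dist A B"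
proof (cases "A \<noteq> {} \<and> bounded A \<and> B \<noteq> {} \<and> bounded B")
  case True
  then obtain a where "a \<in> A" by auto
  then have "infdist a B \<le> hausdorff_dist A B"
    using True hausdorff_dist_le_iff[of A B "hausdorff_dist A B"] by auto
  then show ?thesis using infdist_nonneg[of a B] by linarith
qed (simp only: hausdorff_dist_def if_False order_refl)

lemma infdist_le_hausdorff_dist:
  assumes "compact A" "A \<noteq> {}" "compact B" "B \<noteq> {}" "x \<in> A"
  shows "infdist x B \<le> hausdorff_dist A B"
  using assms hausdorff_dist_le_iff[of A B "hausdorff_dist A B"] compact_imp_bounded by blast

lemma hausdorff_dist_triangle:
  assumes "compact A" "A \<noteq> {}" "compact B" "B \<noteq> {}" "compact C" "C \<noteq> {}"
  shows "hausdorff_dist A C \<le> hausdorff_dist A B + hausdorff_dist B C"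
proof -
  have *: "infdist x C \<le> hausdorff_dist A B + hausdorff_dist B C"
    if "compact A" "A \<noteq> {}" "compact B" "B \<noteq> {}" "compact C" "C \<noteq> {}" "x \<in> A"
    for A B C :: "'a set" and x
  proof -
    have "continuous_on B (\<lambda>y. dist x y)" by (intro continuous_intros)
    then obtain y where y: "y \<in> B" "\<forall>z\<in>B. dist x y \<le> dist x z"
      using continuous_attains_inf[of B "\<lambda>y. dist x y"] \<open>compact B\<close> \<open>B \<noteq> {}\<close> by blast
    then have y_inf: "infdist x B = dist x y"
      unfolding infdist_notempty[OF \<open>B \<noteq> {}\<close>] by (intro cInf_eq_minimum) auto
    have "infdist x C \<le> infdist y C + dist x y"
      by (rule infdist_triangle)
    also have "\<dots> \<le> hausdorff_dist B C + hausdorff_dist A B"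
      using that y y_inf infdist_le_hausdorff_dist[of B C y] infdist_le_hausdorff_dist[of A B x]
      by simp
    finally show ?thesis by simp
  qed
  have "infdist y A \<le> hausdorff_dist A B + hausdorff_dist B C" if "y \<in> C" for y
    using *[of C B A y] assms that by (simp add: hausdorff_dist_commute)
  moreover have "infdist x C \<le> hausdorff_dist A B + hausdorff_dist B C" if "x \<in> A" for x
    using *[of A B C x] assms that by simp
  ultimately show ?thesis
    using assms by (simp add: hausdorff_dist_le_iff compact_imp_bounded)
qed

lemma hausdorff_dist_eq_0:
  assumes "compact A" "A \<noteq> {}" "compact B" "B \<noteq> {}"
  shows "hausdorff_dist A B = 0 \<longleftrightarrow> A = B"
proof
  assume "hausdorff_dist A B = 0"
  then have *: "\<forall>x\<in>A. infdist x B \<le> 0" "\<forall>y\<in>B. infdist y A \<le> 0"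
    using assms hausdorff_dist_le_iff[of A B 0] by (auto simp: compact_imp_bounded)
  then have "\<forall>x\<in>A. infdist x B = 0" "\<forall>y\<in>B. infdist y A = 0"
    using infdist_nonneg by (auto intro!: antisym)
  then show "A = B"
    using assms in_closed_iff_infdist_zero[of A] in_closed_iff_infdist_zero[of B]
      compact_imp_closed by blast
next
  assume "A = B"
  then have "hausdorff_dist A B \<le> 0"
    using assms by (simp add: hausdorff_dist_le_iff compact_imp_bounded)
  then show "hausdorff_dist A B = 0"
    using hausdorff_dist_nonneg[of A B] by linarith
qed


section \<open>Planar convex bodies\<close>

definition convex_bodies :: "(real^2) set set" where
  "convex_bodies = {K. K \<noteq> {} \<and> compact K \<and> convex K}"

definition convex_body_metric :: "(real^2) set metric" where
  "convex_body_metric = metric (convex_bodies, hausdorff_dist)"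

lemma Metric_space_convex_bodies: "Metric_space convex_bodies hausdorff_dist"
  by standard
    (auto simp: convex_bodies_def hausdorff_dist_nonneg hausdorff_dist_commute
      hausdorff_dist_eq_0 hausdorff_dist_triangle)

lemma mspace_convex_body_metric [simp]: "mspace convex_body_metric = convex_bodies"
  and mdist_convex_body_metric [simp]: "mdist convex_body_metric = hausdorff_dist"
  using Metric_space_convex_bodies
  by (simp_all add: convex_body_metric_def Metric_space.mspace_metric Metric_space.mdist_metric)

definition area :: "(real^2) set \<Rightarrow> real" where
  "area K = measure lebesgue K"

text \<open>
  Mixed area by polarization of
  \<open>area (s K + t L) = s^2 V(K,K) + 2 s t V(K,L) + t^2 V(L,L)\<close>.
\<close>

definition mixed_area :: "(real^2) set \<Rightarrow> (real^2) set \<Rightarrow> real" where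
  "mixed_area K L = (area (K + L) - area K - area L) / 2"

definition support_function :: "(real^2) set \<Rightarrow> real^2 \<Rightarrow> real" where
  "support_function K u = (SUP x\<in>K. u \<bullet> x)"

lemma support_function_is_max:
  assumes "K \<in> convex_bodies"
  shows "\<exists>x\<in>K. support_function K u = u \<bullet> x \<and> (\<forall>y\<in>K. u \<bullet> y \<le> u \<bullet> x)"
proof -
  have "continuous_on K (\<lambda>x. u \<bullet> x)" by (intro continuous_intros)
  then obtain x where x: "x \<in> K" "\<forall>y\<in>K. u \<bullet> y \<le> u \<bullet> x"
    using assms continuous_attains_sup[of K "\<lambda>x. u \<bullet> x"] by (auto simp: convex_bodies_def)
  then have "support_function K u = u \<bullet> x"
    unfolding support_function_def by (intro cSup_eq_maximum) auto
  with x show ?thesis by blast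
qed

definition is_surface_area_measure :: "(real^2) set \<Rightarrow> (real^2) measure \<Rightarrow> bool" where
  "is_surface_area_measure K S \<longleftrightarrow>
     sets S = sets (restrict_space borel (sphere 0 1)) \<and> finite_measure S \<and>
     (\<forall>L\<in>convex_bodies. mixed_area K L = 1 / 2 * (\<integral>v. support_function L v \<partial>S))"

definition surface_area_measure :: "(real^2) set \<Rightarrow> (real^2) measure" where
  "surface_area_measure K = (THE S. is_surface_area_measure K S)"


section \<open>The Grassmannian of lines\<close>

definition Gr :: "(real^2) set set" where
  "Gr = {E. subspace E \<and> dim E = 1}"

definition Gr_dist :: "(real^2) set \<Rightarrow> (real^2) set \<Rightarrow> real" where
  "Gr_dist E F = hausdorff_dist (E \<inter> sphere 0 1) (F \<inter> sphere 0 1)"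

definition Gr_metric :: "(real^2) set metric" where
  "Gr_metric = metric (Gr, Gr_dist)"

lemma Gr_obtain_unit:
  assumes "E \<in> Gr"
  obtains w where "norm w = 1" "E = span {w}"
proof -
  obtain B where B: "B \<subseteq> E" "independent B" "E \<subseteq> span B" "card B = dim E"
    using basis_exists[of E] by auto
  then obtain b where b: "B = {b}"
    using assms by (auto simp: Gr_def card_1_singleton_iff)
  have "b \<noteq> 0" using B b dependent_zero by blast
  have E: "E = span {b}"
    using B b assms span_minimal[of B E] by (auto simp: Gr_def)
  have "span {(1 / norm b) *\<^sub>R b} = span {b}"
  proof -
    have "span ((\<lambda>x. (1 / norm b) *\<^sub>R x) ` {b}) = span {b}"
      using \<open>b \<noteq> 0\<close> by (intro span_image_scale) auto
    then show ?thesis by simp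
  qed
  with E \<open>b \<noteq> 0\<close> show thesis
    by (intro that[of "(1 / norm b) *\<^sub>R b"]) auto
qed

lemma Gr_sphere:
  assumes "E \<in> Gr"
  shows "compact (E \<inter> sphere 0 1)" "E \<inter> sphere 0 1 \<noteq> {}" "span (E \<inter> sphere 0 1) = E"
proof -
  obtain w where w: "norm w = 1" "E = span {w}" using assms by (rule Gr_obtain_unit)
  have "closed E" using assms by (auto simp: Gr_def closed_subspace)
  then show "compact (E \<inter> sphere 0 1)" by (intro closed_Int_compact) auto
  have wE: "w \<in> E \<inter> sphere 0 1" using w by (auto intro: span_base)
  then show "E \<inter> sphere 0 1 \<noteq> {}" by auto
  have "E \<subseteq> span (E \<inter> sphere 0 1)"
    unfolding w(2) by (rule span_mono) (use wE w(2) in auto)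
  moreover have "span (E \<inter> sphere 0 1) \<subseteq> E"
    using assms by (intro span_minimal) (auto simp: Gr_def)
  ultimately show "span (E \<inter> sphere 0 1) = E" by auto
qed

lemma Metric_space_Gr: "Metric_space Gr Gr_dist"
proof
  fix E F assume "E \<in> Gr" "F \<in> Gr"
  then show "Gr_dist E F = 0 \<longleftrightarrow> E = F"
    unfolding Gr_dist_def using Gr_sphere by (metis hausdorff_dist_eq_0)
next
  fix E F H assume "E \<in> Gr" "F \<in> Gr" "H \<in> Gr"
  then show "Gr_dist E H \<le> Gr_dist E F + Gr_dist F H"
    unfolding Gr_dist_def by (intro hausdorff_dist_triangle Gr_sphere)
qed (simp_all add: Gr_dist_def hausdorff_dist_nonneg hausdorff_dist_commute)

lemma mspace_Gr_metric [simp]: "mspace Gr_metric = Gr"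
  and mdist_Gr_metric [simp]: "mdist Gr_metric = Gr_dist"
  using Metric_space_Gr
  by (simp_all add: Gr_metric_def Metric_space.mspace_metric Metric_space.mdist_metric)

definition bi_Lipschitz :: "((real^2) set \<Rightarrow> (real^2) set) \<Rightarrow> bool" where
  "bi_Lipschitz \<pi> \<longleftrightarrow>
     (\<exists>c>0. \<exists>C>0. \<forall>E\<in>Gr. \<forall>F\<in>Gr.
        c * Gr_dist E F \<le> Gr_dist (\<pi> E) (\<pi> F) \<and> Gr_dist (\<pi> E) (\<pi> F) \<le> C * Gr_dist E F)"

definition rotate90 :: "real^2 \<Rightarrow> real^2" where
  "rotate90 v = vector [- (v $ 2), v $ 1]"

definition orth_projection :: "(real^2) set \<Rightarrow> (real^2) set \<Rightarrow> (real^2) set" where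
  "orth_projection A E = {y \<in> E. \<exists>x\<in>A. x - y \<in> E\<^sup>\<bottom>}"

text \<open>
  Length of a subset \<open>A\<close> of the line \<open>E\<close>: its Lebesgue measure in the arc length coordinate
  on \<open>E\<close>. The two possible unit directions give the same value, see below.
\<close>

definition line_length :: "(real^2) set \<Rightarrow> (real^2) set \<Rightarrow> real" where
  "line_length E A = measure lebesgue {t :: real. t *\<^sub>R (SOME w. w \<in> E \<and> norm w = 1) \<in> A}"

lemma line_length_eq:
  assumes "E \<in> Gr" "w \<in> E" "norm w = 1"
  shows "line_length E A = measure lebesgue {t :: real. t *\<^sub>R w \<in> A}"
proof -
  define w' where "w' = (SOME w. w \<in> E \<and> norm w = 1)"
  have w': "w' \<in> E" "norm w' = 1"
    unfolding w'_def using someI[of "\<lambda>w. w \<in> E \<and> norm w = 1"] assms by auto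
  obtain u where u: "norm u = 1" "E = span {u}" using assms(1) by (rule Gr_obtain_unit)
  obtain a b where ab: "w = a *\<^sub>R u" "w' = b *\<^sub>R u"
    using assms(2) w'(1) u(2) by (auto simp: span_singleton)
  then have "\<bar>a\<bar> = 1" "\<bar>b\<bar> = 1" using assms(3) w'(2) u(1) by auto
  then consider "w' = w" | "w' = - w" using ab by (auto simp: abs_if split: if_splits)
  then show ?thesis
  proof cases
    case 1
    then show ?thesis by (simp add: line_length_def w'_def)
  next
    case 2
    have "{t. t *\<^sub>R w' \<in> A} = (\<lambda>t. (-1) *\<^sub>R t) ` {t. t *\<^sub>R w \<in> A}"
    proof (intro equalityI subsetI)
      fix t assume "t \<in> {t. t *\<^sub>R w' \<in> A}"
      then show "t \<in> (\<lambda>t. (-1) *\<^sub>R t) ` {t. t *\<^sub>R w \<in> A}"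
        using 2 by (intro image_eqI[of _ _ "- t"]) auto
    qed (use 2 in auto)
    then have "measure lebesgue {t. t *\<^sub>R w' \<in> A} = measure lebesgue {t. t *\<^sub>R w \<in> A}"
      using measure_lebesgue_affine[of "-1" "0::real" "{t. t *\<^sub>R w \<in> A}"] by simp
    then show ?thesis by (simp add: line_length_def w'_def)
  qed
qed


section \<open>Minkowski additive operators\<close>

text \<open>
  Operators are functions on all sets, of which only the values on convex bodies matter;
  \<^const>\<open>continuous_map\<close> includes that bodies are mapped to bodies.
\<close>

definition MAdd_s_plus :: "((real^2) set \<Rightarrow> (real^2) set) set" where
  "MAdd_s_plus = {\<Phi>.
     continuous_map (mtopology_of convex_body_metric) (mtopology_of convex_body_metric) \<Phi> \<and>
     (\<forall>K\<in>convex_bodies. \<forall>L\<in>convex_bodies. \<Phi> (K + L) = \<Phi> K + \<Phi> L) \<and>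
     (\<forall>K\<in>convex_bodies. \<forall>t. \<Phi> ((\<lambda>x. x + t) ` K) = \<Phi> K) \<and>
     (\<forall>K\<in>convex_bodies. \<Phi> (uminus ` K) = \<Phi> K \<and> \<Phi> K = uminus ` \<Phi> K)}"

definition VC :: "((real^2) set \<Rightarrow> (real^2) set) \<Rightarrow> bool" where
  "VC \<Phi> \<longleftrightarrow> (\<exists>c>0. \<exists>C>0. \<forall>K\<in>convex_bodies.
     c * area K \<le> area (\<Phi> K) \<and> area (\<Phi> K) \<le> C * area K)"

end

theory Submission
  imports Defs "HOL-Probability.Helly_Selection"
begin

text \<open>
  A segment \<open>[-e, e]\<close> has the surface area measure \<open>2 (\<delta>\<^bsub>e'\<^esub> + \<delta>\<^bsub>-e'\<^esub>)\<close> with \<open>e' = rotate90 e\<close>, so the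
  formula prescribes \<open>\<Phi> [-e, e] = [-p(e), p(e)]\<close>, where \<open>p(e)\<close> has length \<open>8 \<rho>(span e)\<close> and
  spans \<open>\<pi>(span e)\<close>. Conversely (VC) forces the images of segments to have area 0, hence to be segments.
  Everything else about \<open>\<Phi>\<close> follows: if a polygon \<open>P\<close> has sides with normals \<open>v\<close> and lengths \<open>c(v)\<close>,
  then \<open>P - P\<close> is the sum of the segments \<open>[-v', v'] c(v)/2\<close>, and \<open>2 \<Phi> P = \<Phi> (P - P)\<close>.
  The area of a zonotope \<open>\<Sum> [-a\<^sub>i, a\<^sub>i]\<close> is \<open>2 \<Sum> \<bar>det(a\<^sub>i, a\<^sub>j)\<bar>\<close>, and \<open>area P \<le> area (P - P) \<le> 32 area P\<close>,
  so that (VC) means that \<open>\<bar>det(p(e), p(f))\<bar>\<close> is comparable to \<open>\<bar>det(e, f)\<bar>\<close> for unit vectors. As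
  \<open>\<bar>det(e, f)\<bar>\<close> is comparable to the distance of the lines, this is the bi-Lipschitz property of \<open>\<pi>\<close>.

  Existence of surface area measures: Fubini's theorem gives \<open>V(T, L)\<close> for triangles \<open>T\<close>. The functionals
  \<open>V(P, _)\<close> of polygons are linear combinations of these since, for a Radon partition of the vertices,
  support functions satisfy \<open>h(S) + h(S - {c, d}) = h(S - {c}) + h(S - {d})\<close>. General bodies are handled by
  approximation and Helly's selection theorem.
\<close>

text \<open>The endpoint \<open>p e\<close> is determined only up to sign and is chosen pointwise,
  so continuity of \<open>p\<close> is not at hand. Analytic arguments go through
  \<open>seg_support \<Phi> e u\<close>, which is the absolute value of
  \<open>u \<bullet> p e\<close> for unit \<open>e\<close> and is continuous in \<open>e\<close>;
  the norm of \<open>p e\<close> and the slope of its line are recovered from it by polarization.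
  Mixed area is a polarization of area, so neither additivity nor monotonicity is available at the
  start. Both are derived when one argument is a polygon, from a finite representation with
  coefficients of arbitrary sign. Monotonicity then forces the coefficients to be nonnegative, which
  is what turns them into a measure and permits weak limits. \<open>surface_area_measure\<close> is
  a definite description, so the integral formula carries information only once existence and
  uniqueness hold for every body.\<close>

abbreviation h :: "(real^2) set \<Rightarrow> real^2 \<Rightarrow> real" where
  "h \<equiv> support_function"

abbreviation seg :: "'a::real_vector \<Rightarrow> 'a set" where
  "seg a \<equiv> closed_segment (- a) a"

abbreviation body_limit :: "(nat \<Rightarrow> (real^2) set) \<Rightarrow> (real^2) set \<Rightarrow> bool" where
  "body_limit P K \<equiv> (\<lambda>n. hausdorff_dist (P n) K) \<longlonglongrightarrow> 0"

subsection \<open>Convex bodies\<close>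

lemma convex_bodiesD:
  assumes "K \<in> convex_bodies"
  shows "K \<noteq> {}" "compact K" "convex K" "bounded K" "closed K"
  using assms by (auto simp: convex_bodies_def compact_imp_bounded compact_imp_closed)

lemma set_plus_mono: "A \<subseteq> B \<Longrightarrow> C \<subseteq> D \<Longrightarrow> A + C \<subseteq> B + D" for A :: "'a::plus set"
  by (auto simp: set_plus_def)

lemma convex_bodies_finite_hull:
  "finite S \<Longrightarrow> S \<noteq> {} \<Longrightarrow> convex hull S \<in> convex_bodies"
  by (simp add: convex_bodies_def finite_imp_compact_convex_hull)

lemma compact_set_plus: "compact A \<Longrightarrow> compact B \<Longrightarrow> compact (A + B)"
  for A B :: "'a::real_normed_vector set"
  using compact_sums[of A B] by (simp add: set_plus_def conj_ac) (metis (mono_tags, lifting) Collect_cong)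

lemma convex_bodies_plus: "K \<in> convex_bodies \<Longrightarrow> L \<in> convex_bodies \<Longrightarrow> K + L \<in> convex_bodies"
  unfolding convex_bodies_def
  by (auto simp: compact_set_plus convex_set_plus intro: set_plus_intro)

lemma convex_bodies_linear_image:
  fixes f :: "real^2 \<Rightarrow> real^2"
  shows "linear f \<Longrightarrow> K \<in> convex_bodies \<Longrightarrow> f ` K \<in> convex_bodies"
  by (auto simp: convex_bodies_def convex_linear_image
      intro: compact_continuous_image linear_continuous_on linear_conv_bounded_linear[THEN iffD1])

lemma convex_bodies_scaleR: "K \<in> convex_bodies \<Longrightarrow> (\<lambda>x. t *\<^sub>R x) ` K \<in> convex_bodies"
  by (rule convex_bodies_linear_image[OF linear_scale_self])

lemma convex_bodies_uminus: "K \<in> convex_bodies \<Longrightarrow> uminus ` K \<in> convex_bodies"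
  using convex_bodies_scaleR[of K "-1"] by simp

lemma convex_bodies_singleton [simp]: "{x} \<in> convex_bodies"
  and convex_bodies_segment [simp]: "closed_segment x y \<in> convex_bodies"
  and convex_bodies_cball: "0 \<le> r \<Longrightarrow> cball x r \<in> convex_bodies"
  by (auto simp: convex_bodies_def)

lemma convex_bodies_hull:
  "compact S \<Longrightarrow> S \<noteq> {} \<Longrightarrow> convex hull S \<in> convex_bodies" for S :: "(real^2) set"
  by (simp add: convex_bodies_def compact_convex_hull)

subsection \<open>Support functions\<close>

lemma support_function_eqI:
  assumes "x \<in> K" "\<And>y. y \<in> K \<Longrightarrow> u \<bullet> y \<le> u \<bullet> x"
  shows "h K u = u \<bullet> x"
  unfolding support_function_def using assms by (intro cSup_eq_maximum) auto

lemma support_function_ge: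
  assumes "K \<in> convex_bodies" "y \<in> K"
  shows "u \<bullet> y \<le> h K u"
  using support_function_is_max[OF assms(1), of u] assms(2) by auto

lemma support_function_le:
  assumes "K \<in> convex_bodies" "\<And>y. y \<in> K \<Longrightarrow> u \<bullet> y \<le> c"
  shows "h K u \<le> c"
  using support_function_is_max[OF assms(1), of u] assms(2) by auto

lemma support_function_plus:
  assumes "K \<in> convex_bodies" "L \<in> convex_bodies"
  shows "h (K + L) u = h K u + h L u"
proof -
  obtain x where x: "x \<in> K" "h K u = u \<bullet> x" "\<And>y. y \<in> K \<Longrightarrow> u \<bullet> y \<le> u \<bullet> x"
    using support_function_is_max[OF assms(1), of u] by auto
  obtain z where z: "z \<in> L" "h L u = u \<bullet> z" "\<And>y. y \<in> L \<Longrightarrow> u \<bullet> y \<le> u \<bullet> z"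
    using support_function_is_max[OF assms(2), of u] by auto
  have "h (K + L) u = u \<bullet> (x + z)"
    using x(1,3) z(1,3)
    by (intro support_function_eqI) (auto simp: set_plus_def inner_add_right intro!: add_mono)
  then show ?thesis using x z by (simp add: inner_add_right)
qed

lemma support_function_mono:
  assumes "K \<in> convex_bodies" "L \<in> convex_bodies" "K \<subseteq> L"
  shows "h K u \<le> h L u"
  using assms by (intro support_function_le) (auto intro: support_function_ge)

lemma support_function_linear_image:
  fixes f :: "real^2 \<Rightarrow> real^2"
  assumes "K \<in> convex_bodies" "\<And>x. v \<bullet> x = u \<bullet> f x"
  shows "h (f ` K) u = h K v"
  unfolding support_function_def using assms(2) by (simp add: image_image)

lemma support_function_scale:
  assumes "K \<in> convex_bodies" "0 \<le> t"
  shows "h K (t *\<^sub>R u) = t * h K u"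
proof -
  obtain x where x: "x \<in> K" "h K u = u \<bullet> x" "\<And>y. y \<in> K \<Longrightarrow> u \<bullet> y \<le> u \<bullet> x"
    using support_function_is_max[OF assms(1), of u] by auto
  have "h K (t *\<^sub>R u) = (t *\<^sub>R u) \<bullet> x"
    using x assms by (intro support_function_eqI) (auto intro: mult_left_mono)
  then show ?thesis using x by simp
qed

lemma support_function_0 [simp]: "K \<in> convex_bodies \<Longrightarrow> h K 0 = 0"
  using support_function_scale[of K 0 0] by simp

lemma support_function_scaleR_image:
  assumes "K \<in> convex_bodies" "0 \<le> t"
  shows "h ((\<lambda>x. t *\<^sub>R x) ` K) u = t * h K u"
  using support_function_linear_image[of K "t *\<^sub>R u" u "\<lambda>x. t *\<^sub>R x"] support_function_scale assms
  by simp

lemma support_function_uminus_image: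
  assumes "K \<in> convex_bodies"
  shows "h (uminus ` K) u = h K (- u)"
  using support_function_linear_image[of K "- u" u uminus] assms by simp

lemma support_function_singleton [simp]: "h {x} u = u \<bullet> x"
  by (simp add: support_function_def)

lemma support_function_hull_le_iff:
  assumes "finite S" "S \<noteq> {}"
  shows "h (convex hull S) u \<le> c \<longleftrightarrow> (\<forall>x\<in>S. u \<bullet> x \<le> c)"
proof
  assume *: "\<forall>x\<in>S. u \<bullet> x \<le> c"
  have "convex hull S \<subseteq> {x. u \<bullet> x \<le> c}"
    using * by (intro hull_minimal) (auto simp: convex_halfspace_le)
  then show "h (convex hull S) u \<le> c"
    using assms by (intro support_function_le convex_bodies_hull finite_imp_compact) auto
next
  assume "h (convex hull S) u \<le> c"
  then show "\<forall>x\<in>S. u \<bullet> x \<le> c"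
    using support_function_ge[of "convex hull S" _ u] assms
    by (meson convex_bodies_hull finite_imp_compact hull_inc order_trans)
qed

lemma support_function_hull:
  assumes "finite S" "S \<noteq> {}"
  shows "h (convex hull S) u = Max ((\<lambda>x. u \<bullet> x) ` S)"
proof (rule antisym)
  show "h (convex hull S) u \<le> Max ((\<lambda>x. u \<bullet> x) ` S)"
    using assms by (simp add: support_function_hull_le_iff)
  show "Max ((\<lambda>x. u \<bullet> x) ` S) \<le> h (convex hull S) u"
    using assms support_function_hull_le_iff[OF assms, of u "h (convex hull S) u"]
    by simp
qed

lemma support_function_segment:
  "h (closed_segment x y) u = max (u \<bullet> x) (u \<bullet> y)"
  using support_function_hull[of "{x, y}" u] by (simp add: segment_convex_hull)

lemma support_function_sym_segment:
  "h (seg a) u = \<bar>u \<bullet> a\<bar>"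
  by (simp add: support_function_segment)

lemma support_function_hull_Un:
  assumes "K \<in> convex_bodies" "L \<in> convex_bodies"
  shows "h (convex hull (K \<union> L)) u = max (h K u) (h L u)"
proof -
  have C: "convex hull (K \<union> L) \<in> convex_bodies"
    using assms by (intro convex_bodies_hull) (auto simp: convex_bodies_def)
  have "convex hull (K \<union> L) \<subseteq> {x. u \<bullet> x \<le> max (h K u) (h L u)}"
    using assms
    by (intro hull_minimal convex_halfspace_le) (auto simp: le_max_iff_disj support_function_ge)
  then have "h (convex hull (K \<union> L)) u \<le> max (h K u) (h L u)"
    by (intro support_function_le C) auto
  moreover have "h K u \<le> h (convex hull (K \<union> L)) u"
    "h L u \<le> h (convex hull (K \<union> L)) u"
    using assms C by (auto intro!: support_function_mono hull_inc)
  ultimately show ?thesis by simp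
qed

lemma support_function_cball:
  assumes "0 \<le> r"
  shows "h (cball 0 r) u = r * norm u"
proof (cases "u = 0")
  case True
  then show ?thesis using assms by (simp add: convex_bodies_cball)
next
  case False
  have "h (cball 0 r) u = u \<bullet> ((r / norm u) *\<^sub>R u)"
  proof (intro support_function_eqI)
    fix y :: "real^2" assume "y \<in> cball 0 r"
    then have "u \<bullet> y \<le> norm u * r"
      by (intro order_trans[OF norm_cauchy_schwarz] mult_left_mono) auto
    then show "u \<bullet> y \<le> u \<bullet> ((r / norm u) *\<^sub>R u)"
      using False by (simp add: dot_square_norm power2_eq_square mult.commute)
  qed (use False assms in auto)
  then show ?thesis using False by (simp add: dot_square_norm power2_eq_square)
qed

section \<open>Inclusions and Hausdorff distance in terms of support functions\<close>

lemma convex_body_subset_iff: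
  assumes "K \<in> convex_bodies" "L \<in> convex_bodies"
  shows "K \<subseteq> L \<longleftrightarrow> (\<forall>u. h K u \<le> h L u)"
proof
  assume *: "\<forall>u. h K u \<le> h L u"
  show "K \<subseteq> L"
  proof (rule ccontr)
    assume "\<not> K \<subseteq> L"
    then obtain z where z: "z \<in> K" "z \<notin> L" by auto
    then obtain a b where ab: "a \<bullet> z < b" "\<forall>x\<in>L. a \<bullet> x > b"
      using separating_hyperplane_closed_point[of L z] assms convex_bodiesD by blast
    have "h L (- a) \<le> - b"
      using ab assms by (intro support_function_le) (auto intro: less_imp_le)
    moreover have "(- a) \<bullet> z \<le> h K (- a)"
      using assms z by (intro support_function_ge)
    ultimately show False using * ab(1) by (smt (verit) inner_minus_left)
  qed
qed (use assms in \<open>auto intro: support_function_mono\<close>)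

lemma convex_body_eqI:
  assumes "K \<in> convex_bodies" "L \<in> convex_bodies" "\<And>u. h K u = h L u"
  shows "K = L"
  using convex_body_subset_iff[OF assms(1,2)] convex_body_subset_iff[OF assms(2,1)] assms(3) by auto

text \<open>Trades the Hausdorff distance for inclusions in outer parallel bodies. Support functions
  and area are monotone, so the estimates for both along convergent bodies start from these
  inclusions.\<close>

lemma convex_body_plus_cball:
  assumes "K \<in> convex_bodies" "\<And>x. x \<in> A \<Longrightarrow> infdist x K \<le> e"
  shows "A \<subseteq> K + cball 0 e"
proof
  fix x assume "x \<in> A"
  obtain y where y: "y \<in> K" "infdist x K = dist x y"
    using infdist_attains_inf[of K x] convex_bodiesD[OF assms(1)] by auto
  have "x = y + (x - y)" "x - y \<in> cball 0 e"
    using assms(2)[OF \<open>x \<in> A\<close>] y by (auto simp: dist_norm norm_minus_commute)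
  then show "x \<in> K + cball 0 e" using y by (metis set_plus_intro)
qed

lemma hausdorff_dist_convex_bodiesD:
  assumes "K \<in> convex_bodies" "L \<in> convex_bodies" "hausdorff_dist K L \<le> e"
  shows "K \<subseteq> L + cball 0 e" "L \<subseteq> K + cball 0 e"
proof -
  have "\<forall>x\<in>K. infdist x L \<le> e" "\<forall>x\<in>L. infdist x K \<le> e"
    using hausdorff_dist_le_iff[of K L e] assms convex_bodiesD by blast+
  then show "K \<subseteq> L + cball 0 e" "L \<subseteq> K + cball 0 e"
    using assms convex_body_plus_cball[of L K e] convex_body_plus_cball[of K L e] by blast+
qed

lemma hausdorff_dist_leI:
  assumes "K \<in> convex_bodies" "L \<in> convex_bodies" "K \<subseteq> L + cball 0 e" "L \<subseteq> K + cball 0 e"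
  shows "hausdorff_dist K L \<le> e"
proof -
  have "infdist x B \<le> e" if "x \<in> B + cball 0 e" for x and B :: "(real^2) set"
  proof -
    from that obtain b c where "x = b + c" "b \<in> B" "norm c \<le> e" by (auto simp: set_plus_def)
    then show ?thesis by (intro infdist_le2[of b]) (auto simp: dist_norm)
  qed
  then show ?thesis using hausdorff_dist_le_iff[of K L e] assms convex_bodiesD by blast
qed

lemma support_function_hausdorff:
  assumes "K \<in> convex_bodies" "L \<in> convex_bodies"
  shows "\<bar>h K u - h L u\<bar> \<le> hausdorff_dist K L * norm u"
proof -
  let ?e = "hausdorff_dist K L"
  have B: "cball 0 ?e \<in> convex_bodies" by (intro convex_bodies_cball hausdorff_dist_nonneg)
  have "h A u \<le> h A' u + ?e * norm u"
    if "A \<in> convex_bodies" "A' \<in> convex_bodies" "A \<subseteq> A' + cball 0 ?e" for A A'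
    using support_function_mono[OF that(1) convex_bodies_plus[OF that(2) B] that(3), of u]
      support_function_plus[OF that(2) B, of u] support_function_cball[OF hausdorff_dist_nonneg, of K L u]
    by simp
  from this[of K L] this[of L K] show ?thesis
    using hausdorff_dist_convex_bodiesD[OF assms order_refl] assms by (simp add: abs_le_iff)
qed

lemma support_function_bound:
  assumes "K \<in> convex_bodies" "K \<subseteq> cball 0 R" "0 \<le> R"
  shows "\<bar>h K u\<bar> \<le> R * norm u"
proof -
  obtain x where x: "x \<in> K" "h K u = u \<bullet> x"
    using support_function_is_max[OF assms(1), of u] by auto
  have "\<bar>u \<bullet> x\<bar> \<le> norm u * norm x" by (rule Cauchy_Schwarz_ineq2)
  also have "\<dots> \<le> norm u * R" using x assms by (intro mult_left_mono) auto
  finally show ?thesis using x by (simp add: mult.commute)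
qed

lemma convex_body_bound:
  assumes "K \<in> convex_bodies"
  obtains R where "R > 0" "K \<subseteq> cball 0 R"
  using bounded_subset_ballD[of K 0] convex_bodiesD[OF assms] ball_subset_cball by blast

lemma support_function_lipschitz:
  assumes "K \<in> convex_bodies" "K \<subseteq> cball 0 R" "0 \<le> R"
  shows "\<bar>h K u - h K v\<bar> \<le> R * norm (u - v)"
proof -
  have *: "h K u \<le> h K v + R * norm (u - v)" for u v
  proof (intro support_function_le assms)
    fix y assume y: "y \<in> K"
    have "u \<bullet> y = v \<bullet> y + (u - v) \<bullet> y" by (simp add: inner_diff_left)
    also have "\<dots> \<le> h K v + norm (u - v) * norm y"
      using assms y by (intro add_mono support_function_ge norm_cauchy_schwarz)
    also have "norm (u - v) * norm y \<le> norm (u - v) * R"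
      using assms y by (intro mult_left_mono) auto
    finally show "u \<bullet> y \<le> h K v + R * norm (u - v)" by (simp add: mult.commute)
  qed
  show ?thesis using *[of u v] *[of v u] by (simp add: abs_le_iff norm_minus_commute)
qed

lemma continuous_on_support_function:
  assumes "K \<in> convex_bodies"
  shows "continuous_on A (h K)"
proof -
  obtain R where R: "R > 0" "K \<subseteq> cball 0 R" using convex_body_bound[OF assms] .
  have "R-lipschitz_on A (h K)"
    using R assms support_function_lipschitz[of K R] by (auto simp: lipschitz_on_def dist_norm)
  then show ?thesis by (rule lipschitz_on_continuous_on)
qed

text \<open>Convexity matters: for other sets the sum can be larger. This yields the factor 4 in the
  areas of \<open>\<Phi> P + \<Phi> P\<close> and \<open>?Q + ?Q\<close>.\<close>

lemma convex_body_plus_self: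
  assumes "K \<in> convex_bodies"
  shows "K + K = (\<lambda>x. 2 *\<^sub>R x) ` K"
  using assms
  by (intro convex_body_eqI convex_bodies_plus convex_bodies_scaleR)
    (simp_all add: support_function_plus support_function_scaleR_image)

subsection \<open>Area\<close>

lemma area_nonneg [simp]: "0 \<le> area K"
  by (simp add: area_def)

lemma lmeasurable_convex_body: "K \<in> convex_bodies \<Longrightarrow> K \<in> lmeasurable"
  by (intro lmeasurable_compact convex_bodiesD)

lemma area_mono:
  assumes "K \<in> convex_bodies" "L \<in> convex_bodies" "K \<subseteq> L"
  shows "area K \<le> area L"
  unfolding area_def
  by (rule measure_mono_fmeasurable)
    (use assms lmeasurable_convex_body[of K] lmeasurable_convex_body[of L] in auto)

lemma area_singleton_plus [simp]: "area ({a} + K) = area K"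
  unfolding area_def translation_eq_singleton_plus[symmetric] by (rule measure_translation)

lemma area_plus_singleton [simp]: "area (K + {a}) = area K"
  using area_singleton_plus[of a K] by (simp only: add.commute)

lemma area_scaleR: "area ((\<lambda>x. t *\<^sub>R x) ` K) = t\<^sup>2 * area K"
  using measure_lebesgue_affine[of t 0 K] by (simp add: area_def)

lemma area_singleton [simp]: "area {x} = 0"
  by (simp add: area_def)

subsection \<open>Fubini in the plane\<close>

lemma vec2_nth [simp]: "(vector [x, y] :: real^2) $ 1 = x" "(vector [x, y] :: real^2) $ 2 = y"
  by (simp_all add: vector_2)

lemma inner_vec2: "u \<bullet> v = u $ 1 * v $ 1 + u $ 2 * v $ 2" for u v :: "real^2"
  by (simp add: inner_vec_def sum_2)

lemma vec2_eq_iff: "u = v \<longleftrightarrow> u $ 1 = v $ 1 \<and> u $ 2 = v $ 2" for u v :: "real^2"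
  by (simp add: vec_eq_iff forall_2)

lemma vec2_eta [simp]: "vector [v $ 1, v $ 2] = (v :: real^2)"
  by (simp add: vec2_eq_iff)

lemma vec2_axis: "vector [x, y] = x *\<^sub>R axis 1 1 + y *\<^sub>R (axis 2 1 :: real^2)"
  by (simp add: vec2_eq_iff axis_def)

lemma measurable_vec2 [measurable]:
  "(\<lambda>(x, y). vector [x, y] :: real^2) \<in> borel_measurable (lborel \<Otimes>\<^sub>M lborel)"
  unfolding vec2_axis by measurable

text \<open>\<open>lborel\<close> on \<open>real^2\<close> is not built from pairs, so Fubini's
  theorem has to be transported along the coordinate map; by \<open>lborel_eqI\<close> it is enough
  to compare boxes.\<close>

lemma lborel_vec2:
  "lborel = distr (lborel \<Otimes>\<^sub>M lborel) borel (\<lambda>(x, y). vector [x, y] :: real^2)"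
proof (rule lborel_eqI)
  fix l u :: "real^2"
  assume lu: "\<And>b. b \<in> Basis \<Longrightarrow> l \<bullet> b \<le> u \<bullet> b"
  have le: "l $ i \<le> u $ i" for i
    using lu[of "axis i 1"] by (simp add: inner_axis axis_in_Basis_iff)
  have "emeasure (distr (lborel \<Otimes>\<^sub>M lborel) borel (\<lambda>(x, y). vector [x, y] :: real^2)) (box l u)
      = emeasure (lborel \<Otimes>\<^sub>M lborel) ({l $ 1<..<u $ 1} \<times> {l $ 2<..<u $ 2})"
    by (subst emeasure_distr)
      (auto intro!: arg_cong2[where f = emeasure] simp: mem_box_cart forall_2 space_pair_measure)
  also have "\<dots> = ennreal (u $ 1 - l $ 1) * ennreal (u $ 2 - l $ 2)"
    using le by (subst lborel.emeasure_pair_measure_Times) auto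
  also have "\<dots> = (\<Prod>b\<in>Basis. (u - l) \<bullet> b)"
  proof -
    have "(\<Prod>b\<in>Basis. (u - l) \<bullet> b) = (\<Prod>i\<in>UNIV. (u - l) \<bullet> axis i 1)"
      unfolding Basis_vec_def
      by (subst prod.reindex[symmetric, unfolded o_def])
       (auto simp: inj_on_def axis_eq_axis intro!: prod.cong)
    also have "\<dots> = (u $ 1 - l $ 1) * (u $ 2 - l $ 2)"
      by (simp add: UNIV_2 inner_axis)
    finally show ?thesis using le by (simp add: ennreal_mult')
  qed
  finally show "emeasure (distr (lborel \<Otimes>\<^sub>M lborel) borel (\<lambda>(x, y). vector [x, y] :: real^2)) (box l u)
      = (\<Prod>b\<in>Basis. (u - l) \<bullet> b)" .
qed simp

definition between_graphs :: "real \<Rightarrow> real \<Rightarrow> (real \<Rightarrow> real) \<Rightarrow> (real \<Rightarrow> real) \<Rightarrow> (real^2) set" where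
  "between_graphs a b f g = {v. v $ 1 \<in> {a..b} \<and> f (v $ 1) \<le> v $ 2 \<and> v $ 2 \<le> g (v $ 1)}"

text \<open>Compactness of the region supplies its measurability; for the two graphs, gauge
  integrability is then enough.\<close>

lemma area_between_graphs:
  assumes "compact (between_graphs a b f g)" "\<And>x. x \<in> {a..b} \<Longrightarrow> f x \<le> g x"
    "(g has_integral G) {a..b}" "(f has_integral F) {a..b}"
  shows "area (between_graphs a b f g) = G - F"
proof -
  let ?K = "between_graphs a b f g"
  have K [measurable]: "?K \<in> sets borel"
    using assms(1) by (intro borel_closed compact_imp_closed)
  have I: "((\<lambda>x. g x - f x) has_integral G - F) {a..b}"
    using assms by (intro has_integral_diff)
  have nn: "0 \<le> G - F"
    using has_integral_nonneg[OF I] assms(2) by simp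
  note m = measurable_vec2
  have "emeasure lborel ?K = emeasure (lborel \<Otimes>\<^sub>M lborel) ((\<lambda>(x, y). vector [x, y] :: real^2) -` ?K)"
    by (subst lborel_vec2) (simp add: emeasure_distr m space_pair_measure)
  also have "\<dots> = (\<integral>\<^sup>+x. emeasure lborel {y. vector [x, y] \<in> ?K} \<partial>lborel)"
    using measurable_sets[OF m K]
    by (subst lborel.emeasure_pair_measure_alt) (simp_all add: space_pair_measure vimage_def)
  also have "\<dots> = (\<integral>\<^sup>+x. ennreal (g x - f x) * indicator {a..b} x \<partial>lborel)"
  proof (intro nn_integral_cong)
    fix x :: real
    have "{y. vector [x, y] \<in> ?K} = (if x \<in> {a..b} then {f x..g x} else {})"
      by (auto simp: between_graphs_def)
    then show "emeasure lborel {y. vector [x, y] \<in> ?K} = ennreal (g x - f x) * indicator {a..b} x"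
      using assms(2)[of x] by (simp add: indicator_def)
  qed
  also have "\<dots> = ennreal (G - F)"
    using assms(2) by (intro nn_integral_has_integral_lebesgue' I) simp
  finally have "measure lborel ?K = G - F"
    using nn by (simp add: measure_def)
  then show ?thesis by (simp add: area_def)
qed

text \<open>\<open>f\<close> and \<open>g\<close> are the least and the greatest height over an
  abscissa. Vertical sections are slices of a compact convex set, hence compact intervals.\<close>

lemma convex_body_between_graphs:
  assumes "K \<in> convex_bodies"
  obtains a b f g where "a \<le> b" "K = between_graphs a b f g" "\<And>x. x \<in> {a..b} \<Longrightarrow> f x \<le> g x"
proof -
  have im: "compact ((\<lambda>v. v $ i) ` S)" "convex ((\<lambda>v. v $ i) ` S)"
    if "compact S" "convex S" for S :: "(real^2) set" and i
    using that compact_continuous_image[of S "\<lambda>v. v $ i"]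
      convex_linear_image[OF bounded_linear.linear[OF bounded_linear_vec_nth], of S i]
    by (simp_all add: continuous_intros)
  have "K \<noteq> {}" "compact ((\<lambda>v. v $ 1) ` K)" "convex ((\<lambda>v. v $ 1) ` K)"
    using convex_bodiesD[OF assms] by (simp_all add: im)
  then obtain a b where ab: "(\<lambda>v. v $ 1) ` K = {a..b}"
    using connected_compact_interval_1[of "(\<lambda>v. v $ 1) ` K"] by (auto simp: convex_connected)
  define g where "g x = Sup {y. vector [x, y] \<in> K}" for x
  define f where "f x = Inf {y. vector [x, y] \<in> K}" for x
  have sl: "{y. vector [x, y] \<in> K} = {f x..g x} \<and> f x \<le> g x" if "x \<in> {a..b}" for x
  proof -
    have "{y. vector [x, y] \<in> K} = (\<lambda>v. v $ 2) ` (K \<inter> {v. v $ 1 = x})" (is "?S = _")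
    proof (intro set_eqI iffI)
      fix y assume "y \<in> ?S"
      then show "y \<in> (\<lambda>v. v $ 2) ` (K \<inter> {v. v $ 1 = x})"
        by (intro image_eqI[of _ _ "vector [x, y]"]) auto
    qed auto
    moreover have "{v::real^2. v $ 1 = x} = {v. axis 1 1 \<bullet> v = x}"
      by (simp add: inner_axis inner_commute)
    then have "closed {v::real^2. v $ 1 = x}" "convex {v::real^2. v $ 1 = x}"
      using closed_hyperplane convex_hyperplane by metis+
    ultimately have "compact ?S" "convex ?S"
      using convex_bodiesD[OF assms] im[of "K \<inter> {v. v $ 1 = x}" 2]
      by (simp_all add: compact_Int_closed convex_Int)
    then obtain c d where cd: "?S = {c..d}"
      using connected_compact_interval_1[of ?S] by (auto simp: convex_connected)
    have "x \<in> (\<lambda>v. v $ 1) ` K" using that ab by simp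
    then obtain v where "v \<in> K" "x = v $ 1" by (elim imageE)
    then have "vector [x, v $ 2] \<in> K" by simp
    then have "v $ 2 \<in> {c..d}" unfolding cd[symmetric] by simp
    then have "f x = c" "g x = d" "c \<le> d"
      unfolding f_def g_def cd by simp_all
    then show ?thesis unfolding cd by simp
  qed
  show thesis
  proof
    show "a \<le> b" using ab \<open>K \<noteq> {}\<close> by (metis atLeastatMost_empty_iff2 empty_is_image)
    show "K = between_graphs a b f g"
    proof (intro set_eqI)
      fix v :: "real^2"
      show "v \<in> K \<longleftrightarrow> v \<in> between_graphs a b f g"
      proof (cases "v $ 1 \<in> {a..b}")
        case True
        have "v \<in> K \<longleftrightarrow> v $ 2 \<in> {y. vector [v $ 1, y] \<in> K}" by simp
        also have "\<dots> \<longleftrightarrow> v $ 2 \<in> {f (v $ 1)..g (v $ 1)}" using sl[OF True] by metis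
        finally show ?thesis using True by (simp add: between_graphs_def)
      next
        case False
        then have "v \<notin> K" unfolding ab[symmetric] by blast
        then show ?thesis using False by (auto simp: between_graphs_def)
      qed
    qed
  qed (use sl in auto)
qed

lemma between_graphs_top_bottom:
  assumes "x \<in> {a..b}" "f x \<le> g x"
  shows "vector [x, g x] \<in> between_graphs a b f g" "vector [x, f x] \<in> between_graphs a b f g"
  using assms by (auto simp: between_graphs_def)

subsection \<open>Stretching a unimodal function\<close>

text \<open>The graph is cut at the peak \<open>m\<close>, its right part is moved by 1, and the gap
  is bridged at peak height. For a unimodal function this is the supremum over a window of length 1,
  that is, the upper boundary after adding a horizontal unit segment.\<close>

definition stretch :: "real \<Rightarrow> (real \<Rightarrow> real) \<Rightarrow> real \<Rightarrow> real" where
  "stretch m \<phi> x = (if x \<le> m then \<phi> x else if x \<le> m + 1 then \<phi> m else \<phi> (x - 1))"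

definition unimodal_on :: "real \<Rightarrow> real \<Rightarrow> real \<Rightarrow> (real \<Rightarrow> real) \<Rightarrow> bool" where
  "unimodal_on a m b \<phi> \<longleftrightarrow> a \<le> m \<and> m \<le> b \<and> mono_on {a..m} \<phi> \<and> antimono_on {m..b} \<phi>"

text \<open>Between \<open>x\<close> and the peak, concavity keeps the graph above a chord that
  starts at height \<open>\<phi> x\<close> and does not descend.\<close>

lemma unimodal_onI:
  assumes m: "m \<in> {a..b}" and max: "\<And>x. x \<in> {a..b} \<Longrightarrow> \<phi> x \<le> \<phi> m" and c: "concave_on {a..b} \<phi>"
  shows "unimodal_on a m b \<phi>"
proof -
  have *: "\<phi> x \<le> \<phi> y" if "x \<in> {a..b}" "y \<in> closed_segment x m" for x y
  proof -
    from that(2) obtain t where t: "0 \<le> t" "t \<le> 1" "y = (1 - t) *\<^sub>R x + t *\<^sub>R m"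
      by (auto simp: in_segment)
    have "\<phi> x = (1 - t) * \<phi> x + t * \<phi> x" by (simp add: algebra_simps)
    also have "\<dots> \<le> (1 - t) * \<phi> x + t * \<phi> m"
      using max[OF that(1)] t by (intro add_left_mono mult_left_mono)
    also have "\<dots> \<le> \<phi> y"
      using c t that(1) m unfolding concave_on_iff by auto
    finally show ?thesis .
  qed
  show ?thesis
    unfolding unimodal_on_def
  proof (intro conjI monotone_onI)
    fix x y assume "x \<in> {a..m}" "y \<in> {a..m}" "x \<le> y"
    then show "\<phi> x \<le> \<phi> y" using m by (intro *) (auto simp: closed_segment_eq_real_ivl)
  next
    fix x y assume "x \<in> {m..b}" "y \<in> {m..b}" "x \<le> y"
    then show "\<phi> x \<ge> \<phi> y" using m by (intro *) (auto simp: closed_segment_eq_real_ivl)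
  qed (use m in auto)
qed

text \<open>Left of the peak a shift to the right increases the value, the bridge has maximal
  height, and beyond the bridge the effective shift \<open>z - 1\<close> moves the argument back
  towards the peak.\<close>

lemma stretch_ge:
  assumes "unimodal_on a m b \<phi>" "x \<in> {a..b}" "0 \<le> z" "z \<le> 1"
  shows "\<phi> x \<le> stretch m \<phi> (x + z)"
proof -
  have am: "a \<le> m" "m \<le> b" and mono: "mono_on {a..m} \<phi>" and anti: "antimono_on {m..b} \<phi>"
    using assms by (auto simp: unimodal_on_def)
  note mono' = monotone_onD[OF mono] and anti' = monotone_onD[OF anti]
  consider "x + z \<le> m" | "m < x + z" "x + z \<le> m + 1" | "m + 1 < x + z" by linarith
  then show ?thesis
  proof cases
    case 1
    then show ?thesis using mono'[of x "x + z"] assms am by (simp add: stretch_def)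
  next
    case 2
    have "\<phi> x \<le> \<phi> m"
      using mono'[of x m] anti'[of m x] assms(2) am by (cases "x \<le> m") auto
    then show ?thesis using 2 by (simp add: stretch_def)
  next
    case 3
    then have "\<phi> x \<le> \<phi> (x + z - 1)" using anti'[of "x + z - 1" x] assms am by simp
    then show ?thesis using 3 by (simp add: stretch_def)
  qed
qed

text \<open>Monotone functions are integrable, which settles each side of the peak without
  continuity at the ends of the interval. The bridge of length 1 contributes
  \<open>\<phi> m\<close>.\<close>

lemma unimodal_has_integral:
  assumes "unimodal_on a m b \<phi>"
  shows "(\<phi> has_integral integral {a..b} \<phi>) {a..b}"
    and "(stretch m \<phi> has_integral integral {a..b} \<phi> + \<phi> m) {a..b + 1}"
proof -
  have am: "a \<le> m" "m \<le> b" and mono: "mono_on {a..m} \<phi>" and anti: "antimono_on {m..b} \<phi>"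
    using assms by (auto simp: unimodal_on_def)
  have 1: "(\<phi> has_integral integral {a..m} \<phi>) {a..m}"
    using integrable_on_mono_on[OF mono] by (rule integrable_integral)
  have "mono_on {m..b} (\<lambda>x. - \<phi> x)" using anti by (auto simp: monotone_on_def)
  then have "\<phi> integrable_on {m..b}"
    using integrable_on_mono_on integrable_neg_iff by blast
  then have 2: "(\<phi> has_integral integral {m..b} \<phi>) {m..b}" by (rule integrable_integral)
  note 12 = has_integral_combine[OF am 1 2]
  then show "(\<phi> has_integral integral {a..b} \<phi>) {a..b}" by (simp add: integral_unique)
  have "(stretch m \<phi> has_integral integral {a..m} \<phi>) {a..m}"
    using 1 by (rule has_integral_eq[rotated]) (simp add: stretch_def)
  moreover have "(stretch m \<phi> has_integral \<phi> m) {m..m + 1}"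
  proof (rule has_integral_eq)
    show "((\<lambda>x. \<phi> m) has_integral \<phi> m) {m..m + 1}"
      using has_integral_const_real[of "\<phi> m" m "m + 1"] by simp
  qed (auto simp: stretch_def)
  moreover have "(stretch m \<phi> has_integral integral {m..b} \<phi>) {m + 1..b + 1}"
  proof -
    have "((\<lambda>x. \<phi> (x - 1)) has_integral integral {m..b} \<phi>) {m + 1..b + 1}"
      using has_integral_affinity[OF 2[folded cbox_interval], of 1 "-1"]
      by (simp add: add.commute)
    then show ?thesis by (rule has_integral_eq[rotated]) (auto simp: stretch_def)
  qed
  ultimately have "(stretch m \<phi> has_integral integral {a..m} \<phi> + \<phi> m + integral {m..b} \<phi>) {a..b + 1}"
    using am by (intro has_integral_combine[of a "m + 1" "b + 1"] has_integral_combine[of a m "m + 1"]) auto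
  then show "(stretch m \<phi> has_integral integral {a..b} \<phi> + \<phi> m) {a..b + 1}"
    using 12 by (simp add: integral_unique algebra_simps)
qed

subsection \<open>Minkowski sums with triangles and segments\<close>

lemma between_graphs_concave:
  assumes "convex (between_graphs a b f g)" "\<And>x. x \<in> {a..b} \<Longrightarrow> f x \<le> g x"
  shows "concave_on {a..b} g" "convex_on {a..b} f"
proof -
  have *: "g ((1 - t) * x + t * y) \<ge> (1 - t) * g x + t * g y \<and>
           f ((1 - t) * x + t * y) \<le> (1 - t) * f x + t * f y"
    if "x \<in> {a..b}" "y \<in> {a..b}" "0 \<le> t" "t \<le> 1" for x y t
  proof -
    have "(1 - t) *\<^sub>R vector [x, k x] + t *\<^sub>R vector [y, k y] \<in> between_graphs a b f g"
      if "k = f \<or> k = g" for k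
      using that \<open>x \<in> _\<close> \<open>y \<in> _\<close> \<open>0 \<le> t\<close> \<open>t \<le> 1\<close> assms
      by (intro convexD_alt between_graphs_top_bottom) (auto intro: between_graphs_top_bottom)
    from this[of f] this[of g] show ?thesis by (simp add: between_graphs_def)
  qed
  have "convex {a..b}" by simp
  moreover have "(1 - t) * g x + t * g y \<le> g ((1 - t) *\<^sub>R x + t *\<^sub>R y)"
    "f ((1 - t) *\<^sub>R x + t *\<^sub>R y) \<le> (1 - t) * f x + t * f y"
    if "0 < t" "t < 1" "x \<in> {a..b}" "y \<in> {a..b}" for t x y
    using *[of x y t] that by simp_all
  ultimately show "convex_on {a..b} f"
    by (intro convex_onI) auto
  show "concave_on {a..b} g"
    unfolding concave_on_def
  proof (intro convex_onI)
    fix t x y :: real assume "0 < t" "t < 1" "x \<in> {a..b}" "y \<in> {a..b}"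
    then show "- g ((1 - t) *\<^sub>R x + t *\<^sub>R y) \<le> (1 - t) * - g x + t * - g y"
      using *[of x y t] by simp
  qed simp
qed

definition std_triangle :: "real \<Rightarrow> (real^2) set" where
  "std_triangle \<beta> = {v. 0 \<le> v $ 1 \<and> v $ 1 \<le> 1 \<and> 0 \<le> v $ 2 \<and> v $ 2 \<le> \<beta> * v $ 1}"

text \<open>The arguments of \<open>h L\<close> are the outer normals of the triangle scaled by its
  side lengths. Subtracting \<open>\<beta> * x\<close> makes the sloping side horizontal, so that
  adding the triangle stretches \<open>\<phi>\<close>, the sheared upper graph, at its peak;
  likewise it stretches \<open>\<psi>\<close>, the negative of the lower graph. The two bridges
  contribute the values of \<open>h L\<close> at the normals of the sloping and the bottom
  side.\<close>

lemma area_plus_std_triangle: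
  assumes L: "L \<in> convex_bodies" and T: "std_triangle \<beta> \<in> convex_bodies" and \<beta>: "0 \<le> \<beta>"
  shows "area (L + std_triangle \<beta>) = area L + h L (vector [0, -1])
    + h L (vector [\<beta>, 0]) + h L (vector [- \<beta>, 1]) + \<beta> / 2"
proof -
  obtain a b f g where ab: "a \<le> b" and L_eq: "L = between_graphs a b f g"
    and fg: "\<And>x. x \<in> {a..b} \<Longrightarrow> f x \<le> g x"
    using convex_body_between_graphs[OF L] by blast
  note L' = L[unfolded L_eq]
  have top_bot: "vector [x, g x] \<in> L" "vector [x, f x] \<in> L" if "x \<in> {a..b}" for x
    using between_graphs_top_bottom[of x a b f g] fg that by (auto simp: L_eq)
  have conc: "concave_on {a..b} g" "convex_on {a..b} f"
    using between_graphs_concave[of a b f g] convex_bodiesD[OF L'] fg by auto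
  define \<phi> where "\<phi> x = g x - \<beta> * x" for x
  define \<psi> where "\<psi> x = - f x" for x
  have c\<phi>: "concave_on {a..b} \<phi>"
    using conc(1) unfolding \<phi>_def concave_on_iff by (simp add: algebra_simps)
  have c\<psi>: "concave_on {a..b} \<psi>"
    using conc(2) unfolding \<psi>_def concave_on_def by simp
  obtain p where p: "p \<in> L" "h L (vector [- \<beta>, 1]) = vector [- \<beta>, 1] \<bullet> p"
      "\<And>y. y \<in> L \<Longrightarrow> vector [- \<beta>, 1] \<bullet> y \<le> vector [- \<beta>, 1] \<bullet> p"
    using support_function_is_max[OF L, of "vector [- \<beta>, 1]"] by blast
  obtain q where q: "q \<in> L" "h L (vector [0, -1]) = vector [0, -1] \<bullet> q"
      "\<And>y. y \<in> L \<Longrightarrow> vector [0, -1] \<bullet> y \<le> vector [0, -1] \<bullet> q"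
    using support_function_is_max[OF L, of "vector [0, -1]"] by blast
  define m where "m = p $ 1"
  define n where "n = q $ 1"
  have mn: "m \<in> {a..b}" "n \<in> {a..b}" "p $ 2 \<le> g m" "f n \<le> q $ 2"
    using p(1) q(1) by (auto simp: L_eq between_graphs_def m_def n_def)
  have pm: "p $ 2 = g m"
    using p(3)[OF top_bot(1)[OF mn(1)]] mn by (simp add: inner_vec2 m_def)
  have qn: "q $ 2 = f n"
    using q(3)[OF top_bot(2)[OF mn(2)]] mn by (simp add: inner_vec2 n_def)
  have hm: "h L (vector [- \<beta>, 1]) = \<phi> m"
    using p(2) pm by (simp add: inner_vec2 m_def \<phi>_def)
  have hn: "h L (vector [0, -1]) = \<psi> n"
    using q(2) qn by (simp add: inner_vec2 n_def \<psi>_def)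
  have um: "unimodal_on a m b \<phi>"
  proof (rule unimodal_onI[OF mn(1) _ c\<phi>])
    fix x assume "x \<in> {a..b}"
    from p(3)[OF top_bot(1)[OF this]] show "\<phi> x \<le> \<phi> m"
      using pm by (simp add: inner_vec2 m_def \<phi>_def)
  qed
  have un: "unimodal_on a n b \<psi>"
  proof (rule unimodal_onI[OF mn(2) _ c\<psi>])
    fix x assume "x \<in> {a..b}"
    from q(3)[OF top_bot(2)[OF this]] show "\<psi> x \<le> \<psi> n"
      using qn by (simp add: inner_vec2 n_def \<psi>_def)
  qed
  have hb: "h L (vector [\<beta>, 0]) = \<beta> * b"
  proof -
    have "h L (vector [\<beta>, 0]) = vector [\<beta>, 0] \<bullet> (vector [b, g b] :: real^2)"
    proof (rule support_function_eqI)
      fix y assume "y \<in> L"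
      then show "vector [\<beta>, 0] \<bullet> y \<le> vector [\<beta>, 0] \<bullet> (vector [b, g b] :: real^2)"
        using \<beta> by (auto simp: inner_vec2 L_eq between_graphs_def intro!: mult_left_mono)
    qed (use top_bot(1)[of b] ab in auto)
    then show ?thesis by (simp add: inner_vec2)
  qed
  define G where "G x = stretch m \<phi> x + \<beta> * x" for x
  define F where "F x = - stretch n \<psi> x" for x
  let ?M = "L + std_triangle \<beta>"
  have M: "?M \<in> convex_bodies" using L T by (rule convex_bodies_plus)
  have tT: "vector [z, \<beta> * z] \<in> std_triangle \<beta>" "vector [z, 0] \<in> std_triangle \<beta>"
    if "0 \<le> z" "z \<le> 1" for z
    using that \<beta> by (auto simp: std_triangle_def)
  have sum: "vector [x, y] \<in> ?M"
    if "vector [x - z, y - w] \<in> L" "vector [z, w] \<in> std_triangle \<beta>" for x y z w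
  proof -
    have "vector [x, y] = vector [x - z, y - w] + (vector [z, w] :: real^2)"
      by (simp add: vec2_eq_iff)
    then show ?thesis using that by (metis set_plus_intro)
  qed
  \<comment> \<open>The three pieces of \<open>stretch\<close> are reached with the horizontal
    offset 0, \<open>x - m\<close> and 1 in the triangle, always along its sloping side.\<close>
  have tops: "vector [x, G x] \<in> ?M" if "x \<in> {a..b+1}" for x
  proof -
    consider "x \<le> m" | "m < x" "x \<le> m + 1" | "m + 1 < x" by linarith
    then show ?thesis
    proof cases
      case 1
      then show ?thesis using that mn(1) top_bot(1)[of x] tT[of 0]
        by (intro sum[of _ 0 _ 0]) (auto simp: G_def stretch_def \<phi>_def)
    next
      case 2
      then show ?thesis using that mn(1) top_bot(1)[of m] tT[of "x - m"]
        by (intro sum[of _ "x - m" _ "\<beta> * (x - m)"]) (auto simp: G_def stretch_def \<phi>_def algebra_simps)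
    next
      case 3
      then show ?thesis using that mn(1) top_bot(1)[of "x - 1"] tT[of 1]
        by (intro sum[of _ 1 _ "\<beta>"]) (auto simp: G_def stretch_def \<phi>_def algebra_simps)
    qed
  qed
  have bots: "vector [x, F x] \<in> ?M" if "x \<in> {a..b+1}" for x
  proof -
    consider "x \<le> n" | "n < x" "x \<le> n + 1" | "n + 1 < x" by linarith
    then show ?thesis
    proof cases
      case 1
      then show ?thesis using that mn(2) top_bot(2)[of x] tT[of 0]
        by (intro sum[of _ 0 _ 0]) (auto simp: F_def stretch_def \<psi>_def)
    next
      case 2
      then show ?thesis using that mn(2) top_bot(2)[of n] tT[of "x - n"]
        by (intro sum[of _ "x - n" _ 0]) (auto simp: F_def stretch_def \<psi>_def)
    next
      case 3
      then show ?thesis using that mn(2) top_bot(2)[of "x - 1"] tT[of 1]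
        by (intro sum[of _ 1 _ 0]) (auto simp: F_def stretch_def \<psi>_def)
    qed
  qed
  have sub: "v \<in> between_graphs a (b + 1) F G \<and> F (v $ 1) \<le> G (v $ 1)" if "v \<in> ?M" for v
  proof -
    from that obtain l t where lt: "v = l + t" "l \<in> L" "t \<in> std_triangle \<beta>"
      by (auto simp: set_plus_def)
    have l: "l $ 1 \<in> {a..b}" "f (l $ 1) \<le> l $ 2" "l $ 2 \<le> g (l $ 1)"
      using lt by (auto simp: L_eq between_graphs_def)
    have t: "0 \<le> t $ 1" "t $ 1 \<le> 1" "0 \<le> t $ 2" "t $ 2 \<le> \<beta> * t $ 1"
      using lt by (auto simp: std_triangle_def)
    have "\<phi> (l $ 1) \<le> stretch m \<phi> (v $ 1)" "\<psi> (l $ 1) \<le> stretch n \<psi> (v $ 1)"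
      using stretch_ge[OF um l(1) t(1,2)] stretch_ge[OF un l(1) t(1,2)] lt by simp_all
    then have "v $ 2 \<le> G (v $ 1)" "F (v $ 1) \<le> v $ 2"
      using l t lt by (simp_all add: G_def F_def \<phi>_def \<psi>_def algebra_simps)
    then show ?thesis using l t lt by (auto simp: between_graphs_def)
  qed
  have M_eq: "?M = between_graphs a (b + 1) F G"
  proof (intro equalityI subsetI)
    fix v assume v: "v \<in> between_graphs a (b + 1) F G"
    then have x: "v $ 1 \<in> {a..b+1}" by (simp add: between_graphs_def)
    have "v $ 2 \<in> closed_segment (F (v $ 1)) (G (v $ 1))"
      using v by (auto simp: between_graphs_def closed_segment_eq_real_ivl)
    then obtain t where t: "0 \<le> t" "t \<le> 1" "v $ 2 = (1 - t) *\<^sub>R F (v $ 1) + t *\<^sub>R G (v $ 1)"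
      by (auto simp: in_segment)
    have "v = (1 - t) *\<^sub>R vector [v $ 1, F (v $ 1)] + t *\<^sub>R vector [v $ 1, G (v $ 1)]"
      using t by (simp add: vec2_eq_iff algebra_simps)
    also have "\<dots> \<in> ?M"
      using t bots[OF x] tops[OF x] convex_bodiesD(3)[OF M] by (intro convexD_alt) auto
    finally show "v \<in> ?M" .
  qed (use sub in auto)
  have FG: "F x \<le> G x" if "x \<in> {a..b+1}" for x
    using sub[OF tops[OF that]] by simp
  define I where "I = integral {a..b} \<phi>"
  define J where "J = integral {a..b} \<psi>"
  have lin: "((\<lambda>x. \<beta> * x) has_integral \<beta> * (d\<^sup>2 / 2 - c\<^sup>2 / 2)) {c..d}" if "c \<le> d" for c d :: real
    using has_integral_mult_right[OF ident_has_integral[OF that], of \<beta>]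
    by (simp only: diff_divide_distrib)
  have "((\<lambda>x. \<phi> x + \<beta> * x) has_integral I + \<beta> * (b\<^sup>2 / 2 - a\<^sup>2 / 2)) {a..b}"
    using unimodal_has_integral(1)[OF um] lin[OF ab] by (intro has_integral_add) (auto simp: I_def)
  then have g_int: "(g has_integral I + \<beta> * (b\<^sup>2 / 2 - a\<^sup>2 / 2)) {a..b}"
    by (simp add: \<phi>_def)
  have "((\<lambda>x. - \<psi> x) has_integral - J) {a..b}"
    using unimodal_has_integral(1)[OF un] by (intro has_integral_neg) (auto simp: J_def)
  then have f_int: "(f has_integral - J) {a..b}" by (simp add: \<psi>_def)
  have area_L: "area L = I + \<beta> * (b\<^sup>2 / 2 - a\<^sup>2 / 2) - (- J)"
    unfolding L_eq using L' fg g_int f_int by (intro area_between_graphs convex_bodiesD) auto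
  have G_int: "(G has_integral I + \<phi> m + \<beta> * ((b + 1)\<^sup>2 / 2 - a\<^sup>2 / 2)) {a..b+1}"
    unfolding G_def using unimodal_has_integral(2)[OF um] lin[of a "b + 1"] ab
    by (intro has_integral_add) (auto simp: I_def)
  have F_int: "(F has_integral - (J + \<psi> n)) {a..b+1}"
    unfolding F_def using unimodal_has_integral(2)[OF un] by (intro has_integral_neg) (auto simp: J_def)
  \<comment> \<open>Compared with \<open>L\<close>, the sloping term is integrated up to
    \<open>b + 1\<close>. This adds \<open>\<beta> * (b + 1 / 2)\<close>: the vertical side
    contributes \<open>\<beta> * b\<close>, and the remaining \<open>\<beta> / 2\<close> is the area
    of the triangle.\<close>
  have "area ?M = I + \<phi> m + \<beta> * ((b + 1)\<^sup>2 / 2 - a\<^sup>2 / 2) - (- (J + \<psi> n))"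
    unfolding M_eq using M FG G_int F_int
    by (intro area_between_graphs) (auto simp: M_eq dest: convex_bodiesD(2))
  then show ?thesis
    using area_L hm hn hb by (simp add: power2_eq_square algebra_simps add_divide_distrib)
qed

section \<open>Determinants, quarter turns and linear frames\<close>

definition det2 :: "real^2 \<Rightarrow> real^2 \<Rightarrow> real" where
  "det2 a b = a $ 1 * b $ 2 - a $ 2 * b $ 1"

lemma rotate90_nth [simp]: "rotate90 v $ 1 = - v $ 2" "rotate90 v $ 2 = v $ 1"
  by (simp_all add: rotate90_def)

lemma inner_rotate90: "rotate90 a \<bullet> b = det2 a b" "a \<bullet> rotate90 b = - det2 a b"
  by (simp_all add: det2_def inner_vec2)

lemma linear_rotate90: "linear rotate90"
  by (intro linearI) (simp_all add: vec2_eq_iff)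

lemma rotate90_minus [simp]: "rotate90 (- v) = - rotate90 v"
  and rotate90_scaleR: "rotate90 (c *\<^sub>R v) = c *\<^sub>R rotate90 v"
  and rotate90_rotate90 [simp]: "rotate90 (rotate90 v) = - v"
  and rotate90_0 [simp]: "rotate90 0 = 0"
  by (simp_all add: vec2_eq_iff)

lemma norm_rotate90 [simp]: "norm (rotate90 v) = norm v"
  by (simp add: norm_eq_sqrt_inner inner_vec2 add.commute)

lemma det2_rotate90 [simp]: "det2 (rotate90 a) (rotate90 b) = det2 a b"
  by (simp add: det2_def)

context
  fixes p w :: "real^2" and f :: "real^2 \<Rightarrow> real^2"
  defines "f \<equiv> \<lambda>x. x $ 1 *\<^sub>R p + x $ 2 *\<^sub>R w"
  assumes pos: "0 < det2 p w"
begin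

lemma linear_frame: "linear f"
  by (intro linearI) (simp_all add: f_def algebra_simps)

lemma area_frame_image: "K \<in> convex_bodies \<Longrightarrow> area (f ` K) = det2 p w * area K"
proof -
  assume "K \<in> convex_bodies"
  have "det (matrix f) = det2 p w"
    by (simp add: det_2 matrix_def f_def det2_def axis_def)
  then show ?thesis
    using measure_linear_image[OF linear_frame lmeasurable_convex_body[OF \<open>K \<in> _\<close>]] pos
    by (simp add: area_def)
qed

text \<open>\<open>- rotate90 a\<close> is the outer normal of a side \<open>a\<close> traversed
  counterclockwise. Because \<open>det2 (f a) (f x) = det2 p w * det2 a x\<close>, normals written
  in this way transform without the inverse transpose of \<open>f\<close>.\<close>

lemma support_function_frame_image:
  assumes "K \<in> convex_bodies"
  shows "h (f ` K) (- rotate90 (f a)) = det2 p w * h K (- rotate90 a)"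
proof -
  have "h (f ` K) (- rotate90 (f a)) = h K (det2 p w *\<^sub>R - rotate90 a)"
    using assms
    by (intro support_function_linear_image) (simp_all add: inner_rotate90 f_def det2_def algebra_simps)
  then show ?thesis
    using support_function_scale[OF assms, of "det2 p w" "- rotate90 a"] pos by simp
qed

lemma frame_preimage:
  assumes "L \<in> convex_bodies"
  obtains L' where "L' \<in> convex_bodies" "L = f ` L'"
proof -
  \<comment> \<open>Cramer's rule: the coordinates of \<open>y\<close> in the basis
    \<open>p\<close>, \<open>w\<close>.\<close>
  define g where "g y = (vector [det2 y w, det2 p y] /\<^sub>R det2 p w :: real^2)" for y
  have "linear g"
    by (intro linearI) (simp_all add: g_def det2_def vec2_eq_iff algebra_simps)
  moreover have "f (g y) = y" for y
    using pos unfolding vec2_eq_iff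
    by (simp add: g_def f_def) (simp add: field_simps, simp add: det2_def algebra_simps)
  ultimately show thesis
    using assms by (intro that[of "g ` L"] convex_bodies_linear_image) (auto simp: image_image)
qed

text \<open>Every term for the standard triangle is multiplied by \<open>det2 p w\<close>. The image
  has the sides \<open>p\<close>, \<open>\<beta> *\<^sub>R w\<close> and
  \<open>- (p + \<beta> *\<^sub>R w)\<close>, whose clockwise quarter turns appear here.\<close>

lemma area_plus_frame_triangle:
  assumes L: "L \<in> convex_bodies" and T: "std_triangle \<beta> \<in> convex_bodies" and \<beta>: "0 \<le> \<beta>"
  shows "area (L + f ` std_triangle \<beta>) = area L + h L (- rotate90 p)
    + h L (- rotate90 (\<beta> *\<^sub>R w)) + h L (rotate90 (p + \<beta> *\<^sub>R w))
    + det2 p w * \<beta> / 2"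
proof -
  obtain L' where L': "L' \<in> convex_bodies" "L = f ` L'" using frame_preimage[OF L] .
  have "L + f ` std_triangle \<beta> = f ` (L' + std_triangle \<beta>)"
  proof -
    have "f (x + y) = f x + f y" for x y using linear_add[OF linear_frame] .
    then show ?thesis unfolding L'(2) set_plus_def by (auto simp: image_iff) metis+
  qed
  then have "area (L + f ` std_triangle \<beta>) = det2 p w * area (L' + std_triangle \<beta>)"
    using L' T by (simp add: area_frame_image convex_bodies_plus)
  also have "\<dots> = det2 p w * area L' + det2 p w * h L' (- rotate90 (vector [1, 0]))
    + det2 p w * h L' (- rotate90 (vector [0, \<beta>]))
    + det2 p w * h L' (- rotate90 (vector [-1, -\<beta>])) + det2 p w * \<beta> / 2"
  proof -
    have "- rotate90 (vector [1, 0]) = vector [0, -1]" "- rotate90 (vector [0, \<beta>]) = vector [\<beta>, 0]"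
      "- rotate90 (vector [-1, -\<beta>]) = vector [-\<beta>, 1]"
      by (simp_all add: vec2_eq_iff)
    then show ?thesis
      using area_plus_std_triangle[OF L'(1) T \<beta>] by (simp add: distrib_left)
  qed
  also have "\<dots> = area L + h L (- rotate90 (f (vector [1, 0])))
    + h L (- rotate90 (f (vector [0, \<beta>]))) + h L (- rotate90 (f (vector [-1, -\<beta>])))
    + det2 p w * \<beta> / 2"
    unfolding L'(2) area_frame_image[OF L'(1)] support_function_frame_image[OF L'(1)] ..
  also have "- rotate90 (f (vector [-1, -\<beta>])) = rotate90 (p + \<beta> *\<^sub>R w)"
    by (simp add: f_def vec2_eq_iff)
  finally show ?thesis by (simp add: f_def)
qed

end

lemma std_triangle_1: "std_triangle 1 = convex hull {0, vector [1, 0], vector [1, 1]}"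
proof (intro set_eqI iffI)
  fix v assume v: "v \<in> std_triangle 1"
  then have "0 \<le> 1 - v $ 1 \<and> 0 \<le> v $ 1 - v $ 2 \<and> 0 \<le> v $ 2
    \<and> (1 - v $ 1) + (v $ 1 - v $ 2) + v $ 2 = 1
    \<and> v = (1 - v $ 1) *\<^sub>R 0 + (v $ 1 - v $ 2) *\<^sub>R vector [1, 0] + v $ 2 *\<^sub>R vector [1, 1]"
    by (simp add: std_triangle_def vec2_eq_iff)
  then show "v \<in> convex hull {0, vector [1, 0], vector [1, 1]}"
    unfolding convex_hull_3 by blast
next
  fix v :: "real^2" assume "v \<in> convex hull {0, vector [1, 0], vector [1, 1]}"
  then show "v \<in> std_triangle 1"
    unfolding convex_hull_3 by (auto simp: std_triangle_def)
qed

lemma std_triangle_0: "std_triangle 0 = closed_segment 0 (vector [1, 0])"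
proof (intro set_eqI iffI)
  fix v assume v: "v \<in> std_triangle 0"
  then show "v \<in> closed_segment 0 (vector [1, 0])"
    unfolding in_segment by (intro exI[of _ "v $ 1"]) (auto simp: std_triangle_def vec2_eq_iff)
qed (auto simp: in_segment std_triangle_def)

text \<open>The frame \<open>p\<close>, \<open>q - p\<close> sends the vertices 0, (1, 0), (1, 1) to
  0, \<open>p\<close>, \<open>q\<close>.\<close>

lemma area_plus_triangle:
  assumes L: "L \<in> convex_bodies" and pos: "0 < det2 p q"
  shows "area (L + convex hull {0, p, q}) = area L + h L (- rotate90 p)
    + h L (- rotate90 (q - p)) + h L (rotate90 q) + det2 p q / 2"
proof -
  define f :: "real^2 \<Rightarrow> real^2" where "f x = x $ 1 *\<^sub>R p + x $ 2 *\<^sub>R (q - p)" for x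
  have D: "det2 p (q - p) = det2 p q" by (simp add: det2_def algebra_simps)
  have pos': "0 < det2 p (q - p)" using pos D by simp
  have "f ` std_triangle 1 = convex hull {0, p, q}"
    unfolding std_triangle_1 using linear_frame[OF pos']
    by (subst convex_hull_linear_image) (simp_all add: f_def[abs_def])
  moreover have "std_triangle 1 \<in> convex_bodies"
    unfolding std_triangle_1 by (rule convex_bodies_finite_hull) auto
  ultimately show ?thesis
    using area_plus_frame_triangle[OF pos' L, of 1] by (simp add: f_def[abs_def] D)
qed

text \<open>The degenerate case \<open>\<beta> = 0\<close>; the quarter turn completes
  \<open>p\<close> to a positively oriented frame.\<close>

lemma area_plus_segment:
  assumes L: "L \<in> convex_bodies"
  shows "area (L + closed_segment 0 p) = area L + h L (- rotate90 p) + h L (rotate90 p)"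
proof (cases "p = 0")
  case True
  then show ?thesis using L by simp
next
  case False
  define f :: "real^2 \<Rightarrow> real^2" where "f x = x $ 1 *\<^sub>R p + x $ 2 *\<^sub>R rotate90 p" for x
  have "det2 p (rotate90 p) = p \<bullet> p" by (simp add: det2_def inner_vec2)
  then have pos: "0 < det2 p (rotate90 p)" using False by simp
  have "f ` std_triangle 0 = closed_segment 0 p"
    unfolding std_triangle_0 using closed_segment_linear_image[OF linear_frame[OF pos], of 0 "vector [1, 0]"]
    by (simp add: f_def[abs_def])
  then show ?thesis
    using area_plus_frame_triangle[OF pos L, of 0] L by (simp add: f_def[abs_def] std_triangle_0)
qed

subsection \<open>Mixed areas of polygons\<close>

lemma mixed_area_commute: "mixed_area K L = mixed_area L K"
  by (simp add: mixed_area_def add.commute)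

lemma mixed_area_singleton_plus [simp]:
  "mixed_area ({a} + K) L = mixed_area K L" "mixed_area L ({a} + K) = mixed_area L K"
  by (simp_all add: mixed_area_def add.assoc add.left_commute[of L])

lemma area_plus: "area (K + L) = area K + 2 * mixed_area K L + area L"
  unfolding mixed_area_def by argo

lemma closed_segment_translate: "closed_segment a b = {a} + closed_segment 0 (b - a)"
  for a :: "'a::real_vector"
  using closed_segment_translation[of a 0 "b - a"] by (simp add: translation_eq_singleton_plus)

lemma area_segment [simp]: "area (closed_segment a b) = 0" for a :: "real^2"
  using area_plus_segment[of "{0}" "b - a"] by (simp add: closed_segment_translate[of a b] add.commute[of "{0}"])

lemma mixed_area_segment:
  assumes "K \<in> convex_bodies"
  shows "2 * mixed_area K (closed_segment 0 p) = h K (- rotate90 p) + h K (rotate90 p)"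
  using area_plus_segment[OF assms, of p] by (simp add: mixed_area_def)

lemma mixed_area_sym_segment:
  assumes "K \<in> convex_bodies"
  shows "mixed_area K (seg a) = h K (rotate90 a) + h K (- rotate90 a)"
proof -
  have "seg a = {- a} + closed_segment 0 (2 *\<^sub>R a)"
    using closed_segment_translate[of "- a" a] by (simp add: scaleR_2)
  then show ?thesis
    using mixed_area_segment[OF assms, of "2 *\<^sub>R a"] support_function_scale[OF assms, of 2 "rotate90 a"]
      support_function_scale[OF assms, of 2 "- rotate90 a"] by (simp add: rotate90_scaleR)
qed

text \<open>The shape of the mixed area with a fixed polygon, as a functional of the other body.
  Coefficients of both signs are allowed, so that the class is closed under differences; their
  nonnegativity is recovered in \<open>atomic_body_weights\<close>.\<close>

definition atomic :: "((real^2) set \<Rightarrow> real) \<Rightarrow> bool" where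
  "atomic \<Lambda> \<longleftrightarrow> (\<exists>F c. finite F \<and> F \<subseteq> sphere 0 1 \<and>
     (\<forall>L\<in>convex_bodies. \<Lambda> L = (\<Sum>v\<in>F. c v * h L v)))"

lemma atomicI:
  assumes "finite F" "F \<subseteq> sphere 0 1"
    "\<And>L. L \<in> convex_bodies \<Longrightarrow> \<Lambda> L = (\<Sum>v\<in>F. c v * h L v)"
  shows "atomic \<Lambda>"
  using assms unfolding atomic_def by blast

lemma atomic_support_function: "atomic (\<lambda>L. h L x)"
proof (cases "x = 0")
  case True
  then show ?thesis by (intro atomicI[of "{}"]) auto
next
  case False
  show ?thesis
  proof (rule atomicI[of "{x /\<^sub>R norm x}" _ "\<lambda>_. norm x"])
    fix L :: "(real^2) set" assume "L \<in> convex_bodies"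
    then show "h L x = (\<Sum>v\<in>{x /\<^sub>R norm x}. norm x * h L v)"
      using False support_function_scale[of L "inverse (norm x)" x] by simp
  qed (use False in auto)
qed

lemma atomic_cong:
  "atomic \<Lambda> \<Longrightarrow> (\<And>L. L \<in> convex_bodies \<Longrightarrow> \<Lambda>' L = \<Lambda> L) \<Longrightarrow> atomic \<Lambda>'"
  unfolding atomic_def by metis

lemma atomic_lincomb:
  assumes "atomic \<Lambda>" "atomic \<Lambda>'"
  shows "atomic (\<lambda>L. s * \<Lambda> L + t * \<Lambda>' L)"
proof -
  obtain F c where F: "finite F" "F \<subseteq> sphere 0 1"
    "\<And>L. L \<in> convex_bodies \<Longrightarrow> \<Lambda> L = (\<Sum>v\<in>F. c v * h L v)"
    using assms(1) unfolding atomic_def by blast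
  obtain F' c' where F': "finite F'" "F' \<subseteq> sphere 0 1"
    "\<And>L. L \<in> convex_bodies \<Longrightarrow> \<Lambda>' L = (\<Sum>v\<in>F'. c' v * h L v)"
    using assms(2) unfolding atomic_def by blast
  have ext: "(\<Sum>v\<in>F \<union> F'. (if v \<in> A then d v else 0) * h L v) = (\<Sum>v\<in>A. d v * h L v)"
    if "A = F \<or> A = F'" for A d L
    using that F(1) F'(1) by (intro sum.mono_neutral_cong_right) auto
  show ?thesis
  proof (rule atomicI[of "F \<union> F'" _ "\<lambda>v. s * (if v \<in> F then c v else 0) + t * (if v \<in> F' then c' v else 0)"])
    fix L :: "(real^2) set" assume "L \<in> convex_bodies"
    then show "s * \<Lambda> L + t * \<Lambda>' L = (\<Sum>v\<in>F \<union> F'. (s * (if v \<in> F then c v else 0) +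
        t * (if v \<in> F' then c' v else 0)) * h L v)"
      using ext[of F c L] ext[of F' c' L] F(3) F'(3)
      by (simp add: distrib_right sum.distrib mult.assoc flip: sum_distrib_left)
  qed (use F F' in auto)
qed

lemma atomic_add: "atomic \<Lambda> \<Longrightarrow> atomic \<Lambda>' \<Longrightarrow> atomic (\<lambda>L. \<Lambda> L + \<Lambda>' L)"
  using atomic_lincomb[of \<Lambda> \<Lambda>' 1 1] by simp

lemma atomic_plus:
  assumes "atomic \<Lambda>" "L \<in> convex_bodies" "L' \<in> convex_bodies"
  shows "\<Lambda> (L + L') = \<Lambda> L + \<Lambda> L'"
  using assms unfolding atomic_def
  by (auto simp: convex_bodies_plus support_function_plus algebra_simps sum.distrib)

abbreviation atomic_body :: "(real^2) set \<Rightarrow> bool" where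
  "atomic_body K \<equiv> atomic (mixed_area K)"

text \<open>Bilinearity is not known yet. The area of \<open>K + B + L\<close> is expanded once by
  splitting off \<open>B\<close>, where \<open>atomic_plus\<close> separates \<open>K\<close> from
  \<open>L\<close>, and once by splitting off \<open>L\<close>.\<close>

lemma mixed_area_plus_left:
  assumes "atomic_body B" "B \<in> convex_bodies" "K \<in> convex_bodies" "L \<in> convex_bodies"
  shows "mixed_area (K + B) L = mixed_area K L + mixed_area B L"
proof -
  have "area (K + B + L) = area (K + L) + 2 * mixed_area B (K + L) + area B"
    using area_plus[of B "K + L"] by (simp add: ac_simps)
  then show ?thesis
    using atomic_plus[OF assms(1,3,4)] area_plus[of K B] area_plus[of "K + B" L] area_plus[of K L]
      mixed_area_commute[of K B] by simp
qed

lemma atomic_body_plus: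
  assumes "atomic_body A" "atomic_body B" "A \<in> convex_bodies" "B \<in> convex_bodies"
  shows "atomic_body (A + B)"
  using atomic_add[OF assms(1,2)] by (rule atomic_cong) (use assms mixed_area_plus_left in auto)

lemma atomic_body_cancel:
  assumes "atomic_body (K + B)" "atomic_body B" "K \<in> convex_bodies" "B \<in> convex_bodies"
  shows "atomic_body K"
  using atomic_lincomb[OF assms(1,2), of 1 "-1"]
  by (rule atomic_cong) (use assms mixed_area_plus_left in auto)

lemma atomic_body_translate: "atomic_body K \<Longrightarrow> atomic_body ({a} + K)"
  by (rule atomic_cong) auto

lemma atomic_body_segment: "atomic_body (closed_segment a b)"
proof -
  have "atomic_body (closed_segment 0 p)" for p
    using atomic_lincomb[OF atomic_support_function atomic_support_function, of "1/2" "- rotate90 p" "1/2" "rotate90 p"]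
  proof (rule atomic_cong)
    fix L :: "(real^2) set" assume "L \<in> convex_bodies"
    then show "mixed_area (closed_segment 0 p) L = 1 / 2 * h L (- rotate90 p) + 1 / 2 * h L (rotate90 p)"
      using mixed_area_segment[of L p] by (simp add: mixed_area_commute[of "closed_segment 0 p"])
  qed
  then show ?thesis
    unfolding closed_segment_translate[of a b] by (intro atomic_body_translate)
qed

lemma atomic_body_triangle_0:
  assumes "0 < det2 p q"
  shows "atomic_body (convex hull {0, p, q})"
proof -
  have a: "area (convex hull {0, p, q}) = det2 p q / 2"
    using area_plus_triangle[of "{0}" p q] assms by (simp add: add.commute[of "{0}"])
  have "atomic (\<lambda>L. h L (- rotate90 p) + h L (- rotate90 (q - p))
      + h L (rotate90 q))" (is "atomic ?\<Lambda>")
    by (intro atomic_add atomic_support_function)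
  from atomic_lincomb[OF this this, of "1/2" 0] show ?thesis
  proof (rule atomic_cong)
    fix L :: "(real^2) set" assume "L \<in> convex_bodies"
    then show "mixed_area (convex hull {0, p, q}) L = 1 / 2 * ?\<Lambda> L + 0 * ?\<Lambda> L"
      using area_plus_triangle[of L p q] assms a
      by (simp add: mixed_area_commute[of _ L]) (simp add: mixed_area_def)
  qed
qed

lemma convex_body_on_line:
  assumes K: "K \<in> convex_bodies" and w: "w \<noteq> 0" and det: "\<And>x. x \<in> K \<Longrightarrow> det2 w x = 0"
  obtains c d where "K = closed_segment (c *\<^sub>R w) (d *\<^sub>R w)"
proof -
  have ww: "w \<bullet> w \<noteq> 0" using w by simp
  have "compact ((\<bullet>) w ` K)" "convex ((\<bullet>) w ` K)"
    using convex_bodiesD[OF K] compact_continuous_image[of K "(\<bullet>) w"]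
      convex_linear_image[OF bounded_linear.linear[OF bounded_linear_inner_right], of K w]
    by (simp_all add: continuous_intros)
  then obtain c d where cd: "(\<bullet>) w ` K = {c..d}"
    using connected_compact_interval_1[of "(\<bullet>) w ` K"] by (auto simp: convex_connected)
  have "c \<le> d" using cd convex_bodiesD(1)[OF K] by (metis atLeastatMost_empty_iff2 image_is_empty)
  \<comment> \<open>The inverse of the inner product with \<open>w\<close> on the line spanned by
    \<open>w\<close>, which contains \<open>K\<close>.\<close>
  define f where "f s = (s / (w \<bullet> w)) *\<^sub>R w" for s
  have "f (w \<bullet> x) = x" if "x \<in> K" for x
  proof -
    have "(w \<bullet> x) *\<^sub>R w = (w \<bullet> w) *\<^sub>R x"
      using det[OF that] by (simp add: vec2_eq_iff inner_vec2 det2_def) algebra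
    then have "(1 / (w \<bullet> w)) *\<^sub>R ((w \<bullet> x) *\<^sub>R w) = (1 / (w \<bullet> w)) *\<^sub>R ((w \<bullet> w) *\<^sub>R x)"
      by simp
    then show ?thesis using ww by (simp add: f_def)
  qed
  then have "K = f ` ((\<bullet>) w ` K)" by (force simp: image_image)
  also have "\<dots> = f ` closed_segment c d"
    using \<open>c \<le> d\<close> cd by (simp add: closed_segment_eq_real_ivl)
  also have "\<dots> = closed_segment (f c) (f d)"
    by (intro closed_segment_linear_image[symmetric] linearI)
      (simp_all add: f_def add_divide_distrib scaleR_add_left)
  finally show thesis using that by (simp add: f_def)
qed

lemma flat_triangle:
  assumes "det2 p q = 0"
  obtains a b where "convex hull {0, p, q} = closed_segment a b"
proof (cases "p = 0 \<and> q = 0")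
  case True
  then show ?thesis using that[of 0 0] by simp
next
  case False
  define w where "w = (if p \<noteq> 0 then p else q)"
  have w: "w \<noteq> 0" using False by (auto simp: w_def)
  have "convex {x. det2 w x = 0}"
    using convex_hyperplane[of "rotate90 w" 0] by (simp add: inner_rotate90)
  then have "convex hull {0, p, q} \<subseteq> {x. det2 w x = 0}"
    using assms by (intro hull_minimal) (auto simp: det2_def w_def)
  moreover have "convex hull {0, p, q} \<in> convex_bodies"
    by (rule convex_bodies_finite_hull) auto
  ultimately show ?thesis using convex_body_on_line[OF _ w] that by blast
qed

lemma det2_commute: "det2 q p = - det2 p q"
  by (simp add: det2_def mult.commute)

lemma convex_hull_translate_3: "convex hull {a, b, c} = {a} + convex hull {0, b - a, c - a}"
proof -
  have "{a, b, c} = {a} + {0, b - a, c - a}" by (auto simp: set_plus_def)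
  then show ?thesis by (simp add: convex_hull_set_plus)
qed

lemma atomic_body_triangle: "atomic_body (convex hull {a, b, c})"
proof -
  have "atomic_body (convex hull {0, p, q})" for p q
  proof -
    consider "0 < det2 p q" | "0 < det2 q p" | "det2 p q = 0"
      using det2_commute[of p q] by linarith
    then show ?thesis
    proof cases
      case 2
      then show ?thesis using atomic_body_triangle_0[of q p] by (simp add: insert_commute)
    next
      case 3
      then show ?thesis using flat_triangle[of p q] atomic_body_segment by metis
    qed (rule atomic_body_triangle_0)
  qed
  then show ?thesis unfolding convex_hull_translate_3[of a b c] by (rule atomic_body_translate)
qed

text \<open>Induction on the number of points. From four points on, a Radon partition writes the
  polygon as a difference, in the sense of Minkowski sums, of polygons with fewer points;
  \<open>atomic_body_cancel\<close> carries out the subtraction.\<close>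

lemma atomic_body_polygon:
  assumes "finite S" "S \<noteq> {}"
  shows "atomic_body (convex hull S)"
  using assms
proof (induction "card S" arbitrary: S rule: less_induct)
  case less
  have cb: "convex hull T \<in> convex_bodies" if "T \<subseteq> S" "T \<noteq> {}" for T
    using that less.prems by (intro convex_bodies_hull finite_imp_compact) (auto intro: finite_subset)
  have IH: "atomic_body (convex hull T)" if "T \<subset> S" "T \<noteq> {}" for T
    using that less.prems by (intro less.hyps) (auto intro: psubset_card_mono finite_subset)
  show ?case
  proof (cases "card S \<le> 3")
    case True
    have "\<exists>a b c. S = {a, b, c}"
    proof -
      have "card S = 1 \<or> card S = 2 \<or> card S = 3"
        using True less.prems card_0_eq[of S] by linarith
      then show ?thesis
        by (auto simp: card_1_singleton_iff card_2_iff card_3_iff)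
    qed
    then show ?thesis using atomic_body_triangle by auto
  next
    case False
    then obtain C where C: "C \<subseteq> S" "card C = 4" "finite C"
      using obtain_subset_with_card_n[of 4 S] by auto
    have "affine_dependent C"
      using C by (intro affine_dependent_biggerset) auto
    then obtain M P where MP: "M \<inter> P = {}" "M \<union> P = C" "convex hull M \<inter> convex hull P \<noteq> {}"
      using Radon_partition[OF C(3)] by blast
    have "card M + card P = 4"
      using MP C card_Un_disjoint[of M P] by (metis finite_Un)
    \<comment> \<open>The two parts have four points together, so one of them has at most two; call
      it \<open>M\<close>.\<close>
    then have "\<exists>M P. M \<inter> P = {} \<and> M \<union> P \<subseteq> S \<and> convex hull M \<inter> convex hull P \<noteq> {} \<and> card M \<le> 2"
      using MP C(1) by (cases "card M \<le> 2") (blast, intro exI[of _ P] exI[of _ M], auto)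
    then obtain M P z where MP: "M \<inter> P = {}" "M \<subseteq> S" "P \<subseteq> S" "card M \<le> 2"
      "z \<in> convex hull M" "z \<in> convex hull P"
      by auto
    have fin: "finite M" "finite P" using MP(2,3) less.prems(1) finite_subset by blast+
    have ne: "M \<noteq> {}" "P \<noteq> {}" using MP by auto
    then have "card M = 1 \<or> card M = 2" using MP(4) fin card_0_eq[of M] by linarith
    then obtain c d where cd: "M = {c, d}"
      by (auto simp: card_1_singleton_iff card_2_iff)
    define R where "R = S - {c, d}"
    have R: "finite R" "R \<noteq> {}" "P \<subseteq> R" "S = insert c (insert d R)" "R \<subset> S" "c \<notin> R" "d \<notin> R"
      using MP less.prems ne cd by (auto simp: R_def)
    let ?h = "\<lambda>T u. h (convex hull T) u"
    have ins: "?h (insert x T) u = max (u \<bullet> x) (?h T u)" if "finite T" "T \<noteq> {}" for x T u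
      using that by (simp add: support_function_hull Max_insert)
    \<comment> \<open>The common point \<open>z\<close> lies on the segment from \<open>c\<close> to
      \<open>d\<close> and in the hull of \<open>R\<close>, so its height is at least the smaller
      end height and at most the largest height of \<open>R\<close>.\<close>
    have cross: "min (u \<bullet> c) (u \<bullet> d) \<le> ?h R u" for u
    proof -
      have "- (u \<bullet> z) \<le> ?h {c, d} (- u)"
        using support_function_ge[OF cb[of M] MP(5), of "- u"] MP ne cd by simp
      also have "\<dots> = - min (u \<bullet> c) (u \<bullet> d)"
        by (simp add: support_function_hull)
      finally have "min (u \<bullet> c) (u \<bullet> d) \<le> u \<bullet> z" by simp
      also have "\<dots> \<le> ?h R u"
        using MP(6) hull_mono[OF R(3)] R by (intro support_function_ge cb) auto
      finally show ?thesis .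
    qed
    show ?thesis
    proof (cases "c = d")
      case True
      have "?h S u = ?h R u" for u
        using ins[of R c u] R cross[of u] True by simp
      then have "convex hull S = convex hull R"
        using R less.prems by (intro convex_body_eqI cb) auto
      then show ?thesis using IH R by simp
    next
      case False
      \<comment> \<open>On support functions this reads
        \<open>max a (max b r) + r = max a r + max b r\<close>, which holds exactly when
        \<open>min a b \<le> r\<close>; that is \<open>cross\<close>.\<close>
      have "convex hull S + convex hull R = convex hull (insert c R) + convex hull (insert d R)"
      proof (intro convex_body_eqI convex_bodies_plus cb)
        fix u
        have "?h S u = max (u \<bullet> c) (max (u \<bullet> d) (?h R u))"
          using R(1,2) by (simp add: R(4) ins)
        then show "h (convex hull S + convex hull R) u
            = h (convex hull (insert c R) + convex hull (insert d R)) u"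
          using cross[of u] R by (simp add: support_function_plus cb ins)
      qed (use R in auto)
      moreover have "atomic_body (convex hull (insert c R) + convex hull (insert d R))"
        using R False by (intro atomic_body_plus IH cb) auto
      ultimately show ?thesis
        using R by (intro atomic_body_cancel[of "convex hull S" "convex hull R"] IH cb) auto
    qed
  qed
qed

subsection \<open>Monotonicity and nonnegative weights\<close>

text \<open>The surface area measure of a polygon in finite form: outer unit normals weighted by
  side lengths, where directions of weight 0 may be included. A segment counts as a polygon with two
  sides.\<close>

definition surface_weights :: "(real^2) set \<Rightarrow> (real^2) set \<Rightarrow> (real^2 \<Rightarrow> real) \<Rightarrow> bool" where
  "surface_weights K F c \<longleftrightarrow> finite F \<and> F \<subseteq> sphere 0 1 \<and> (\<forall>v\<in>F. 0 \<le> c v) \<and>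
     (\<forall>L\<in>convex_bodies. 2 * mixed_area K L = (\<Sum>v\<in>F. c v * h L v))"

lemma area_convex_body_scale_plus:
  assumes "atomic_body K" "K \<in> convex_bodies" "L \<in> convex_bodies" "0 \<le> t"
  shows "area (K + (\<lambda>x. t *\<^sub>R x) ` L) = area K + 2 * t * mixed_area K L + t\<^sup>2 * area L"
proof -
  obtain F c where F: "\<And>L. L \<in> convex_bodies \<Longrightarrow> mixed_area K L = (\<Sum>v\<in>F. c v * h L v)"
    using assms(1) unfolding atomic_def by blast
  have "mixed_area K ((\<lambda>x. t *\<^sub>R x) ` L) = t * mixed_area K L"
    using assms by (simp add: F convex_bodies_scaleR support_function_scaleR_image sum_distrib_left mult_ac)
  then show ?thesis by (simp add: area_plus area_scaleR)
qed

text \<open>Mixed area is half the derivative of \<open>area (K + t L)\<close> at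
  \<open>t = 0\<close>. Comparing the areas for \<open>L\<close> and \<open>L'\<close> at a small
  \<open>t\<close> leaves a quadratic error, which is made arbitrarily small.\<close>

lemma mixed_area_mono:
  assumes "atomic_body K" "K \<in> convex_bodies" "L \<in> convex_bodies" "L' \<in> convex_bodies" "L \<subseteq> L'"
  shows "mixed_area K L \<le> mixed_area K L'"
proof (rule field_le_epsilon)
  fix e :: real assume e: "0 < e"
  \<comment> \<open>Small enough to push the quadratic error, divided by \<open>t\<close>, below
    \<open>e\<close>; the summand 1 covers bodies of area 0.\<close>
  define t where "t = e / (area L' + 1)"
  have t: "0 < t" "t * area L' \<le> e"
    using e area_nonneg[of L'] by (auto simp: t_def field_simps add_pos_nonneg)
  have "K + (\<lambda>x. t *\<^sub>R x) ` L \<subseteq> K + (\<lambda>x. t *\<^sub>R x) ` L'"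
    using assms(5) by (intro set_plus_mono) auto
  then have "area (K + (\<lambda>x. t *\<^sub>R x) ` L) \<le> area (K + (\<lambda>x. t *\<^sub>R x) ` L')"
    using assms by (intro area_mono convex_bodies_plus convex_bodies_scaleR)
  then have "t * (2 * mixed_area K L) + t * (t * area L) \<le> t * (2 * mixed_area K L') + t * (t * area L')"
    using area_convex_body_scale_plus[OF assms(1,2), of L t] area_convex_body_scale_plus[OF assms(1,2), of L' t]
      assms t by (simp add: power2_eq_square mult.left_commute[of t 2] mult.assoc)
  moreover have "0 \<le> t * (t * area L)" using t by simp
  ultimately have "t * (2 * mixed_area K L) \<le> t * (2 * mixed_area K L' + t * area L')"
    unfolding distrib_left by linarith
  then have "2 * mixed_area K L \<le> 2 * mixed_area K L' + t * area L'" using t by simp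
  then show "mixed_area K L \<le> mixed_area K L' + e" using t e by linarith
qed

text \<open>To isolate the coefficient of \<open>w\<close>, the unit disc is enlarged by a spike
  ending at \<open>s *\<^sub>R w\<close>, so short that its support function is unchanged at all
  other directions of \<open>F\<close>. Monotonicity then reads
  \<open>0 \<le> c w * (s - 1)\<close>.\<close>

lemma atomic_body_weights:
  assumes "atomic_body K" "K \<in> convex_bodies"
  obtains F c where "surface_weights K F c"
proof -
  obtain F c where F: "finite F" "F \<subseteq> sphere 0 1"
    "\<And>L. L \<in> convex_bodies \<Longrightarrow> mixed_area K L = (\<Sum>v\<in>F. c v * h L v)"
    using assms(1) unfolding atomic_def by blast
  have "0 \<le> c w" if w: "w \<in> F" for w
  proof -
    have nw: "norm w = 1" using w F by auto
    have "v \<bullet> w < 1" if "v \<in> F - {w}" for v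
    proof -
      have "norm v = 1" using that F by auto
      then have "v \<bullet> v = 1" "w \<bullet> w = 1" using nw by (simp_all add: dot_square_norm)
      then have "(v - w) \<bullet> (v - w) = 2 - 2 * (v \<bullet> w)"
        by (simp add: inner_diff_left inner_diff_right inner_commute[of w v])
      moreover have "0 < (v - w) \<bullet> (v - w)" using that by simp
      ultimately show ?thesis by simp
    qed
    moreover define m where "m = Max (insert 0 ((\<lambda>v. v \<bullet> w) ` (F - {w})))"
    ultimately have m: "m < 1" "0 \<le> m" "\<And>v. v \<in> F - {w} \<Longrightarrow> v \<bullet> w \<le> m"
      using F(1) by (auto simp: m_def)
    \<comment> \<open>\<open>m\<close> bounds the cosines between \<open>w\<close> and the other
      directions, so the spike is invisible to them as long as \<open>s * m \<le> 1\<close>. If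
      \<open>m = 0\<close>, any length above 1 will do.\<close>
    define s where "s = (if m = 0 then 2 else 1 / m)"
    have s: "1 < s" "s * m \<le> 1" using m by (auto simp: s_def)
    let ?L = "convex hull (cball 0 1 \<union> {s *\<^sub>R w})"
    have B: "cball 0 1 \<in> convex_bodies" by (intro convex_bodies_cball) simp
    have L: "?L \<in> convex_bodies"
      by (intro convex_bodies_hull compact_Un) auto
    have h: "h ?L u = max (norm u) (s * (u \<bullet> w))" for u
      using support_function_hull_Un[OF B, of "{s *\<^sub>R w}" u] support_function_cball[of 1 u] by simp
    have "mixed_area K (cball 0 1) \<le> mixed_area K ?L"
      using hull_subset[of "cball 0 1 \<union> {s *\<^sub>R w}" convex] by (intro mixed_area_mono assms B L) auto
    also have "mixed_area K ?L = (\<Sum>v\<in>F. c v * (1 + (if v = w then s - 1 else 0)))"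
      unfolding F(3)[OF L]
    proof (intro sum.cong refl arg_cong2[where f = "(*)"])
      fix v assume v: "v \<in> F"
      then have "norm v = 1" using F by auto
      moreover have "s * (v \<bullet> w) \<le> 1" if "v \<noteq> w"
        using m(3)[of v] that v s by (smt (verit) mult_left_mono insertE insert_Diff_single Diff_iff singletonD)
      ultimately show "h ?L v = 1 + (if v = w then s - 1 else 0)"
        unfolding h using s nw by (auto simp: dot_square_norm)
    qed
    also have "\<dots> = (\<Sum>v\<in>F. c v) + (\<Sum>v\<in>F. if v = w then c v * (s - 1) else 0)"
      by (auto simp: distrib_left sum.distrib intro!: sum.cong)
    also have "(\<Sum>v\<in>F. if v = w then c v * (s - 1) else 0) = c w * (s - 1)"
      using F(1) w by simp
    also have "mixed_area K (cball 0 1) = (\<Sum>v\<in>F. c v)"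
      unfolding F(3)[OF B] using F(2) by (intro sum.cong) (auto simp: support_function_cball)
    finally have "0 \<le> c w * (s - 1)" by simp
    then show "0 \<le> c w" using s by (simp add: zero_le_mult_iff)
  qed
  then show thesis
    using F by (intro that[of F "\<lambda>v. 2 * c v"]) (auto simp: surface_weights_def sum_distrib_left mult_ac)
qed

lemma polygon_weights:
  assumes "finite S" "S \<noteq> {}"
  obtains F c where "surface_weights (convex hull S) F c"
  using atomic_body_weights[OF atomic_body_polygon[OF assms] convex_bodies_hull] assms finite_imp_compact
  by blast

section \<open>Approximation by polygons\<close>

lemma polygon_approx:
  assumes "K \<in> convex_bodies" "0 < e"
  obtains S where "finite S" "S \<noteq> {}" "hausdorff_dist (convex hull S) K \<le> e"
proof -
  obtain S where S: "finite S" "S \<subseteq> K" "K \<subseteq> (\<Union>x\<in>S. ball x e)"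
  proof (rule compactE_image[of K K "\<lambda>x. ball x e"])
    show "compact K" using assms(1) by (rule convex_bodiesD)
    show "K \<subseteq> (\<Union>x\<in>K. ball x e)" using assms(2) by force
  qed auto
  have ne: "S \<noteq> {}" using S convex_bodiesD(1)[OF assms(1)] by auto
  have sub: "convex hull S \<subseteq> K" using S convex_bodiesD[OF assms(1)] by (intro hull_minimal)
  have "K \<subseteq> S + cball 0 e"
  proof
    fix y assume "y \<in> K"
    then obtain x where "x \<in> S" "dist x y < e" using S by auto
    then show "y \<in> S + cball 0 e"
      using set_plus_intro[of x S "y - x" "cball 0 e"] by (auto simp: dist_norm norm_minus_commute)
  qed
  also have "\<dots> \<subseteq> convex hull S + cball 0 e" by (intro set_plus_mono hull_subset order_refl)
  finally have "K \<subseteq> convex hull S + cball 0 e" .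
  moreover have "convex hull S \<subseteq> K + cball 0 e"
    using set_plus_mono[OF sub, of "{0}" "cball 0 e"] assms(2) by auto
  ultimately show thesis
    using S ne assms(1)
    by (intro that[of S] hausdorff_dist_leI convex_bodies_hull finite_imp_compact)
qed

lemma polygon_sequence:
  assumes "K \<in> convex_bodies"
  obtains P F c where "\<And>n. P n \<in> convex_bodies" "\<And>n. surface_weights (P n) (F n) (c n)"
    "body_limit P K"
proof -
  have "\<exists>P F c. P \<in> convex_bodies \<and> surface_weights P F c \<and> hausdorff_dist P K \<le> inverse (real (Suc n))" for n
  proof -
    have "0 < inverse (real (Suc n))" by simp
    then obtain S where S: "finite S" "S \<noteq> {}" "hausdorff_dist (convex hull S) K \<le> inverse (real (Suc n))"
      using polygon_approx[OF assms] by blast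
    obtain F c where "surface_weights (convex hull S) F c" by (rule polygon_weights[OF S(1,2)])
    then show ?thesis using S convex_bodies_hull finite_imp_compact by blast
  qed
  then obtain P F c where P: "\<And>n. P n \<in> convex_bodies" "\<And>n. surface_weights (P n) (F n) (c n)"
    "\<And>n. hausdorff_dist (P n) K \<le> inverse (real (Suc n))" by metis
  have "body_limit P K"
    using P(3) hausdorff_dist_nonneg
    by (intro tendsto_sandwich[OF _ _ tendsto_const LIMSEQ_inverse_real_of_nat] always_eventually allI)
  with P(1,2) show thesis by (rule that)
qed

subsection \<open>Continuity of area\<close>

lemma scaleR_in_seg: "\<bar>t\<bar> \<le> r \<Longrightarrow> t *\<^sub>R u \<in> seg (r *\<^sub>R u)" for u :: "'a::real_vector"
  using closed_segment_linear_image[of "\<lambda>t. t *\<^sub>R u" "- r" r]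
  by (auto simp: linear_scaleR_left closed_segment_eq_real_ivl intro!: image_eqI[of _ _ t])

text \<open>The disc lies in a square, which is a sum of two segments of half-length
  \<open>e\<close>. Adding such a segment to a body of radius \<open>r\<close> costs at most
  \<open>4 * e * r\<close>; the radius is \<open>R\<close> for the first one and
  \<open>R + e\<close> for the second.\<close>

lemma area_plus_cball_le:
  assumes "K \<in> convex_bodies" "K \<subseteq> cball 0 R" "0 \<le> R" "0 \<le> e"
  shows "area (K + cball 0 e) \<le> area K + 8 * e * (R + e)"
proof -
  let ?e1 = "vector [1, 0] :: real^2" and ?e2 = "vector [0, 1] :: real^2"
  let ?I = "seg (e *\<^sub>R ?e1)" and ?J = "seg (e *\<^sub>R ?e2)"
  have n: "norm ?e1 = 1" "norm ?e2 = 1" by (simp_all add: norm_eq_sqrt_inner inner_vec2)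
  have *: "area (L + seg (e *\<^sub>R u)) \<le> area L + 4 * e * r"
    if "L \<in> convex_bodies" "L \<subseteq> cball 0 r" "0 \<le> r" "norm u = 1" for L r and u :: "real^2"
  proof -
    have "h L (rotate90 (e *\<^sub>R u)) \<le> r * e" "h L (- rotate90 (e *\<^sub>R u)) \<le> r * e"
      using support_function_bound[OF that(1-3), of "rotate90 (e *\<^sub>R u)"] assms(4)
        support_function_bound[OF that(1-3), of "- rotate90 (e *\<^sub>R u)"] that(4) by simp_all
    then show ?thesis
      using area_plus[of L "seg (e *\<^sub>R u)"] mixed_area_sym_segment[OF that(1), of "e *\<^sub>R u"]
      by (simp add: algebra_simps)
  qed
  have "cball 0 e \<subseteq> ?I + ?J"
  proof
    fix v :: "real^2" assume "v \<in> cball 0 e"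
    then have v: "\<bar>v $ 1\<bar> \<le> e" "\<bar>v $ 2\<bar> \<le> e"
      using component_le_norm_cart[of v 1] component_le_norm_cart[of v 2] by auto
    have "v = v $ 1 *\<^sub>R ?e1 + v $ 2 *\<^sub>R ?e2" by (simp add: vec2_eq_iff)
    then show "v \<in> ?I + ?J" using scaleR_in_seg v by (metis set_plus_intro)
  qed
  then have "K + cball 0 e \<subseteq> K + ?I + ?J"
    using set_plus_mono[of K K "cball 0 e" "?I + ?J"] by (simp add: add.assoc)
  then have "area (K + cball 0 e) \<le> area (K + ?I + ?J)"
    using assms by (intro area_mono convex_bodies_plus convex_bodies_cball) auto
  also have "\<dots> \<le> area (K + ?I) + 4 * e * (R + e)"
  proof (rule *)
    have "?I \<subseteq> cball 0 e"
      using assms(4) n by (intro closed_segment_subset) auto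
    then have "K + ?I \<subseteq> cball 0 R + cball 0 e" using assms by (intro set_plus_mono)
    also have "\<dots> \<subseteq> cball 0 (R + e)"
      by (auto simp: set_plus_def intro: norm_triangle_mono)
    finally show "K + ?I \<subseteq> cball 0 (R + e)" .
  qed (use assms n in \<open>auto intro: convex_bodies_plus\<close>)
  also have "area (K + ?I) \<le> area K + 4 * e * R"
    using assms n by (intro *)
  also have "area K + 4 * e * R + 4 * e * (R + e) \<le> area K + 8 * e * (R + e)"
    using assms by (simp add: algebra_simps)
  finally show ?thesis by simp
qed

text \<open>The radius is prescribed for \<open>K\<close> only, so that the Lipschitz constant is
  uniform along a sequence converging to \<open>K\<close>; since \<open>e \<le> 1\<close>, the other
  body lies in the disc of radius \<open>R + 1\<close>.\<close>

lemma area_hausdorff_le: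
  assumes "K \<in> convex_bodies" "L \<in> convex_bodies" "K \<subseteq> cball 0 R" "0 \<le> R" "hausdorff_dist L K \<le> e" "e \<le> 1"
  shows "\<bar>area L - area K\<bar> \<le> e * (8 * (R + 2))"
proof -
  have e: "0 \<le> e" using hausdorff_dist_nonneg[of L K] assms by linarith
  have sub: "L \<subseteq> K + cball 0 e" "K \<subseteq> L + cball 0 e"
    using hausdorff_dist_convex_bodiesD[OF assms(2,1,5)] by auto
  have "K + cball 0 e \<subseteq> cball 0 (R + 1)"
    using assms by (force simp: set_plus_def intro: norm_triangle_le)
  then have LR: "L \<subseteq> cball 0 (R + 1)" using sub by auto
  have "area L \<le> area (K + cball 0 e)"
    using sub assms e by (intro area_mono convex_bodies_plus convex_bodies_cball)
  also have "\<dots> \<le> area K + 8 * e * (R + e)" using assms e by (intro area_plus_cball_le)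
  finally have 1: "area L \<le> area K + e * (8 * (R + e))" by (simp add: algebra_simps)
  have "area K \<le> area (L + cball 0 e)"
    using sub assms e by (intro area_mono convex_bodies_plus convex_bodies_cball)
  also have "\<dots> \<le> area L + 8 * e * (R + 1 + e)" using assms LR e by (intro area_plus_cball_le) auto
  finally have 2: "area K \<le> area L + e * (8 * (R + 1 + e))" by (simp add: algebra_simps)
  have "e * (8 * (R + e)) \<le> e * (8 * (R + 2))" "e * (8 * (R + 1 + e)) \<le> e * (8 * (R + 2))"
    using assms e by (intro mult_left_mono; simp)+
  then show ?thesis using 1 2 by linarith
qed

lemma tendsto_area:
  assumes "K \<in> convex_bodies" "\<And>n. P n \<in> convex_bodies" "body_limit P K"
  shows "(\<lambda>n. area (P n)) \<longlonglongrightarrow> area K"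
proof -
  obtain R where R: "R > 0" "K \<subseteq> cball 0 R" using convex_body_bound[OF assms(1)] .
  have "eventually (\<lambda>n. hausdorff_dist (P n) K < 1) sequentially"
    using assms(3) by (rule order_tendstoD) simp
  then have "eventually (\<lambda>n. \<bar>area (P n) - area K\<bar> \<le> hausdorff_dist (P n) K * (8 * (R + 2))) sequentially"
  proof eventually_elim
    case (elim n)
    then show ?case using R by (intro area_hausdorff_le assms(1,2)) auto
  qed
  then have "(\<lambda>n. \<bar>area (P n) - area K\<bar>) \<longlonglongrightarrow> 0"
    by (rule tendsto_sandwich[OF always_eventually _ tendsto_const tendsto_mult_left_zero[OF assms(3)], rotated]) simp
  then have "(\<lambda>n. area (P n) - area K) \<longlonglongrightarrow> 0"
    by (rule tendsto_rabs_zero_cancel)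
  then show ?thesis by (simp add: LIM_zero_iff)
qed

lemma hausdorff_dist_plus_le:
  assumes "K \<in> convex_bodies" "K' \<in> convex_bodies" "L \<in> convex_bodies"
  shows "hausdorff_dist (K + L) (K' + L) \<le> hausdorff_dist K K'"
proof (rule hausdorff_dist_leI)
  let ?B = "cball 0 (hausdorff_dist K K')"
  have "K + L \<subseteq> K' + ?B + L" "K' + L \<subseteq> K + ?B + L"
    using hausdorff_dist_convex_bodiesD[OF assms(1,2) order_refl] by (intro set_plus_mono order_refl; simp)+
  then show "K + L \<subseteq> K' + L + ?B" "K' + L \<subseteq> K + L + ?B" by (simp_all add: ac_simps)
qed (intro convex_bodies_plus assms)+

lemma tendsto_hausdorff_plus:
  assumes "K \<in> convex_bodies" "\<And>n. P n \<in> convex_bodies" "body_limit P K"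
    "L \<in> convex_bodies"
  shows "body_limit (\<lambda>n. P n + L) (K + L)"
  by (rule tendsto_sandwich[OF _ _ tendsto_const assms(3)])
    (simp_all add: assms hausdorff_dist_nonneg hausdorff_dist_plus_le)

lemma tendsto_mixed_area:
  assumes "K \<in> convex_bodies" "\<And>n. P n \<in> convex_bodies" "body_limit P K"
    "L \<in> convex_bodies"
  shows "(\<lambda>n. mixed_area (P n) L) \<longlonglongrightarrow> mixed_area K L"
  unfolding mixed_area_def
proof (intro tendsto_divide tendsto_diff tendsto_const)
  show "(\<lambda>n. area (P n + L)) \<longlonglongrightarrow> area (K + L)"
    by (intro tendsto_area tendsto_hausdorff_plus convex_bodies_plus assms)
qed (use tendsto_area[OF assms(1-3)] in auto)

subsection \<open>Discrete measures on the circle\<close>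

abbreviation circle_borel :: "(real^2) measure" where
  "circle_borel \<equiv> restrict_space borel (sphere 0 1)"

text \<open>\<open>point_measure\<close> has \<open>F\<close> as its space and all subsets of
  \<open>F\<close> as measurable sets. The pushforward places it on the Borel sets of the circle, as
  \<open>is_surface_area_measure\<close> demands.\<close>

definition discrete_measure :: "(real^2) set \<Rightarrow> (real^2 \<Rightarrow> real) \<Rightarrow> (real^2) measure" where
  "discrete_measure F c = distr (point_measure F (\<lambda>v. ennreal (c v))) circle_borel (\<lambda>v. v)"

lemma measurable_discrete:
  "F \<subseteq> sphere 0 1 \<Longrightarrow> (\<lambda>v. v) \<in> point_measure F w \<rightarrow>\<^sub>M circle_borel"
  by (auto simp: measurable_def space_point_measure sets_point_measure space_restrict_space)

lemma borel_measurable_circle: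
  fixes f :: "real^2 \<Rightarrow> real"
  shows "continuous_on (sphere 0 1) f \<Longrightarrow> f \<in> borel_measurable circle_borel"
  by (rule borel_measurable_continuous_on_restrict)

lemma integral_discrete_measure:
  fixes f :: "real^2 \<Rightarrow> real"
  assumes "finite F" "F \<subseteq> sphere 0 1" "\<forall>v\<in>F. 0 \<le> c v" "continuous_on (sphere 0 1) f"
  shows "(\<integral>v. f v \<partial>discrete_measure F c) = (\<Sum>v\<in>F. c v * f v)"
proof -
  have "(\<integral>v. f v \<partial>discrete_measure F c) = (\<integral>v. f v \<partial>point_measure F (\<lambda>v. ennreal (c v)))"
    unfolding discrete_measure_def
    using measurable_discrete[OF assms(2)] borel_measurable_circle[OF assms(4)] by (rule integral_distr)
  also have "\<dots> = (\<Sum>v\<in>F. c v * f v)"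
    using assms by (simp add: lebesgue_integral_point_measure_finite)
  finally show ?thesis .
qed

lemma sets_discrete_measure [simp]: "sets (discrete_measure F c) = sets circle_borel"
  by (simp add: discrete_measure_def)

lemma finite_measure_discrete_measure:
  assumes "finite F" "F \<subseteq> sphere 0 1"
  shows "finite_measure (discrete_measure F c)"
  unfolding discrete_measure_def
proof (rule finite_measure.finite_measure_distr[OF finite_measureI measurable_discrete])
  show "emeasure (point_measure F (\<lambda>v. ennreal (c v))) (space (point_measure F (\<lambda>v. ennreal (c v)))) \<noteq> \<infinity>"
    using assms(1) by (simp add: space_point_measure emeasure_point_measure_finite)
qed (rule assms)

lemma surface_weights_is_surface_area_measure:
  assumes "surface_weights K F c"
  shows "is_surface_area_measure K (discrete_measure F c)"
  using assms unfolding is_surface_area_measure_def surface_weights_def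
  by (auto simp: finite_measure_discrete_measure integral_discrete_measure continuous_on_support_function)

subsection \<open>Uniqueness of the surface area measure\<close>

text \<open>The functions whose integrals are fixed by the defining identity of a surface area
  measure. They form a vector lattice with constants, which is rich enough to determine the
  measure.\<close>

definition support_diff :: "(real^2 \<Rightarrow> real) \<Rightarrow> bool" where
  "support_diff f \<longleftrightarrow> (\<exists>A\<in>convex_bodies. \<exists>B\<in>convex_bodies.
     \<forall>v\<in>sphere 0 1. f v = h A v - h B v)"

lemma support_diffI:
  "A \<in> convex_bodies \<Longrightarrow> B \<in> convex_bodies \<Longrightarrow>
    (\<And>v. v \<in> sphere 0 1 \<Longrightarrow> f v = h A v - h B v) \<Longrightarrow> support_diff f"
  unfolding support_diff_def by blast

lemma support_diff_const: "support_diff (\<lambda>v. c)"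
  by (rule support_diffI[of "cball 0 (max 0 c)" "cball 0 (max 0 (- c))"])
    (auto simp: convex_bodies_cball support_function_cball)

lemma support_diff_inner: "support_diff (\<lambda>v. v \<bullet> x)"
  by (rule support_diffI[of "{x}" "{0}"]) auto

lemma support_diff_uminus: "support_diff f \<Longrightarrow> support_diff (\<lambda>v. - f v)"
  unfolding support_diff_def by (metis minus_diff_eq)

lemma support_diff_add:
  assumes "support_diff f" "support_diff g"
  shows "support_diff (\<lambda>v. f v + g v)"
proof -
  obtain A B A' B' where *: "A \<in> convex_bodies" "B \<in> convex_bodies" "A' \<in> convex_bodies" "B' \<in> convex_bodies"
    "\<And>v. v \<in> sphere 0 1 \<Longrightarrow> f v = h A v - h B v"
    "\<And>v. v \<in> sphere 0 1 \<Longrightarrow> g v = h A' v - h B' v"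
    using assms unfolding support_diff_def by blast
  show ?thesis
    by (rule support_diffI[of "A + A'" "B + B'"])
      (use * in \<open>simp_all add: convex_bodies_plus support_function_plus\<close>)
qed

lemma support_diff_scale:
  assumes "support_diff f" "0 \<le> t"
  shows "support_diff (\<lambda>v. t * f v)"
proof -
  obtain A B where *: "A \<in> convex_bodies" "B \<in> convex_bodies"
    "\<And>v. v \<in> sphere 0 1 \<Longrightarrow> f v = h A v - h B v"
    using assms unfolding support_diff_def by blast
  show ?thesis
    by (rule support_diffI[of "(\<lambda>x. t *\<^sub>R x) ` A" "(\<lambda>x. t *\<^sub>R x) ` B"])
      (use * assms in \<open>simp_all add: convex_bodies_scaleR support_function_scaleR_image right_diff_distrib\<close>)
qed

text \<open>After adding \<open>h B + h B'\<close> to both differences, their maximum is that of two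
  support functions, which belongs to the hull of a union.\<close>

lemma support_diff_max:
  assumes "support_diff f" "support_diff g"
  shows "support_diff (\<lambda>v. max (f v) (g v))"
proof -
  obtain A B A' B' where *: "A \<in> convex_bodies" "B \<in> convex_bodies" "A' \<in> convex_bodies" "B' \<in> convex_bodies"
    "\<And>v. v \<in> sphere 0 1 \<Longrightarrow> f v = h A v - h B v"
    "\<And>v. v \<in> sphere 0 1 \<Longrightarrow> g v = h A' v - h B' v"
    using assms unfolding support_diff_def by blast
  have c: "A + B' \<in> convex_bodies" "A' + B \<in> convex_bodies" "B + B' \<in> convex_bodies"
    using * by (auto intro: convex_bodies_plus)
  show ?thesis
  proof (rule support_diffI[of "convex hull ((A + B') \<union> (A' + B))" "B + B'"])
    show "convex hull ((A + B') \<union> (A' + B)) \<in> convex_bodies"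
      using c by (intro convex_bodies_hull compact_Un) (auto dest: convex_bodiesD)
  qed (use * c in \<open>auto simp: support_function_hull_Un support_function_plus\<close>)
qed

lemma support_diff_min: "support_diff f \<Longrightarrow> support_diff g \<Longrightarrow> support_diff (\<lambda>v. min (f v) (g v))"
proof -
  assume "support_diff f" "support_diff g"
  then have "support_diff (\<lambda>v. - max (- f v) (- g v))"
    by (intro support_diff_uminus support_diff_max)
  moreover have "(\<lambda>v. - max (- f v) (- g v)) = (\<lambda>v. min (f v) (g v))" by (auto simp: fun_eq_iff)
  ultimately show ?thesis by simp
qed

lemma support_diff_continuous:
  assumes "support_diff f"
  shows "continuous_on (sphere 0 1) f"
proof -
  obtain A B where *: "A \<in> convex_bodies" "B \<in> convex_bodies"
    "\<And>v. v \<in> sphere 0 1 \<Longrightarrow> f v = h A v - h B v"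
    using assms unfolding support_diff_def by blast
  then show ?thesis
    by (subst continuous_on_cong[OF refl *(3)])
       (auto intro!: continuous_on_diff continuous_on_support_function)
qed

lemma circle_continuous_bound:
  fixes f :: "real^2 \<Rightarrow> real"
  assumes "continuous_on (sphere 0 1) f"
  obtains B where "0 \<le> B" "\<And>v. v \<in> sphere 0 1 \<Longrightarrow> \<bar>f v\<bar> \<le> B"
proof -
  have "compact (f ` sphere 0 1)" by (intro compact_continuous_image assms compact_sphere)
  then obtain B where "\<forall>x\<in>f ` sphere 0 1. norm x \<le> B"
    using compact_imp_bounded bounded_iff by metis
  then show thesis by (intro that[of "max B 0"]) (auto simp: le_max_iff_disj)
qed

lemma integrable_circle:
  fixes f :: "real^2 \<Rightarrow> real"
  assumes "finite_measure S" "sets S = sets circle_borel" "continuous_on (sphere 0 1) f"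
  shows "integrable S f"
proof -
  obtain B where "0 \<le> B" "\<And>v. v \<in> sphere 0 1 \<Longrightarrow> \<bar>f v\<bar> \<le> B"
    using circle_continuous_bound[OF assms(3)] by blast
  moreover have "space S = sphere 0 1"
    using sets_eq_imp_space_eq[OF assms(2)] by (simp add: space_restrict_space)
  moreover have "f \<in> borel_measurable S"
    using borel_measurable_circle[OF assms(3)] measurable_cong_sets[OF assms(2) refl] by blast
  ultimately show ?thesis
    by (intro finite_measure.integrable_const_bound[OF assms(1), of _ B]) (auto intro: AE_I2)
qed

lemma surface_area_measure_integral_support_diff:
  assumes "is_surface_area_measure K S" "is_surface_area_measure K S'" "support_diff f"
  shows "(\<integral>v. f v \<partial>S) = (\<integral>v. f v \<partial>S')"
proof -
  obtain A B where *: "A \<in> convex_bodies" "B \<in> convex_bodies"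
    "\<And>v. v \<in> sphere 0 1 \<Longrightarrow> f v = h A v - h B v"
    using assms unfolding support_diff_def by blast
  have "(\<integral>v. f v \<partial>T) = 2 * mixed_area K A - 2 * mixed_area K B" if T: "is_surface_area_measure K T" for T
  proof -
    have "space T = sphere 0 1"
      using T sets_eq_imp_space_eq[of T circle_borel]
      by (simp add: space_restrict_space is_surface_area_measure_def)
    then have "(\<integral>v. f v \<partial>T) = (\<integral>v. h A v - h B v \<partial>T)"
      using *(3) by (intro Bochner_Integration.integral_cong) auto
    also have "\<dots> = (\<integral>v. h A v \<partial>T) - (\<integral>v. h B v \<partial>T)"
      using T * by (intro Bochner_Integration.integral_diff integrable_circle continuous_on_support_function)
        (auto simp: is_surface_area_measure_def)
    finally have "(\<integral>v. f v \<partial>T) = (\<integral>v. h A v \<partial>T) - (\<integral>v. h B v \<partial>T)" .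
    moreover have "mixed_area K A = 1 / 2 * (\<integral>v. h A v \<partial>T)"
      "mixed_area K B = 1 / 2 * (\<integral>v. h B v \<partial>T)"
      using T *(1,2) unfolding is_surface_area_measure_def by blast+
    ultimately show ?thesis by simp
  qed
  then show ?thesis using assms by simp
qed

text \<open>The truncations of \<open>n\<close> times the positive part increase to the indicator
  and remain in the lattice, so their integrals are known.\<close>

lemma measure_support_diff_pos:
  assumes S: "finite_measure S" "sets S = sets circle_borel" and f: "support_diff f"
  shows "(\<lambda>n. \<integral>v. min 1 (real n * max (f v) 0) \<partial>S) \<longlonglongrightarrow> measure S {v\<in>sphere 0 1. 0 < f v}"
proof -
  interpret finite_measure S by fact
  have sp: "space S = sphere 0 1"
    using sets_eq_imp_space_eq[OF S(2)] by (simp add: space_restrict_space)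
  have m: "g \<in> borel_measurable S" if "support_diff g" for g
    using integrable_circle[OF S support_diff_continuous[OF that]] by (rule borel_measurable_integrable)
  have U: "{v\<in>sphere 0 1. 0 < f v} \<in> sets S"
    using borel_measurable_less[of "\<lambda>_. 0" S f] m[OF f] sp by simp
  have "(\<lambda>n. \<integral>v. min 1 (real n * max (f v) 0) \<partial>S) \<longlonglongrightarrow> (\<integral>v. indicator {v\<in>sphere 0 1. 0 < f v} v \<partial>S)"
  proof (rule integral_dominated_convergence[where w = "\<lambda>_. 1"])
    show "AE v in S. (\<lambda>n. min 1 (real n * max (f v) 0)) \<longlonglongrightarrow> indicator {v\<in>sphere 0 1. 0 < f v} v"
    proof (rule AE_I2)
      fix v assume v: "v \<in> space S"
      show "(\<lambda>n. min 1 (real n * max (f v) 0)) \<longlonglongrightarrow> indicator {v\<in>sphere 0 1. 0 < f v} v"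
      proof (cases "0 < f v")
        case True
        obtain N where N: "1 \<le> real N * f v"
          using reals_Archimedean3[OF True] by (meson less_imp_le)
        have "eventually (\<lambda>n. min 1 (real n * max (f v) 0) = 1) sequentially"
        proof (rule eventually_sequentiallyI[of N])
          fix n assume "N \<le> n"
          then have "real N * f v \<le> real n * f v" using True by (intro mult_right_mono) auto
          then have "1 \<le> real n * f v" using N by linarith
          then show "min 1 (real n * max (f v) 0) = 1" using True by simp
        qed
        then show ?thesis using True v sp by (simp add: tendsto_eventually)
      qed simp
    qed
  next
    fix n show "(\<lambda>v. min 1 (real n * max (f v) 0)) \<in> borel_measurable S"
      by (intro m support_diff_min support_diff_scale support_diff_max support_diff_const f) simp
  qed (use U in auto)
  moreover have "{v\<in>sphere 0 1. 0 < f v} \<inter> space S = {v\<in>sphere 0 1. 0 < f v}"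
    unfolding sp by blast
  ultimately show ?thesis unfolding Bochner_Integration.integral_indicator by (simp only:)
qed

text \<open>The sets where some function of the lattice is positive are stable under intersection,
  by minima. They include the traces of half-planes, hence generate the Borel sets of the circle,
  and both measures agree on them.\<close>

lemma surface_area_measure_unique:
  assumes S: "is_surface_area_measure K S" "is_surface_area_measure K S'"
  shows "S = S'"
proof -
  define E where "E = {{v\<in>sphere 0 1. 0 < f v} | f. support_diff f}"
  have E: "{v\<in>sphere 0 1. 0 < f v} \<in> E" if "support_diff f" for f
    using that by (auto simp: E_def)
  have halfspace: "{v\<in>sphere 0 1. a < v \<bullet> i} \<in> E" for a and i :: "real^2"
    using E[OF support_diff_add[OF support_diff_inner[of i] support_diff_const[of "- a"]]] by simp
  have gen: "sets circle_borel = sigma_sets (sphere 0 1) E"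
  proof -
    let ?H = "(\<lambda>(a, i). {x :: real^2. a < x \<bullet> i}) ` (UNIV \<times> Basis)"
    have base: "sets circle_borel = sigma_sets (sphere 0 1) ((\<inter>) (sphere 0 1) ` ?H)"
    proof -
    have "sets circle_borel = (\<inter>) (sphere 0 1) ` sigma_sets UNIV ?H"
      by (simp add: sets_restrict_space borel_eq_halfspace_greater)
    also have "\<dots> = sigma_sets (sphere 0 1) ((\<inter>) (sphere 0 1) ` ?H)"
    proof (rule sigma_sets_Int)
      have "sphere (0::real^2) 1 \<in> sets borel" by simp
      then show "sphere (0::real^2) 1 \<in> sigma_sets UNIV ?H"
        by (simp only: borel_eq_halfspace_greater sets_measure_of subset_UNIV Pow_UNIV)
    qed simp
    finally show ?thesis .
    qed
    also have "\<dots> = sigma_sets (sphere 0 1) E"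
    proof (rule sigma_sets_eqI)
      fix A assume "A \<in> (\<inter>) (sphere 0 1) ` ?H"
      then obtain a and i :: "real^2" where "A = sphere 0 1 \<inter> {v. a < v \<bullet> i}" by auto
      then have "A = {v\<in>sphere 0 1. a < v \<bullet> i}" by auto
      then show "A \<in> sigma_sets (sphere 0 1) E" using halfspace by auto
    next
      fix A assume "A \<in> E"
      then obtain f where f: "support_diff f" "A = {v\<in>sphere 0 1. 0 < f v}" by (auto simp: E_def)
      have "A = {v\<in>space circle_borel. 0 < f v}" using f by (simp add: space_restrict_space)
      also have "\<dots> \<in> sets circle_borel"
        using borel_measurable_circle[OF support_diff_continuous[OF f(1)]] by measurable
      also note base
      finally show "A \<in> sigma_sets (sphere 0 1) ((\<inter>) (sphere 0 1) ` ?H)" .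
    qed
    finally show ?thesis .
  qed
  have SS: "finite_measure S" "sets S = sets circle_borel" "finite_measure S'" "sets S' = sets circle_borel"
    using S by (auto simp: is_surface_area_measure_def)
  have "{v\<in>sphere 0 1. 0 < (1::real)} = (sphere 0 1 :: (real^2) set)" by auto
  then have sphere_E: "sphere 0 1 \<in> E" using E[OF support_diff_const[of 1]] by (simp only:)
  show ?thesis
  proof (rule measure_eqI_generator_eq[of E "sphere 0 1" S S' "\<lambda>_. sphere 0 1"])
    show "Int_stable E"
    proof (rule Int_stableI)
      fix A B assume "A \<in> E" "B \<in> E"
      then obtain f g where "support_diff f" "A = {v\<in>sphere 0 1. 0 < f v}"
        "support_diff g" "B = {v\<in>sphere 0 1. 0 < g v}" by (auto simp: E_def)
      then show "A \<inter> B \<in> E"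
        using E[OF support_diff_min[of f g]] by (auto simp: Collect_conj_eq[symmetric] elim!: back_subst[of "\<lambda>X. X \<in> E"])
    qed
    show "emeasure S X = emeasure S' X" if "X \<in> E" for X
    proof -
      from that obtain f where f: "support_diff f" "X = {v\<in>sphere 0 1. 0 < f v}" by (auto simp: E_def)
      have "(\<integral>v. min 1 (real n * max (f v) 0) \<partial>S) = (\<integral>v. min 1 (real n * max (f v) 0) \<partial>S')" for n
        using S by (intro surface_area_measure_integral_support_diff support_diff_min support_diff_scale
            support_diff_max support_diff_const f) simp_all
      then have "measure S X = measure S' X"
        using measure_support_diff_pos[OF SS(1,2) f(1)] measure_support_diff_pos[OF SS(3,4) f(1)] f(2)
        by (simp add: LIMSEQ_unique)
      then show ?thesis
        using SS by (simp add: finite_measure.emeasure_eq_measure)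
    qed
    show "range (\<lambda>_. sphere 0 1) \<subseteq> E" using sphere_E by auto
    show "emeasure S (sphere 0 1) \<noteq> \<infinity>"
      using finite_measure.emeasure_finite[OF SS(1)] by simp
  qed (use SS gen in \<open>auto simp: E_def\<close>)
qed

lemma surface_area_measure_eqI:
  "is_surface_area_measure K S \<Longrightarrow> surface_area_measure K = S"
  unfolding surface_area_measure_def
  by (rule the_equality) (auto intro: surface_area_measure_unique)

subsection \<open>Existence of the surface area measure\<close>

definition circle_point :: "real \<Rightarrow> real^2" where
  "circle_point t = vector [cos t, sin t]"

lemma continuous_circle_point: "continuous_on A circle_point"
  unfolding circle_point_def[abs_def] vec2_axis by (intro continuous_intros)

lemma norm_circle_point [simp]: "norm (circle_point t) = 1"
  by (simp add: circle_point_def norm_eq_sqrt_inner inner_vec2 power2_eq_square[symmetric])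

lemma circle_point_angle:
  assumes "v \<in> sphere 0 1"
  obtains t where "0 \<le> t" "t \<le> 2 * pi" "circle_point t = v"
proof -
  have "(v $ 1)\<^sup>2 + (v $ 2)\<^sup>2 = 1"
    using assms by (simp add: norm_eq_sqrt_inner inner_vec2 power2_eq_square)
  then obtain t where "0 \<le> t" "t < 2 * pi" "v $ 1 = cos t" "v $ 2 = sin t"
    using sincos_total_2pi by metis
  then show thesis
    by (intro that[of t]) (auto simp: circle_point_def vec2_eq_iff)
qed

text \<open>Helly's theorem concerns probability distributions on the real line. Normals are
  replaced by angles and the masses are normalized; the limit is rescaled by \<open>m\<close> and
  wrapped around the circle. The jump of the angle \<open>\<theta>\<close> is harmless because test
  functions are evaluated as \<open>f\<close> after \<open>circle_point\<close>, which is
  continuous.\<close>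

lemma discrete_weak_limit_pos:
  fixes F :: "nat \<Rightarrow> (real^2) set" and c :: "nat \<Rightarrow> real^2 \<Rightarrow> real"
  assumes F: "\<And>n. finite (F n)" "\<And>n. F n \<subseteq> sphere 0 1" "\<And>n v. v \<in> F n \<Longrightarrow> 0 \<le> c n v"
    and lim: "(\<lambda>n. \<Sum>v\<in>F n. c n v) \<longlonglongrightarrow> m" and pos: "\<And>n. 0 < (\<Sum>v\<in>F n. c n v)"
    and m: "0 \<le> m"
  obtains r S where "strict_mono (r :: nat \<Rightarrow> nat)" "finite_measure S" "sets S = sets circle_borel"
    "\<And>f. continuous_on (sphere 0 1) f \<Longrightarrow>
       (\<lambda>n. \<Sum>v\<in>F (r n). c (r n) v * f v) \<longlonglongrightarrow> (\<integral>v. f v \<partial>S)"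
proof -
  define T where "T n = (\<Sum>v\<in>F n. c n v)" for n
  have "\<forall>v. \<exists>t. v \<in> sphere 0 1 \<longrightarrow> 0 \<le> t \<and> t \<le> 2 * pi \<and> circle_point t = v"
    using circle_point_angle by metis
  then obtain \<theta> where \<theta>: "\<And>v. v \<in> sphere 0 1 \<Longrightarrow> 0 \<le> \<theta> v \<and> \<theta> v \<le> 2 * pi \<and> circle_point (\<theta> v) = v"
    by metis
  define Q where "Q n = point_measure (F n) (\<lambda>v. ennreal (c n v / T n))" for n
  define \<mu> where "\<mu> n = distr (Q n) borel \<theta>" for n
  have meas: "\<theta> \<in> Q n \<rightarrow>\<^sub>M borel" for n
    by (auto simp: Q_def measurable_def sets_point_measure space_point_measure)
  have nonneg: "0 \<le> c n v / T n" if "v \<in> F n" for n v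
    using that F(3) pos[of n] by (simp add: T_def)
  have one: "(\<Sum>v\<in>F n. c n v / T n) = 1" for n
    using pos[of n] by (simp add: T_def flip: sum_divide_distrib)
  have total: "emeasure (Q n) (F n) = 1" for n
    using F(1) nonneg by (simp add: Q_def emeasure_point_measure_finite sum_ennreal one)
  have spQ: "space (Q n) = F n" for n by (simp add: Q_def space_point_measure)
  have prob: "prob_space (Q n)" for n
    by (rule prob_spaceI) (simp add: spQ total)
  have rd: "real_distribution (\<mu> n)" for n
    unfolding \<mu>_def real_distribution_def real_distribution_axioms_def
    by (simp add: prob_space.prob_space_distr[OF prob meas])
  \<comment> \<open>All angles lie between 0 and 2 pi, inside one bounded interval; this is the
    tightness. It is half-open because \<open>tight_def\<close> uses such intervals.\<close>
  have m1: "measure (\<mu> n) {-1<..7} = 1" for n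
  proof -
    have "2 * pi \<le> 7" using pi_less_4 pi_approx by simp
    then have "\<theta> -` {-1<..7} \<inter> space (Q n) = F n"
      using \<theta> F(2)[of n] unfolding spQ by fastforce
    then show ?thesis
      using measure_distr[OF meas, of "{-1<..7}" n] total[of n] by (simp add: \<mu>_def measure_def)
  qed
  have "tight \<mu>"
    unfolding tight_def
  proof (intro conjI allI impI rd)
    fix e :: real assume "0 < e"
    then show "\<exists>a b. a < b \<and> (\<forall>n. 1 - e < measure (\<mu> n) {a<..b})"
      using m1 by (intro exI[of _ "-1"] exI[of _ 7]) simp
  qed
  then obtain r M where r: "strict_mono r" "real_distribution M" "weak_conv_m (\<mu> \<circ> (\<lambda>n. n) \<circ> r) M"
    using tight_imp_convergent_subsubsequence[of \<mu> "\<lambda>n. n"] by (auto simp: strict_mono_def)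
  interpret M: real_distribution M by fact
  have cp: "circle_point \<in> density M (\<lambda>_. ennreal m) \<rightarrow>\<^sub>M circle_borel"
  proof (rule measurable_restrict_space2)
    have "circle_point \<in> borel_measurable borel"
      by (intro borel_measurable_continuous_onI continuous_circle_point)
    then show "circle_point \<in> borel_measurable (density M (\<lambda>_. ennreal m))" by simp
  qed simp
  define S where "S = distr (density M (\<lambda>_. ennreal m)) circle_borel circle_point"
  have fin: "finite_measure S"
    unfolding S_def
  proof (rule finite_measure.finite_measure_distr[OF finite_measureI cp])
    show "emeasure (density M (\<lambda>_. ennreal m)) (space (density M (\<lambda>_. ennreal m))) \<noteq> \<infinity>"
      using M.emeasure_space_1 by (simp add: emeasure_density)
  qed
  have conv: "(\<lambda>n. \<Sum>v\<in>F (r n). c (r n) v * f v) \<longlonglongrightarrow> (\<integral>v. f v \<partial>S)"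
    if f: "continuous_on (sphere 0 1) f" for f
  proof -
    define g where "g t = f (circle_point t)" for t
    obtain B where B: "\<And>v. v \<in> sphere 0 1 \<Longrightarrow> \<bar>f v\<bar> \<le> B"
      using circle_continuous_bound[OF f] by blast
    have gc: "continuous_on UNIV g"
      unfolding g_def
      by (rule continuous_on_compose2[OF f continuous_circle_point]) auto
    then have gm: "g \<in> borel_measurable borel" by (rule borel_measurable_continuous_onI)
    have "(\<lambda>n. integral\<^sup>L (\<mu> (r n)) g) \<longlonglongrightarrow> integral\<^sup>L M g"
    proof (rule weak_conv_imp_integral_bdd_continuous_conv[of "\<lambda>n. \<mu> (r n)", where B = B])
      show "isCont g x" for x using gc by (simp add: continuous_on_eq_continuous_at)
      show "norm (g x) \<le> B" for x using B[of "circle_point x"] by (simp add: g_def)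
    qed (use rd r in \<open>auto simp: o_def\<close>)
    moreover have "integral\<^sup>L (\<mu> n) g = (\<Sum>v\<in>F n. c n v * f v) / T n" for n
    proof -
      have "integral\<^sup>L (\<mu> n) g = (\<integral>v. g (\<theta> v) \<partial>Q n)"
        unfolding \<mu>_def by (rule integral_distr[OF meas gm])
      also have "\<dots> = (\<Sum>v\<in>F n. c n v / T n * g (\<theta> v))"
        unfolding Q_def using F(1) nonneg by (simp add: lebesgue_integral_point_measure_finite)
      also have "\<dots> = (\<Sum>v\<in>F n. c n v / T n * f v)"
      proof (rule sum.cong[OF refl])
        fix v assume "v \<in> F n"
        then have "circle_point (\<theta> v) = v" using \<theta> F(2) by blast
        then show "c n v / T n * g (\<theta> v) = c n v / T n * f v" by (simp add: g_def)
      qed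
      finally show ?thesis by (simp add: sum_divide_distrib)
    qed
    ultimately have "(\<lambda>n. T (r n) * ((\<Sum>v\<in>F (r n). c (r n) v * f v) / T (r n))) \<longlonglongrightarrow> m * integral\<^sup>L M g"
      using LIMSEQ_subseq_LIMSEQ[OF lim r(1)] by (intro tendsto_mult) (auto simp: T_def o_def)
    moreover have "T n \<noteq> 0" for n using pos[of n] by (simp add: T_def)
    moreover have "(\<integral>v. f v \<partial>S) = m * integral\<^sup>L M g"
    proof -
      have "(\<integral>v. f v \<partial>S) = (\<integral>t. g t \<partial>density M (\<lambda>_. ennreal m))"
        unfolding S_def g_def using cp borel_measurable_circle[OF f] by (rule integral_distr)
      also have "\<dots> = (\<integral>t. m *\<^sub>R g t \<partial>M)"
        using gm m by (intro integral_density) auto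
      finally show ?thesis by simp
    qed
    ultimately show ?thesis by simp
  qed
  show thesis
    by (rule that[OF r(1) fin _ conv]) (simp_all add: S_def)
qed

text \<open>Masses cannot be normalized if they vanish. For \<open>m = 0\<close> the sums tend to 0
  by the bound on \<open>f\<close>, and the zero measure is the limit; otherwise all totals are
  positive from some index on, and the earlier terms are dropped.\<close>

lemma discrete_weak_limit:
  fixes F :: "nat \<Rightarrow> (real^2) set" and c :: "nat \<Rightarrow> real^2 \<Rightarrow> real"
  assumes F: "\<And>n. finite (F n)" "\<And>n. F n \<subseteq> sphere 0 1" "\<And>n v. v \<in> F n \<Longrightarrow> 0 \<le> c n v"
    and lim: "(\<lambda>n. \<Sum>v\<in>F n. c n v) \<longlonglongrightarrow> m"
  obtains r S where "strict_mono (r :: nat \<Rightarrow> nat)" "finite_measure S" "sets S = sets circle_borel"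
    "\<And>f. continuous_on (sphere 0 1) f \<Longrightarrow>
       (\<lambda>n. \<Sum>v\<in>F (r n). c (r n) v * f v) \<longlonglongrightarrow> (\<integral>v. f v \<partial>S)"
proof -
  have nn: "0 \<le> (\<Sum>v\<in>F n. c n v)" for n using F(3) by (intro sum_nonneg) auto
  then have m: "0 \<le> m" using LIMSEQ_le_const[OF lim] by blast
  show thesis
  proof (cases "m = 0")
    case True
    have "(\<lambda>n. \<Sum>v\<in>F n. c n v * f v) \<longlonglongrightarrow> 0" if f: "continuous_on (sphere 0 1) f" for f
    proof -
      obtain B where B: "\<And>v. v \<in> sphere 0 1 \<Longrightarrow> \<bar>f v\<bar> \<le> B"
        using circle_continuous_bound[OF f] by blast
      have "norm (\<Sum>v\<in>F n. c n v * f v) \<le> (\<Sum>v\<in>F n. c n v) * B" for n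
        unfolding sum_distrib_right
      proof (intro order_trans[OF norm_sum sum_mono])
        fix v assume v: "v \<in> F n"
        then have "c n v * \<bar>f v\<bar> \<le> c n v * B" using F(2)[of n] F(3)[OF v] by (intro mult_left_mono B) auto
        then show "norm (c n v * f v) \<le> c n v * B" using F(3)[OF v] by (simp add: abs_mult)
      qed
      then show ?thesis
        using tendsto_mult_left_zero[OF lim[unfolded True], of B]
        by (intro Lim_null_comparison[of "\<lambda>n. \<Sum>v\<in>F n. c n v * f v" "\<lambda>n. (\<Sum>v\<in>F n. c n v) * B"] always_eventually) auto
    qed
    moreover have "strict_mono (\<lambda>n::nat. n)" by (simp add: strict_mono_def)
    ultimately show thesis
      using that[of "\<lambda>n. n" "discrete_measure {} (\<lambda>_. 0)"]
      by (simp add: finite_measure_discrete_measure integral_discrete_measure)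
  next
    case False
    then have "eventually (\<lambda>n. 0 < (\<Sum>v\<in>F n. c n v)) sequentially"
      using m order_tendstoD(1)[OF lim, of 0] by simp
    then obtain N where N: "\<And>n. 0 < (\<Sum>v\<in>F (n + N). c (n + N) v)"
      unfolding eventually_sequentially by (metis le_add2)
    show thesis
    proof (rule discrete_weak_limit_pos[of "\<lambda>n. F (n + N)" "\<lambda>n. c (n + N)" m])
      show "(\<lambda>n. \<Sum>v\<in>F (n + N). c (n + N) v) \<longlonglongrightarrow> m"
        by (rule LIMSEQ_ignore_initial_segment[OF lim])
    next
      fix r S
      assume r: "strict_mono (r :: nat \<Rightarrow> nat)" "finite_measure S" "sets S = sets circle_borel"
        and conv: "\<And>f. continuous_on (sphere 0 1) f \<Longrightarrow>
          (\<lambda>n. \<Sum>v\<in>F (r n + N). c (r n + N) v * f v) \<longlonglongrightarrow> (\<integral>v. f v \<partial>S)"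
      have "strict_mono (\<lambda>n. r n + N)" using r(1) by (simp add: strict_mono_def)
      then show thesis using r(2,3) conv by (rule that)
    qed (fact F N m)+
  qed
qed

lemma surface_weights_total:
  assumes "surface_weights K F c"
  shows "(\<Sum>v\<in>F. c v) = 2 * mixed_area K (cball 0 1)"
proof -
  have "2 * mixed_area K (cball 0 1) = (\<Sum>v\<in>F. c v * h (cball 0 1) v)"
    using assms by (simp add: surface_weights_def convex_bodies_cball)
  also have "\<dots> = (\<Sum>v\<in>F. c v)"
    using assms by (intro sum.cong) (auto simp: surface_weights_def support_function_cball)
  finally show ?thesis ..
qed

text \<open>Besides existence, the convergence against arbitrary continuous functions is exported,
  so that the representation of \<open>\<Phi>\<close> can pass from polygons to \<open>K\<close>.
  Uniqueness identifies the subsequential limit with \<open>surface_area_measure K\<close>.\<close>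

lemma surface_area_measure_limit:
  assumes K: "K \<in> convex_bodies" and P: "\<And>n. P n \<in> convex_bodies" "\<And>n. surface_weights (P n) (F n) (c n)"
    and lim: "body_limit P K"
  obtains r where "strict_mono (r :: nat \<Rightarrow> nat)" "is_surface_area_measure K (surface_area_measure K)"
    "\<And>f. continuous_on (sphere 0 1) f \<Longrightarrow>
       (\<lambda>n. \<Sum>v\<in>F (r n). c (r n) v * f v) \<longlonglongrightarrow> (\<integral>v. f v \<partial>surface_area_measure K)"
proof -
  have B: "cball 0 1 \<in> convex_bodies" by (simp add: convex_bodies_cball)
  have tot: "(\<lambda>n. \<Sum>v\<in>F n. c n v) \<longlonglongrightarrow> 2 * mixed_area K (cball 0 1)"
    unfolding surface_weights_total[OF P(2)] by (intro tendsto_mult tendsto_const tendsto_mixed_area K P lim B)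
  have F: "\<And>n. finite (F n)" "\<And>n. F n \<subseteq> sphere 0 1" "\<And>n v. v \<in> F n \<Longrightarrow> 0 \<le> c n v"
    using P(2) by (auto simp: surface_weights_def)
  show thesis
  proof (rule discrete_weak_limit[OF F tot])
  fix r S
  assume r: "strict_mono (r :: nat \<Rightarrow> nat)" "finite_measure S" "sets S = sets circle_borel"
    and conv: "\<And>f. continuous_on (sphere 0 1) f \<Longrightarrow>
       (\<lambda>n. \<Sum>v\<in>F (r n). c (r n) v * f v) \<longlonglongrightarrow> (\<integral>v. f v \<partial>S)"
  have "is_surface_area_measure K S"
    unfolding is_surface_area_measure_def
  proof (intro conjI ballI r)
    fix L :: "(real^2) set" assume L: "L \<in> convex_bodies"
    have "(\<lambda>n. 2 * mixed_area (P (r n)) L) \<longlonglongrightarrow> 2 * mixed_area K L"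
      using LIMSEQ_subseq_LIMSEQ[OF lim r(1)]
      by (intro tendsto_mult tendsto_const tendsto_mixed_area K P L) (auto simp: o_def)
    moreover have "(\<lambda>n. 2 * mixed_area (P (r n)) L) \<longlonglongrightarrow> (\<integral>v. h L v \<partial>S)"
      using conv[OF continuous_on_support_function[OF L]] P(2) L by (simp add: surface_weights_def)
    ultimately have "2 * mixed_area K L = (\<integral>v. h L v \<partial>S)"
      by (rule LIMSEQ_unique)
    then show "mixed_area K L = 1 / 2 * (\<integral>v. h L v \<partial>S)" by simp
  qed
  then have "surface_area_measure K = S" "is_surface_area_measure K S"
    using surface_area_measure_eqI by auto
  then show thesis using that[OF r(1)] conv by simp
  qed
qed

subsection \<open>Zonotopes and difference bodies\<close>

lemma convex_bodies_sum:
  assumes "finite F" "\<And>v. v \<in> F \<Longrightarrow> A v \<in> convex_bodies"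
  shows "(\<Sum>v\<in>F. A v) \<in> convex_bodies"
  using assms by (induction F rule: finite_induct) (auto simp: set_zero intro: convex_bodies_plus)

lemma support_function_sum:
  assumes "finite F" "\<And>v. v \<in> F \<Longrightarrow> A v \<in> convex_bodies"
  shows "h (\<Sum>v\<in>F. A v) u = (\<Sum>v\<in>F. h (A v) u)"
  using assms
  by (induction F rule: finite_induct) (auto simp: set_zero support_function_plus convex_bodies_sum)

lemma abs_det2_commute: "\<bar>det2 p q\<bar> = \<bar>det2 q p\<bar>"
  by (simp add: det2_commute[of p q])

text \<open>A further segment adds twice its mixed area with the sum so far, which is 4 times a sum
  of determinants; the double sum counts each unordered pair twice, and its diagonal
  vanishes.\<close>

lemma area_zonotope:
  assumes "finite F"
  shows "area (\<Sum>v\<in>F. seg (a v)) = 2 * (\<Sum>v\<in>F. \<Sum>w\<in>F. \<bar>det2 (a v) (a w)\<bar>)"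
  using assms
proof (induction F rule: finite_induct)
  case empty
  then show ?case by (simp add: set_zero)
next
  case (insert x F)
  let ?Z = "\<Sum>v\<in>F. seg (a v)"
  have Z: "?Z \<in> convex_bodies" using insert(1) by (intro convex_bodies_sum) auto
  have "h ?Z (rotate90 (a x)) = (\<Sum>v\<in>F. \<bar>det2 (a x) (a v)\<bar>)"
    "h ?Z (- rotate90 (a x)) = (\<Sum>v\<in>F. \<bar>det2 (a x) (a v)\<bar>)"
    using insert(1) by (simp_all add: support_function_sum support_function_sym_segment inner_rotate90)
  then have "area (?Z + seg (a x)) = area ?Z + 4 * (\<Sum>v\<in>F. \<bar>det2 (a x) (a v)\<bar>)"
    using area_plus[of ?Z "seg (a x)"] mixed_area_sym_segment[OF Z, of "a x"] by simp
  moreover have "det2 (a x) (a x) = 0" by (simp add: det2_def)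
  ultimately show ?case
    using insert by (simp add: add.commute[of _ ?Z] sum.distrib abs_det2_commute[of _ "a x"])
qed

lemma area_parallelogram: "area (seg a + seg b) = 4 * \<bar>det2 a b\<bar>"
  using area_plus[of "seg a" "seg b"]
  by (simp add: mixed_area_sym_segment support_function_sym_segment inner_rotate90 abs_det2_commute[of b a])

lemma area_on_line:
  assumes "K \<in> convex_bodies" "w \<noteq> 0" "\<And>x. x \<in> K \<Longrightarrow> det2 w x = 0"
  shows "area K = 0"
  using convex_body_on_line[OF assms] by (metis area_segment)

text \<open>\<open>Q + Q\<close> also has area 0 but contains the parallelogram of any two points of
  \<open>Q\<close>. So these are linearly dependent, \<open>Q\<close> is a segment on a line through
  0, and the symmetry of its support function centers it.\<close>

lemma area_zero_symmetric:
  assumes Q: "Q \<in> convex_bodies" and sym: "Q = uminus ` Q" and "area Q = 0"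
  obtains p where "Q = seg p"
proof -
  have hsym: "h Q (- u) = h Q u" for u
    using support_function_uminus_image[OF Q, of u] sym by simp
  have det: "det2 x y = 0" if "x \<in> Q" "y \<in> Q" for x y
  proof -
    have "seg z \<subseteq> Q" if "z \<in> Q" for z
      using that sym convex_bodiesD(3)[OF Q] by (metis closed_segment_subset image_eqI)
    then have "seg x + seg y \<subseteq> Q + Q"
      using that by (intro set_plus_mono)
    then have "4 * \<bar>det2 x y\<bar> \<le> area (Q + Q)"
      unfolding area_parallelogram[symmetric] using Q by (intro area_mono convex_bodies_plus) auto
    then show ?thesis using assms(3) Q by (simp add: convex_body_plus_self area_scaleR)
  qed
  have "\<exists>a b. Q = closed_segment a b"
  proof (cases "\<exists>w\<in>Q. w \<noteq> 0")
    case True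
    then show ?thesis using convex_body_on_line[OF Q] det by metis
  next
    case False
    then have "Q = closed_segment 0 0" using convex_bodiesD(1)[OF Q] by auto
    then show ?thesis by blast
  qed
  then obtain a b where ab: "Q = closed_segment a b" by blast
  have "u \<bullet> (a + b) = 0" for u
    using hsym[of u] by (simp add: ab support_function_segment inner_add_right)
  then have "(a + b) \<bullet> (a + b) = 0" by blast
  then have "a = - b" by (simp add: eq_neg_iff_add_eq_0)
  then show thesis using that ab by blast
qed

section \<open>Area of the difference body\<close>

lemma area_le_difference_body:
  assumes K: "K \<in> convex_bodies"
  shows "area K \<le> area (K + uminus ` K)"
proof -
  obtain x where x: "x \<in> K" using convex_bodiesD(1)[OF K] by auto
  then have "K + {- x} \<subseteq> K + uminus ` K" by (intro set_plus_mono) auto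
  then have "area (K + {- x}) \<le> area (K + uminus ` K)"
    using K by (intro area_mono convex_bodies_plus convex_bodies_uminus) auto
  then show ?thesis by simp
qed

lemma area_triangle: "area (convex hull {a, b, c}) = \<bar>det2 (b - a) (c - a)\<bar> / 2"
proof -
  have pos: "area (convex hull {0, p, q}) = det2 p q / 2" if "0 < det2 p q" for p q
    using area_plus_triangle[of "{0}" p q] that by (simp add: add.commute[of "{0}"])
  have "area (convex hull {0, p, q}) = \<bar>det2 p q\<bar> / 2" for p q
  proof -
    consider "0 < det2 p q" | "0 < det2 q p" | "det2 p q = 0"
      using det2_commute[of p q] by linarith
    then show ?thesis
    proof cases
      case 2
      then show ?thesis using pos[of q p] det2_commute[of p q] by (simp add: insert_commute)
    next
      case 3
      then obtain x y where "convex hull {0, p, q} = closed_segment x y" by (rule flat_triangle)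
      then show ?thesis using 3 by simp
    qed (use pos in simp)
  qed
  then show ?thesis unfolding convex_hull_translate_3[of a b c] by simp
qed

text \<open>A triangle of maximal area in \<open>K\<close> gives a parallelogram of comparable area that contains \<open>K\<close>.\<close>

lemma area_difference_body_le:
  assumes K: "K \<in> convex_bodies"
  shows "area (K + uminus ` K) \<le> 32 * area K"
proof -
  have dK: "K + uminus ` K \<in> convex_bodies" using K by (intro convex_bodies_plus convex_bodies_uminus)
  let ?f = "\<lambda>(a, b, c). \<bar>det2 (b - a) (c - a)\<bar> :: real"
  have "continuous_on (K \<times> K \<times> K) ?f"
    unfolding det2_def case_prod_unfold by (intro continuous_intros)
  moreover have "compact (K \<times> K \<times> K)" "K \<times> K \<times> K \<noteq> {}"
    using convex_bodiesD[OF K] by (auto intro!: compact_Times)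
  ultimately have "\<exists>z\<in>K \<times> K \<times> K. \<forall>y\<in>K \<times> K \<times> K. ?f y \<le> ?f z"
    by (intro continuous_attains_sup)
  then obtain z where z: "z \<in> K \<times> K \<times> K" "\<forall>y\<in>K \<times> K \<times> K. ?f y \<le> ?f z" by (elim bexE)
  obtain a b c where "z = (a, b, c)" by (cases z)
  then have abc: "a \<in> K" "b \<in> K" "c \<in> K" "\<forall>y\<in>K \<times> K \<times> K. ?f y \<le> ?f (a, b, c)"
    using z by simp_all
  define p where "p = b - a"
  define q where "q = c - a"
  define D where "D = det2 p q"
  have max: "\<bar>det2 (y - x) (w - x)\<bar> \<le> \<bar>D\<bar>" if "x \<in> K" "y \<in> K" "w \<in> K" for x y w
    using bspec[OF abc(4), of "(x, y, w)"] that by (simp add: D_def p_def q_def)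
  show ?thesis
  proof (cases "D = 0")
    case True
    have "area (K + uminus ` K) = 0"
    proof (cases "\<exists>w\<in>K. w \<noteq> a")
      case True
      then obtain w where w: "w \<in> K" "w - a \<noteq> 0" by auto
      show ?thesis
      proof (rule area_on_line[OF dK w(2)])
        fix x assume "x \<in> K + uminus ` K"
        then obtain y z where yz: "y \<in> K" "z \<in> K" "x = y - z" by (auto simp: set_plus_def)
        have "det2 (w - a) (y - a) = 0" "det2 (w - a) (z - a) = 0"
          using max[OF abc(1) w(1) yz(1)] max[OF abc(1) w(1) yz(2)] \<open>D = 0\<close> by simp_all
        moreover have "det2 (w - a) x = det2 (w - a) (y - a) - det2 (w - a) (z - a)"
          by (simp add: yz det2_def algebra_simps)
        ultimately show "det2 (w - a) x = 0" by simp
      qed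
    next
      case False
      then have "K = {a}" using abc(1) by blast
      then show ?thesis by simp
    qed
    then show ?thesis by simp
  next
    case False
    let ?Q = "seg p + seg q"
    have Q: "?Q \<in> convex_bodies" by (intro convex_bodies_plus) auto
    have sub: "{- a} + K \<subseteq> ?Q"
    proof
      fix y assume "y \<in> {- a} + K"
      then obtain x where x: "x \<in> K" "y = x - a" by (auto simp: set_plus_def)
      define s where "s = det2 y q / D"
      define t where "t = det2 p y / D"
      \<comment> \<open>\<open>s\<close> and \<open>t\<close> are the coordinates of
        \<open>y\<close> in the basis \<open>p\<close>, \<open>q\<close>. Replacing one vertex of
        the maximal triangle by \<open>x\<close> does not enlarge it, so both are at most 1 in
        absolute value.\<close>
      have "\<bar>det2 y q\<bar> \<le> \<bar>D\<bar>" "\<bar>det2 p y\<bar> \<le> \<bar>D\<bar>"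
        using max[OF abc(1) x(1) abc(3)] max[OF abc(1) abc(2) x(1)] by (simp_all add: x p_def q_def)
      then have st: "\<bar>s\<bar> \<le> 1" "\<bar>t\<bar> \<le> 1"
        using False by (simp_all add: s_def t_def)
      have "D *\<^sub>R y = det2 y q *\<^sub>R p + det2 p y *\<^sub>R q"
        unfolding D_def vec2_eq_iff by (simp add: det2_def algebra_simps)
      then have "(1 / D) *\<^sub>R (D *\<^sub>R y) = s *\<^sub>R p + t *\<^sub>R q"
        by (simp add: s_def t_def scaleR_right_distrib)
      then have "y = s *\<^sub>R p + t *\<^sub>R q" using False by simp
      then show "y \<in> ?Q"
        using set_plus_intro[OF scaleR_in_seg[OF st(1), of p] scaleR_in_seg[OF st(2), of q]] by simp
    qed
    have "uminus ` ?Q = ?Q"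
      by (rule convex_body_eqI)
        (use Q in \<open>auto simp: support_function_uminus_image support_function_plus support_function_sym_segment
          intro: convex_bodies_uminus\<close>)
    have "K + uminus ` K = ({- a} + K) + uminus ` ({- a} + K)"
      using K
      by (intro convex_body_eqI convex_bodies_plus convex_bodies_uminus convex_bodies_singleton)
        (simp_all add: support_function_plus support_function_uminus_image convex_bodies_plus convex_bodies_uminus)
    also have "\<dots> \<subseteq> ?Q + ?Q"
      using set_plus_mono[OF sub image_mono[OF sub, of uminus]] unfolding \<open>uminus ` ?Q = ?Q\<close> .
    finally have "area (K + uminus ` K) \<le> area (?Q + ?Q)"
      by (rule area_mono[OF dK convex_bodies_plus[OF Q Q]])
    \<comment> \<open>Doubling \<open>?Q\<close> gives a factor 4, and its own area is
      \<open>4 * \<bar>D\<bar>\<close>. As \<open>\<bar>D\<bar>\<close> is twice the area of the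
      triangle, the constant becomes 32.\<close>
    also have "\<dots> = 16 * \<bar>D\<bar>"
      using Q by (simp add: convex_body_plus_self area_scaleR area_parallelogram D_def)
    also have "\<bar>D\<bar> = 2 * area (convex hull {a, b, c})"
      by (simp add: area_triangle D_def p_def q_def)
    also have "area (convex hull {a, b, c}) \<le> area K"
      using abc convex_bodiesD[OF K]
      by (intro area_mono K convex_bodies_hull hull_minimal finite_imp_compact) auto
    finally show ?thesis by simp
  qed
qed

subsection \<open>Lines through the origin\<close>

lemma span_Gr: "v \<noteq> 0 \<Longrightarrow> span {v} \<in> Gr"
  by (simp add: Gr_def dim_eq_card_independent card_insert_if)

lemma span_sphere:
  fixes e :: "real^2"
  assumes "norm e = 1"
  shows "span {e} \<inter> sphere 0 1 = {e, - e}"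
proof (intro equalityI subsetI)
  fix x assume "x \<in> span {e} \<inter> sphere 0 1"
  then have "x \<in> range (\<lambda>k. k *\<^sub>R e)" and x: "norm x = 1" by (simp_all add: span_singleton)
  then obtain k where k: "x = k *\<^sub>R e" by blast
  then have "\<bar>k\<bar> = 1" using assms x by simp
  then have "k = 1 \<or> k = -1" by linarith
  then show "x \<in> {e, - e}" using k by auto
qed (use assms in \<open>auto intro: span_base span_neg\<close>)

lemma span_uminus_singleton: "span {- w} = span {w :: real^2}"
proof -
  have "- w \<in> span {w}" "- (- w) \<in> span {- w}" by (intro span_neg span_base; simp)+
  then show ?thesis by (intro equalityI span_minimal) simp_all
qed

lemma Gr_unit_vector:
  assumes "E \<in> Gr"
  shows "(SOME w. w \<in> E \<and> norm w = 1) \<in> E" "norm (SOME w. w \<in> E \<and> norm w = 1) = 1"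
    "span {SOME w. w \<in> E \<and> norm w = 1} = E"
proof -
  define s where "s = (SOME w. w \<in> E \<and> norm w = 1)"
  obtain w where w: "norm w = 1" "E = span {w}" using Gr_obtain_unit[OF assms] .
  have "w \<in> E \<and> norm w = 1" unfolding w(2) using w(1) by (simp add: span_base)
  then have s: "s \<in> E \<and> norm s = 1" unfolding s_def by (rule someI)
  then have "s \<in> span {w} \<inter> sphere 0 1" unfolding w(2) by simp
  then have "s = w \<or> s = - w" unfolding span_sphere[OF w(1)] by simp
  then have "span {s} = E" unfolding w(2) using span_uminus_singleton[of w] by metis
  with s show "(SOME w. w \<in> E \<and> norm w = 1) \<in> E" "norm (SOME w. w \<in> E \<and> norm w = 1) = 1"
    "span {SOME w. w \<in> E \<and> norm w = 1} = E"
    unfolding s_def by auto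
qed

lemma Gr_dist_span:
  assumes "norm e = 1" "norm f = 1"
  shows "Gr_dist (span {e}) (span {f}) = min (norm (e - f)) (norm (e + f))"
proof -
  have inf: "infdist x {a, - a} = min (dist x a) (dist x (- a))" for x a :: "real^2"
    by (simp add: infdist_notempty cInf_eq_Min image_insert)
  have "Gr_dist (span {e}) (span {f}) \<le> r \<longleftrightarrow> min (norm (e - f)) (norm (e + f)) \<le> r" for r
    unfolding Gr_dist_def span_sphere[OF assms(1)] span_sphere[OF assms(2)]
  proof (subst hausdorff_dist_le_iff)
    have "norm (- e - f) = norm (e + f)" "norm (- f - e) = norm (e + f)" "norm (f - e) = norm (e - f)"
    proof -
      have "- e - f = - (e + f)" "- f - e = - (e + f)" by simp_all
      then show "norm (- e - f) = norm (e + f)" "norm (- f - e) = norm (e + f)"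
        by (simp_all only: norm_minus_cancel)
    qed (rule norm_minus_commute)
    then show "((\<forall>x\<in>{e, - e}. infdist x {f, - f} \<le> r) \<and> (\<forall>y\<in>{f, - f}. infdist y {e, - e} \<le> r))
        = (min (norm (e - f)) (norm (e + f)) \<le> r)"
      by (auto simp: inf dist_norm min_le_iff_disj add.commute)
  qed auto
  then show ?thesis by (metis order.antisym order.refl)
qed

lemma det2_inner: "(det2 e f)\<^sup>2 + (e \<bullet> f)\<^sup>2 = (norm e)\<^sup>2 * (norm f)\<^sup>2"
  by (simp add: det2_def inner_vec2 power2_norm_eq_inner) (simp add: power2_eq_square algebra_simps)

text \<open>Both bounds come from \<open>|e - f|\<^sup>2 |e + f|\<^sup>2 = 4 det(e, f)\<^sup>2\<close>, as \<open>|e - f|\<^sup>2 + |e + f|\<^sup>2 = 4\<close>.\<close>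

lemma Gr_dist_det2:
  assumes e: "norm e = 1" and f: "norm f = 1"
  shows "\<bar>det2 e f\<bar> \<le> Gr_dist (span {e}) (span {f})"
    and "Gr_dist (span {e}) (span {f}) \<le> 2 * \<bar>det2 e f\<bar>"
proof -
  define s where "s = e \<bullet> f"
  have d: "(det2 e f)\<^sup>2 = (1 - s) * (1 + s)"
    using det2_inner[of e f] e f by (simp add: s_def power2_eq_square algebra_simps)
  have nm: "(norm (e - f))\<^sup>2 = 2 * (1 - s)" "(norm (e + f))\<^sup>2 = 2 * (1 + s)"
  proof -
    have "e \<bullet> e = 1" "f \<bullet> f = 1" using e f by (simp_all add: dot_square_norm)
    then show "(norm (e - f))\<^sup>2 = 2 * (1 - s)" "(norm (e + f))\<^sup>2 = 2 * (1 + s)"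
      by (simp_all add: power2_norm_eq_inner inner_diff_left inner_diff_right inner_add_left inner_add_right
          s_def inner_commute[of f e])
  qed
  have s: "s \<le> 1" "- 1 \<le> s" using Cauchy_Schwarz_ineq2[of e f] e f by (simp_all add: s_def abs_le_iff)
  have "\<bar>det2 e f\<bar>\<^sup>2 \<le> (norm (e - f))\<^sup>2" "\<bar>det2 e f\<bar>\<^sup>2 \<le> (norm (e + f))\<^sup>2"
    unfolding power2_abs d nm
    using s mult_left_mono[of "1 + s" 2 "1 - s"] mult_right_mono[of "1 - s" 2 "1 + s"] by simp_all
  then have "\<bar>det2 e f\<bar> \<le> norm (e - f)" "\<bar>det2 e f\<bar> \<le> norm (e + f)"
    using power2_le_imp_le norm_ge_zero by blast+
  then show "\<bar>det2 e f\<bar> \<le> Gr_dist (span {e}) (span {f})" by (simp add: Gr_dist_span e f)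
  \<comment> \<open>The sign of \<open>s\<close> tells which of \<open>f\<close> and
    \<open>- f\<close> is nearer to \<open>e\<close>; the factor \<open>1 + s\<close> or
    \<open>1 - s\<close> of the other one is then at least 1.\<close>
  have "norm (e - f) \<le> 2 * \<bar>det2 e f\<bar> \<or> norm (e + f) \<le> 2 * \<bar>det2 e f\<bar>"
  proof (cases "0 \<le> s")
    case True
    have "(norm (e - f))\<^sup>2 \<le> (2 * \<bar>det2 e f\<bar>)\<^sup>2"
      unfolding power_mult_distrib power2_abs d nm using True s mult_left_mono[of 1 "1 + s" "1 - s"] by simp
    then have "norm (e - f) \<le> 2 * \<bar>det2 e f\<bar>" by (rule power2_le_imp_le) simp
    then show ?thesis ..
  next
    case False
    have "(norm (e + f))\<^sup>2 \<le> (2 * \<bar>det2 e f\<bar>)\<^sup>2"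
      unfolding power_mult_distrib power2_abs d nm using False s mult_right_mono[of 1 "1 - s" "1 + s"] by simp
    then have "norm (e + f) \<le> 2 * \<bar>det2 e f\<bar>" by (rule power2_le_imp_le) simp
    then show ?thesis ..
  qed
  then show "Gr_dist (span {e}) (span {f}) \<le> 2 * \<bar>det2 e f\<bar>"
    by (auto simp: Gr_dist_span e f)
qed

lemma det2_eq_0_imp_span:
  assumes "p \<noteq> 0" "q \<noteq> 0" "det2 p q = 0"
  shows "span {p} = span {q}"
proof -
  have pp: "p \<bullet> p \<noteq> 0" and qq: "q \<bullet> q \<noteq> 0" using assms by auto
  have "(p \<bullet> p) *\<^sub>R q = (p \<bullet> q) *\<^sub>R p" "(q \<bullet> q) *\<^sub>R p = (p \<bullet> q) *\<^sub>R q"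
    using assms(3) unfolding vec2_eq_iff by (simp_all add: inner_vec2 det2_def) algebra+
  then have "(1 / (p \<bullet> p)) *\<^sub>R ((p \<bullet> p) *\<^sub>R q) \<in> span {p}" "(1 / (q \<bullet> q)) *\<^sub>R ((q \<bullet> q) *\<^sub>R p) \<in> span {q}"
    by (simp_all add: span_scale span_base)
  then have "q \<in> span {p}" "p \<in> span {q}" using pp qq by simp_all
  then show ?thesis by (intro equalityI span_minimal) auto
qed

lemma det2_span_eq_0:
  assumes "span {e} = span {f}"
  shows "det2 e f = 0"
proof -
  have "e \<in> span {f}" using assms span_base[of e "{e}"] by simp
  then obtain k where "e = k *\<^sub>R f" by (auto simp: span_singleton)
  then show ?thesis by (simp add: det2_def)
qed

lemma line_length_projection:
  assumes E: "E \<in> Gr" and w: "w \<in> E" "norm w = 1"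
  shows "line_length E (orth_projection (seg u) E) = 2 * \<bar>u \<bullet> w\<bar>"
proof -
  have ww: "w \<bullet> w = 1" using w by (simp add: dot_square_norm)
  obtain w' where w': "norm w' = 1" "E = span {w'}" using Gr_obtain_unit[OF E] .
  have "w \<in> span {w'} \<inter> sphere 0 1" using w unfolding w'(2) by simp
  then have "w \<in> {w', - w'}" unfolding span_sphere[OF w'(1)] .
  have orth: "x \<in> E\<^sup>\<bottom> \<longleftrightarrow> x \<bullet> w = 0" for x
  proof
    assume "x \<in> E\<^sup>\<bottom>" then show "x \<bullet> w = 0"
      using w by (simp add: orthogonal_comp_def orthogonal_def inner_commute)
  next
    assume "x \<bullet> w = 0"
    then have "x \<bullet> w' = 0" using \<open>w \<in> {w', - w'}\<close> by auto
    then show "x \<in> E\<^sup>\<bottom>"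
      unfolding w'(2) by (auto simp: orthogonal_comp_def orthogonal_def span_singleton inner_commute)
  qed
  have scaled: "t *\<^sub>R w \<in> E" for t
    using E w by (auto simp: Gr_def subspace_scale)
  have "{t. t *\<^sub>R w \<in> orth_projection (seg u) E} = (\<lambda>x. x \<bullet> w) ` seg u"
  proof (intro set_eqI)
    fix t
    have "t *\<^sub>R w \<in> orth_projection (seg u) E \<longleftrightarrow> (\<exists>x\<in>seg u. x \<bullet> w - t = 0)"
      by (simp add: orth_projection_def orth scaled inner_diff_left ww)
    then show "t \<in> {t. t *\<^sub>R w \<in> orth_projection (seg u) E} \<longleftrightarrow>
        t \<in> (\<lambda>x. x \<bullet> w) ` seg u"
      by (simp add: image_iff) (metis eq_iff_diff_eq_0)
  qed
  also have "\<dots> = seg (u \<bullet> w)"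
    using closed_segment_linear_image[of "\<lambda>x. x \<bullet> w" "- u" u]
    by (simp add: bounded_linear.linear[OF bounded_linear_inner_left])
  also have "\<dots> = {- \<bar>u \<bullet> w\<bar>..\<bar>u \<bullet> w\<bar>}"
    by (auto simp: closed_segment_eq_real_ivl)
  finally show ?thesis by (simp add: line_length_eq[OF E w])
qed

text \<open>Allows continuity to be checked on the circle. Of the two unit vectors on a nearby line,
  one is close to the given one, and \<open>G\<close> has the same value at both by
  \<open>eq\<close>.\<close>

lemma continuous_map_Gr:
  assumes G: "continuous_on (sphere 0 1) G" and eq: "\<And>v. norm v = 1 \<Longrightarrow> \<rho> (span {v}) = G v"
  shows "continuous_map (mtopology_of Gr_metric) euclideanreal \<rho>"
proof -
  interpret Metric_space Gr Gr_dist by (rule Metric_space_Gr)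
  have "continuous_map mtopology Met_TC.mtopology \<rho>"
    unfolding metric_continuous_map[OF Met_TC.Metric_space_axioms]
  proof (intro conjI ballI allI impI)
    fix E and e :: real assume E: "E \<in> Gr" and "0 < e"
    obtain w where w: "norm w = 1" "E = span {w}" using Gr_obtain_unit[OF E] .
    have "w \<in> sphere 0 1" using w by simp
    then obtain d where d: "0 < d" "\<forall>v\<in>sphere 0 1. dist v w < d \<longrightarrow> dist (G v) (G w) < e"
      using G \<open>0 < e\<close> unfolding continuous_on_iff by blast
    show "\<exists>\<delta>>0. \<forall>x. x \<in> Gr \<and> Gr_dist E x < \<delta> \<longrightarrow> dist (\<rho> E) (\<rho> x) < e"
    proof (intro exI[of _ d] conjI allI impI d(1))
      fix F assume F: "F \<in> Gr \<and> Gr_dist E F < d"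
      obtain f where f: "norm f = 1" "F = span {f}" using Gr_obtain_unit F by blast
      have neg: "span {- f} = F" using f(2) by (simp add: span_uminus_singleton)
      have "norm (w - f) < d \<or> norm (w - (- f)) < d"
        using F by (auto simp: f w Gr_dist_span min_less_iff_disj)
      then obtain g where g: "norm g = 1" "F = span {g}" "norm (w - g) < d"
        using f neg by (metis norm_minus_cancel)
      then have "dist (G g) (G w) < e"
        by (intro d(2)[rule_format]) (simp_all add: dist_norm norm_minus_commute)
      then show "dist (\<rho> E) (\<rho> F) < e" using g w eq by (simp add: dist_commute)
    qed
  qed simp
  then show ?thesis
    by (simp add: mtopology_of_def)
qed

text \<open>Passing from a unit vector to its line does not increase distances.\<close>

lemma continuous_on_span:
  assumes "continuous_map (mtopology_of Gr_metric) euclideanreal \<rho>"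
  shows "continuous_on (sphere 0 1) (\<lambda>v. \<rho> (span {v}))"
  unfolding continuous_on_iff
proof (intro ballI allI impI)
  interpret Metric_space Gr Gr_dist by (rule Metric_space_Gr)
  fix w :: "real^2" and e :: real assume w: "w \<in> sphere 0 1" and e: "0 < e"
  have "continuous_map mtopology Met_TC.mtopology \<rho>"
    using assms by (simp add: mtopology_of_def)
  moreover have "span {w} \<in> Gr" using w by (intro span_Gr) auto
  ultimately obtain d where d: "0 < d" "\<forall>F. F \<in> Gr \<and> Gr_dist (span {w}) F < d \<longrightarrow> dist (\<rho> (span {w})) (\<rho> F) < e"
    unfolding metric_continuous_map[OF Met_TC.Metric_space_axioms] using e by blast
  show "\<exists>d>0. \<forall>x'\<in>sphere 0 1. dist x' w < d \<longrightarrow> dist (\<rho> (span {x'})) (\<rho> (span {w})) < e"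
  proof (intro exI[of _ d] conjI ballI impI d(1))
    fix v :: "real^2" assume v: "v \<in> sphere 0 1" "dist v w < d"
    have "Gr_dist (span {w}) (span {v}) \<le> norm (w - v)"
      using v w by (simp add: Gr_dist_span)
    then have "dist (\<rho> (span {w})) (\<rho> (span {v})) < e"
      using v by (intro d(2)[rule_format] conjI span_Gr) (auto simp: dist_norm norm_minus_commute)
    then show "dist (\<rho> (span {v})) (\<rho> (span {w})) < e" by (simp add: dist_commute)
  qed
qed

subsection \<open>Operators on segments\<close>

text \<open>Cauchy's functional equation on the half-line. Nonnegativity makes \<open>f\<close>
  monotone; squeezing \<open>n * t\<close> between consecutive integers bounds \<open>n\<close>
  times the error by \<open>f 1\<close> for every \<open>n\<close>.\<close>

lemma additive_nonneg_linear:
  fixes f :: "real \<Rightarrow> real"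
  assumes add: "\<And>s t. 0 \<le> s \<Longrightarrow> 0 \<le> t \<Longrightarrow> f (s + t) = f s + f t"
    and nonneg: "\<And>t. 0 \<le> t \<Longrightarrow> 0 \<le> f t" and t: "0 \<le> t"
  shows "f t = t * f 1"
proof -
  have nat: "f (real n * s) = real n * f s" if "0 \<le> s" for n s
  proof (induction n)
    case 0
    then show ?case using add[of 0 0] by simp
  next
    case (Suc n)
    have "real (Suc n) * s = real n * s + s" by (simp add: algebra_simps)
    then show ?case using add[of "real n * s" s] Suc that by (simp add: algebra_simps)
  qed
  have mono: "f s \<le> f r" if "0 \<le> s" "s \<le> r" for s r
    using add[of s "r - s"] nonneg[of "r - s"] that by simp
  have bound: "real n * \<bar>f t - t * f 1\<bar> \<le> f 1" for n
  proof -
    define k where "k = nat \<lfloor>real n * t\<rfloor>"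
    have k: "real k \<le> real n * t" "real n * t \<le> real (Suc k)"
      using t by (simp_all add: k_def) linarith+
    have "real k * f 1 \<le> real n * f t" "real n * f t \<le> real (Suc k) * f 1"
      using mono[OF _ k(1)] mono[OF _ k(2)] nat[of 1 k] nat[of 1 "Suc k"] nat[of t n] t by simp_all
    moreover have "real k * f 1 \<le> real n * t * f 1" "real n * t * f 1 \<le> real (Suc k) * f 1"
      using k nonneg[of 1] by (intro mult_right_mono; simp)+
    ultimately have "\<bar>real n * f t - real n * t * f 1\<bar> \<le> f 1"
      by (simp add: abs_le_iff algebra_simps)
    moreover have "real n * \<bar>f t - t * f 1\<bar> = \<bar>real n * (f t - t * f 1)\<bar>" by (simp add: abs_mult)
    ultimately show ?thesis by (simp add: right_diff_distrib mult.assoc)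
  qed
  have "\<bar>f t - t * f 1\<bar> = 0"
  proof (rule ccontr)
    assume "\<bar>f t - t * f 1\<bar> \<noteq> 0"
    then have "0 < \<bar>f t - t * f 1\<bar>" by simp
    then obtain n where "f 1 < real n * \<bar>f t - t * f 1\<bar>" using reals_Archimedean3 by blast
    then show False using bound[of n] by simp
  qed
  then show ?thesis by simp
qed

lemma continuous_rotate90: "continuous_on A rotate90"
  using linear_rotate90 by (simp add: linear_continuous_on linear_conv_bounded_linear)

lemma sym_segment_plus:
  fixes e :: "real^2"
  assumes "0 \<le> s" "0 \<le> t"
  shows "seg ((s + t) *\<^sub>R e) =
    seg (s *\<^sub>R e) + seg (t *\<^sub>R e)"
  using assms
  by (intro convex_body_eqI convex_bodies_plus convex_bodies_segment)
    (simp add: support_function_plus support_function_sym_segment abs_mult, simp add: distrib_right)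

lemma hausdorff_sym_segment:
  fixes e f :: "real^2"
  shows "hausdorff_dist (seg e) (seg f) \<le> norm (e - f)"
proof -
  have *: "seg e \<subseteq> seg f + cball 0 (norm (e - f))" for e f :: "real^2"
  proof -
    have "\<bar>u \<bullet> e\<bar> \<le> \<bar>u \<bullet> f\<bar> + norm (e - f) * norm u" for u
      using Cauchy_Schwarz_ineq2[of u "e - f"] by (simp add: inner_diff_right mult.commute)
    then show ?thesis
      by (subst convex_body_subset_iff)
        (auto simp: convex_bodies_plus convex_bodies_cball support_function_plus support_function_sym_segment
          support_function_cball)
  qed
  show ?thesis
    using *[of e f] *[of f e] by (intro hausdorff_dist_leI) (simp_all add: norm_minus_commute)
qed

text \<open>The integral formula speaks of unit vectors only; homogeneity extends it to all
  directions.\<close>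

lemma sym_segment_eqI:
  assumes "Q \<in> convex_bodies" "\<And>u. u \<in> sphere 0 1 \<Longrightarrow> h Q u = \<bar>u \<bullet> p\<bar>"
  shows "Q = seg p"
proof (rule convex_body_eqI[OF assms(1) convex_bodies_segment])
  fix u :: "real^2"
  show "h Q u = h (seg p) u"
  proof (cases "u = 0")
    case False
    then have "h Q (norm u *\<^sub>R (u /\<^sub>R norm u)) = norm u * \<bar>(u /\<^sub>R norm u) \<bullet> p\<bar>"
      using assms(1) assms(2)[of "u /\<^sub>R norm u"] support_function_scale[of Q "norm u" "u /\<^sub>R norm u"] by simp
    moreover have "norm u * \<bar>(u /\<^sub>R norm u) \<bullet> p\<bar> = \<bar>u \<bullet> p\<bar>"
      using False by (simp add: abs_mult)
    ultimately show ?thesis using False by (simp add: support_function_sym_segment)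
  qed (use assms in simp)
qed

text \<open>
  Evaluating the mixed area of \<open>K\<close> and the segment \<open>[-a, a]\<close> in two ways shows that
  \<open>K - K\<close> is a zonotope whose segments are given by the surface area measure.
\<close>

lemma difference_body_zonotope:
  assumes K: "K \<in> convex_bodies" and w: "surface_weights K F c"
  shows "K + uminus ` K = (\<Sum>v\<in>F. seg ((c v / 2) *\<^sub>R rotate90 v))"
proof (rule convex_body_eqI)
  have F: "finite F" "\<And>v. v \<in> F \<Longrightarrow> 0 \<le> c v" using w by (auto simp: surface_weights_def)
  show "K + uminus ` K \<in> convex_bodies" using K by (intro convex_bodies_plus convex_bodies_uminus)
  show "(\<Sum>v\<in>F. seg ((c v / 2) *\<^sub>R rotate90 v)) \<in> convex_bodies"
    using F(1) by (intro convex_bodies_sum) auto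
  fix u
  have "h (K + uminus ` K) u = h K u + h K (- u)"
    using K by (simp add: support_function_plus support_function_uminus_image convex_bodies_uminus)
  also have "\<dots> = mixed_area K (seg (- rotate90 u))"
    using mixed_area_sym_segment[OF K, of "- rotate90 u"] by simp
  also have "\<dots> = (\<Sum>v\<in>F. c v * \<bar>v \<bullet> rotate90 u\<bar>) / 2"
  proof -
    have "2 * mixed_area K (seg (- rotate90 u))
        = (\<Sum>v\<in>F. c v * h (seg (- rotate90 u)) v)"
      using w convex_bodies_segment unfolding surface_weights_def by blast
    then show ?thesis unfolding support_function_sym_segment by simp
  qed
  also have "\<dots> = (\<Sum>v\<in>F. c v / 2 * \<bar>u \<bullet> rotate90 v\<bar>)"
    by (simp add: sum_divide_distrib inner_rotate90 abs_det2_commute[of _ u])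
  also have "\<dots> = h (\<Sum>v\<in>F. seg ((c v / 2) *\<^sub>R rotate90 v)) u"
    using F by (simp add: support_function_sum support_function_sym_segment abs_mult)
  finally show "h (K + uminus ` K) u = h
    (\<Sum>v\<in>F. seg ((c v / 2) *\<^sub>R rotate90 v)) u" .
qed

text \<open>The kernel by which \<open>\<Phi>\<close> acts on surface area measures, up to a quarter
  turn and the factor 1/4. Unlike the endpoint of an image segment it involves no choice of
  sign.\<close>

definition seg_support :: "((real^2) set \<Rightarrow> (real^2) set) \<Rightarrow> real^2 \<Rightarrow> real^2 \<Rightarrow> real" where
  "seg_support \<Phi> e u = h (\<Phi> (seg e)) u"

section \<open>Consequences of additivity, symmetry and continuity\<close>

context
  fixes \<Phi> :: "(real^2) set \<Rightarrow> (real^2) set"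
  assumes \<Phi>: "\<Phi> \<in> MAdd_s_plus"
begin

lemma Phi_convex_bodies: "K \<in> convex_bodies \<Longrightarrow> \<Phi> K \<in> convex_bodies"
  using \<Phi> continuous_map_funspace[of "mtopology_of convex_body_metric" "mtopology_of convex_body_metric" \<Phi>]
  by (auto simp: MAdd_s_plus_def Pi_iff)

lemma Phi_plus: "K \<in> convex_bodies \<Longrightarrow> L \<in> convex_bodies \<Longrightarrow> \<Phi> (K + L) = \<Phi> K + \<Phi> L"
  using \<Phi> by (simp add: MAdd_s_plus_def)

lemma Phi_uminus: "K \<in> convex_bodies \<Longrightarrow> \<Phi> (uminus ` K) = \<Phi> K"
  using \<Phi> by (simp add: MAdd_s_plus_def)

lemma Phi_symmetric: "K \<in> convex_bodies \<Longrightarrow> \<Phi> K = uminus ` \<Phi> K"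
  using \<Phi> unfolding MAdd_s_plus_def by blast

lemma Phi_singleton_0: "\<Phi> {0} = {0}"
proof (rule convex_body_eqI)
  show c: "\<Phi> {0} \<in> convex_bodies" "{0} \<in> convex_bodies" by (auto intro: Phi_convex_bodies)
  fix u
  have "\<Phi> {0} = \<Phi> {0} + \<Phi> {0}" using Phi_plus[of "{0}" "{0}"] by (simp add: set_plus_def)
  then have "h (\<Phi> {0}) u = h (\<Phi> {0}) u + h (\<Phi> {0}) u"
    using support_function_plus[OF c(1) c(1), of u] by metis
  then show "h (\<Phi> {0}) u = h {0} u" by simp
qed

lemma Phi_sum:
  assumes "finite F" "\<And>v. v \<in> F \<Longrightarrow> A v \<in> convex_bodies"
  shows "\<Phi> (\<Sum>v\<in>F. A v) = (\<Sum>v\<in>F. \<Phi> (A v))"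
  using assms
  by (induction F rule: finite_induct) (auto simp: set_zero Phi_singleton_0 Phi_plus convex_bodies_sum)

lemma Phi_tendsto:
  assumes "K \<in> convex_bodies" "\<And>n. P n \<in> convex_bodies" "body_limit P K"
  shows "body_limit (\<lambda>n. \<Phi> (P n)) (\<Phi> K)"
proof -
  interpret Metric_space convex_bodies hausdorff_dist by (rule Metric_space_convex_bodies)
  have "continuous_map mtopology mtopology \<Phi>"
    using \<Phi> by (simp add: MAdd_s_plus_def mtopology_of_def)
  then have ed: "\<forall>a\<in>convex_bodies. \<forall>\<epsilon>>0. \<exists>\<delta>>0. \<forall>x. x \<in> convex_bodies \<and> hausdorff_dist a x < \<delta> \<longrightarrow>
      hausdorff_dist (\<Phi> a) (\<Phi> x) < \<epsilon>"
    using metric_continuous_map[OF Metric_space_convex_bodies, of \<Phi>] by blast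
  show ?thesis
  proof (rule LIMSEQ_I)
    fix e :: real assume "0 < e"
    then obtain d where d: "0 < d" "\<And>x. x \<in> convex_bodies \<Longrightarrow> hausdorff_dist K x < d \<Longrightarrow> hausdorff_dist (\<Phi> K) (\<Phi> x) < e"
      using ed assms(1) by blast
    obtain N where N: "\<And>n. N \<le> n \<Longrightarrow> norm (hausdorff_dist (P n) K - 0) < d"
      using LIMSEQ_D[OF assms(3) d(1)] by blast
    show "\<exists>N. \<forall>n\<ge>N. norm (hausdorff_dist (\<Phi> (P n)) (\<Phi> K) - 0) < e"
    proof (intro exI[of _ N] allI impI)
      fix n assume "N \<le> n"
      then have "hausdorff_dist K (P n) < d"
        using N[of n] by (simp add: hausdorff_dist_commute)
      then show "norm (hausdorff_dist (\<Phi> (P n)) (\<Phi> K) - 0) < e"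
        using d(2)[OF assms(2)] by (simp add: hausdorff_dist_nonneg hausdorff_dist_commute)
    qed
  qed
qed

lemma Phi_support_tendsto:
  assumes "K \<in> convex_bodies" "\<And>n. P n \<in> convex_bodies" "body_limit P K"
  shows "(\<lambda>n. h (\<Phi> (P n)) u) \<longlonglongrightarrow> h (\<Phi> K) u"
proof -
  have lim: "(\<lambda>n. hausdorff_dist (\<Phi> (P n)) (\<Phi> K) * norm u) \<longlonglongrightarrow> 0"
    using tendsto_mult_left_zero[OF Phi_tendsto[OF assms]] .
  have "norm (h (\<Phi> (P n)) u - h (\<Phi> K) u)
      \<le> hausdorff_dist (\<Phi> (P n)) (\<Phi> K) * norm u" for n
    using support_function_hausdorff[of "\<Phi> (P n)" "\<Phi> K" u] Phi_convex_bodies assms by simp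
  then have "(\<lambda>n. h (\<Phi> (P n)) u - h (\<Phi> K) u) \<longlonglongrightarrow> 0"
    by (intro Lim_null_comparison[OF always_eventually lim] allI)
  then show ?thesis by (simp add: LIM_zero_iff)
qed

lemma seg_support_nonneg: "0 \<le> seg_support \<Phi> e u"
proof -
  let ?Q = "\<Phi> (seg e)"
  have Q: "?Q \<in> convex_bodies" by (simp add: Phi_convex_bodies)
  have "h ?Q (- u) = h ?Q u"
    using support_function_uminus_image[OF Q, of u] Phi_symmetric[of "seg e"] by simp
  moreover obtain x where "x \<in> ?Q" using convex_bodiesD(1)[OF Q] by auto
  ultimately show ?thesis
    using support_function_ge[OF Q, of x u] support_function_ge[OF Q, of x "- u"]
    by (simp add: seg_support_def)
qed

lemma seg_support_uminus: "seg_support \<Phi> (- e) u = seg_support \<Phi> e u"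
  by (simp add: seg_support_def closed_segment_commute)

text \<open>Homogeneity is not among the hypotheses on \<open>\<Phi>\<close>. It follows from
  additivity along a ray together with nonnegativity, which in turn comes from the symmetry of the
  images.\<close>

lemma seg_support_scale: "0 \<le> t \<Longrightarrow> seg_support \<Phi> (t *\<^sub>R e) u = t * seg_support \<Phi> e u"
  using additive_nonneg_linear[of "\<lambda>t. seg_support \<Phi> (t *\<^sub>R e) u" t]
  by (simp add: seg_support_nonneg)
    (simp add: seg_support_def sym_segment_plus Phi_plus support_function_plus Phi_convex_bodies)

lemma continuous_seg_support: "continuous_on A (\<lambda>e. seg_support \<Phi> e u)"
proof -
  have "isCont (\<lambda>e. seg_support \<Phi> e u) e" for e
    unfolding continuous_at_sequentially
  proof (intro allI impI)
    fix x :: "nat \<Rightarrow> real^2" assume "x \<longlonglongrightarrow> e"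
    then have "(\<lambda>n. norm (x n - e)) \<longlonglongrightarrow> 0" by (simp add: LIM_zero tendsto_norm_zero)
    then have "(\<lambda>n. hausdorff_dist (seg (x n)) (seg e)) \<longlonglongrightarrow> 0"
      by (rule Lim_null_comparison[OF always_eventually, rotated])
        (simp add: hausdorff_sym_segment hausdorff_dist_nonneg)
    then show "((\<lambda>e. seg_support \<Phi> e u) \<circ> x) \<longlonglongrightarrow> seg_support \<Phi> e u"
      unfolding o_def seg_support_def by (intro Phi_support_tendsto) auto
  qed
  then show ?thesis by (simp add: continuous_at_imp_continuous_on)
qed

lemma Phi_plus_self:
  assumes "K \<in> convex_bodies" "surface_weights K F c"
  shows "\<Phi> K + \<Phi> K = (\<Sum>v\<in>F. \<Phi> (seg ((c v / 2) *\<^sub>R rotate90 v)))"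
proof -
  have "finite F" using assms(2) by (simp add: surface_weights_def)
  have "\<Phi> K + \<Phi> K = \<Phi> (K + uminus ` K)"
    using assms(1) by (simp add: Phi_plus Phi_uminus convex_bodies_uminus)
  then show ?thesis
    unfolding difference_body_zonotope[OF assms] using \<open>finite F\<close> by (simp add: Phi_sum)
qed

text \<open>In the factor 1/4, one half comes from the lengths \<open>c v / 2\<close> in the
  difference body, the other from passing from \<open>\<Phi> K + \<Phi> K\<close> back to
  \<open>\<Phi> K\<close>.\<close>

lemma Phi_support_weights:
  assumes "K \<in> convex_bodies" "surface_weights K F c"
  shows "h (\<Phi> K) u = (\<Sum>v\<in>F. c v * (seg_support \<Phi> (rotate90 v) u / 4))"
proof -
  have F: "finite F" "\<And>v. v \<in> F \<Longrightarrow> 0 \<le> c v" using assms(2) by (auto simp: surface_weights_def)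
  have "2 * h (\<Phi> K) u = h (\<Phi> K + \<Phi> K) u"
    using assms(1) by (simp add: support_function_plus Phi_convex_bodies)
  also have "\<dots> = (\<Sum>v\<in>F. seg_support \<Phi> ((c v / 2) *\<^sub>R rotate90 v) u)"
    unfolding Phi_plus_self[OF assms] using F(1)
    by (simp add: support_function_sum Phi_convex_bodies seg_support_def)
  also have "\<dots> = (\<Sum>v\<in>F. c v / 2 * seg_support \<Phi> (rotate90 v) u)"
    using F by (intro sum.cong) (auto simp: seg_support_scale simp del: scaleR_minus_right)
  also have "\<dots> = 2 * (\<Sum>v\<in>F. c v * (seg_support \<Phi> (rotate90 v) u / 4))"
    by (simp add: sum_distrib_left)
  finally show ?thesis by simp
qed

text \<open>Both sides of the polygon formula converge along a subsequence: the left by continuity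
  of \<open>\<Phi>\<close>, the right because the kernel is continuous on the circle. The second
  conjunct later supplies the space of the measure.\<close>

lemma Phi_support_integral:
  assumes K: "K \<in> convex_bodies"
  shows "h (\<Phi> K) u = (\<integral>v. seg_support \<Phi> (rotate90 v) u / 4 \<partial>surface_area_measure K) \<and>
    is_surface_area_measure K (surface_area_measure K)"
proof -
  obtain P F c where P: "\<And>n. P n \<in> convex_bodies" "\<And>n. surface_weights (P n) (F n) (c n)"
    "body_limit P K"
    by (rule polygon_sequence[OF K], rule that)
  have cont: "continuous_on (sphere 0 1) (\<lambda>v. seg_support \<Phi> (rotate90 v) u / 4)"
    by (intro continuous_on_divide continuous_on_const
        continuous_on_compose2[OF continuous_seg_support[of UNIV]] continuous_rotate90) auto
  show ?thesis
  proof (rule surface_area_measure_limit[OF K P])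
    fix r
    assume r: "strict_mono (r :: nat \<Rightarrow> nat)" "is_surface_area_measure K (surface_area_measure K)"
      and conv: "\<And>f. continuous_on (sphere 0 1) f \<Longrightarrow>
       (\<lambda>n. \<Sum>v\<in>F (r n). c (r n) v * f v) \<longlonglongrightarrow> (\<integral>v. f v \<partial>surface_area_measure K)"
    have "(\<lambda>n. h (\<Phi> (P (r n))) u)
        \<longlonglongrightarrow> (\<integral>v. seg_support \<Phi> (rotate90 v) u / 4 \<partial>surface_area_measure K)"
      unfolding Phi_support_weights[OF P(1,2)] by (rule conv[OF cont])
    moreover have "(\<lambda>n. h (\<Phi> (P (r n))) u) \<longlonglongrightarrow> h (\<Phi> K) u"
      using LIMSEQ_subseq_LIMSEQ[OF P(3) r(1)] by (intro Phi_support_tendsto K P(1)) (simp add: o_def)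
    ultimately show ?thesis using LIMSEQ_unique r(2) by blast
  qed
qed

end

subsection \<open>The volume condition in terms of segments\<close>

definition segment_map :: "((real^2) set \<Rightarrow> (real^2) set) \<Rightarrow> (real^2 \<Rightarrow> real^2) \<Rightarrow> bool" where
  "segment_map \<Phi> p \<longleftrightarrow> (\<forall>e. norm e = 1 \<longrightarrow> \<Phi> (seg e) = seg (p e))"

text \<open>The volume condition on parallelograms with unit generators; by absolute values it is
  independent of the signs of \<open>p\<close>.\<close>

definition det2_bi_Lipschitz :: "(real^2 \<Rightarrow> real^2) \<Rightarrow> bool" where
  "det2_bi_Lipschitz p \<longleftrightarrow> (\<exists>a>0. \<exists>b>0. \<forall>e f. norm e = 1 \<longrightarrow> norm f = 1 \<longrightarrow>
     a * \<bar>det2 e f\<bar> \<le> \<bar>det2 (p e) (p f)\<bar> \<and> \<bar>det2 (p e) (p f)\<bar> \<le> b * \<bar>det2 e f\<bar>)"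

lemma segment_map_support:
  "segment_map \<Phi> p \<Longrightarrow> norm e = 1 \<Longrightarrow> seg_support \<Phi> e u = \<bar>u \<bullet> p e\<bar>"
  by (simp add: segment_map_def seg_support_def support_function_sym_segment)

context
  fixes \<Phi> :: "(real^2) set \<Rightarrow> (real^2) set"
  assumes \<Phi>: "\<Phi> \<in> MAdd_s_plus"
begin

lemma VC_imp_segment_map:
  assumes "VC \<Phi>"
  obtains p where "segment_map \<Phi> p" "det2_bi_Lipschitz p"
proof -
  obtain c C where cC: "0 < c" "0 < C"
    "\<And>K. K \<in> convex_bodies \<Longrightarrow> c * area K \<le> area (\<Phi> K) \<and> area (\<Phi> K) \<le> C * area K"
    using assms unfolding VC_def by blast
  have "\<exists>p. \<Phi> (seg e) = seg p" for e
  proof -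
    let ?I = "seg e"
    have "area (\<Phi> ?I) \<le> 0" using cC(3)[of ?I] by simp
    then have "area (\<Phi> ?I) = 0" using area_nonneg[of "\<Phi> ?I"] by linarith
    moreover have "\<Phi> ?I \<in> convex_bodies" "\<Phi> ?I = uminus ` \<Phi> ?I"
      by (intro Phi_convex_bodies[OF \<Phi>] Phi_symmetric[OF \<Phi>] convex_bodies_segment)+
    ultimately show ?thesis by (metis area_zero_symmetric)
  qed
  then obtain p where p: "\<And>e. \<Phi> (seg e) = seg (p e)" by metis
  have "c * \<bar>det2 e f\<bar> \<le> \<bar>det2 (p e) (p f)\<bar> \<and> \<bar>det2 (p e) (p f)\<bar> \<le> C * \<bar>det2 e f\<bar>" for e f
  proof -
    let ?K = "seg e + seg f"
    have K: "?K \<in> convex_bodies" by (intro convex_bodies_plus) auto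
    have "\<Phi> ?K = seg (p e) + seg (p f)"
      by (simp add: Phi_plus[OF \<Phi>] p)
    then show ?thesis using cC(3)[OF K] by (simp add: area_parallelogram)
  qed
  then have "det2_bi_Lipschitz p" using cC unfolding det2_bi_Lipschitz_def by blast
  then show thesis using p that[of p] by (simp add: segment_map_def)
qed

text \<open>For a polygon, \<open>\<Phi> P + \<Phi> P\<close> and the difference body are zonotopes
  with the same weights, so the bounds on determinants compare their areas term by term.\<close>

lemma segment_map_imp_VC:
  assumes p: "segment_map \<Phi> p" and "det2_bi_Lipschitz p"
  shows "VC \<Phi>"
proof -
  obtain a b where ab: "0 < a" "0 < b" "\<And>e f. norm e = 1 \<Longrightarrow> norm f = 1 \<Longrightarrow>
     a * \<bar>det2 e f\<bar> \<le> \<bar>det2 (p e) (p f)\<bar> \<and> \<bar>det2 (p e) (p f)\<bar> \<le> b * \<bar>det2 e f\<bar>"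
    using assms(2) unfolding det2_bi_Lipschitz_def by blast
  have seg: "\<Phi> (seg (t *\<^sub>R e)) = seg (t *\<^sub>R p e)"
    if "0 \<le> t" "norm e = 1" for t e
  proof (rule convex_body_eqI)
    fix u
    show "h (\<Phi> (seg (t *\<^sub>R e))) u
      = h (seg (t *\<^sub>R p e)) u"
      using seg_support_scale[OF \<Phi> that(1), of e u] segment_map_support[OF p that(2), of u] that(1)
      by (simp add: seg_support_def support_function_sym_segment abs_mult)
  qed (auto intro: Phi_convex_bodies[OF \<Phi>])
  \<comment> \<open>\<open>4 * area (\<Phi> P)\<close> lies between \<open>a\<close> and
    \<open>b\<close> times the area of the difference body, which lies between \<open>area P\<close>
    and \<open>32 * area P\<close>.\<close>
  have poly: "a / 4 * area P \<le> area (\<Phi> P)" "area (\<Phi> P) \<le> 8 * b * area P"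
    if P: "P \<in> convex_bodies" and w: "surface_weights P F c" for P F c
  proof -
    have F: "finite F" "\<And>v. v \<in> F \<Longrightarrow> 0 \<le> c v" "\<And>v. v \<in> F \<Longrightarrow> norm v = 1"
      using w by (auto simp: surface_weights_def)
    define d where "d v w = c v * c w / 4" for v w
    have d: "0 \<le> d v w" if "v \<in> F" "w \<in> F" for v w
      using F(2) that by (simp add: d_def)
    have dd: "\<bar>det2 ((c v / 2) *\<^sub>R x) ((c w / 2) *\<^sub>R y)\<bar> = d v w * \<bar>det2 x y\<bar>"
      if "v \<in> F" "w \<in> F" for v w x y
    proof -
      have "det2 ((c v / 2) *\<^sub>R x) ((c w / 2) *\<^sub>R y) = d v w * det2 x y"
        by (simp add: det2_def d_def algebra_simps)
      then show ?thesis using d[OF that] by (simp add: abs_mult)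
    qed
    have "\<Phi> P + \<Phi> P = (\<Sum>v\<in>F. seg ((c v / 2) *\<^sub>R p (rotate90 v)))"
      unfolding Phi_plus_self[OF \<Phi> P w] using F by (intro sum.cong refl seg) auto
    then have "area (\<Phi> P + \<Phi> P) = 2 * (\<Sum>v\<in>F. \<Sum>w\<in>F. \<bar>det2 ((c v / 2) *\<^sub>R p (rotate90 v)) ((c w / 2) *\<^sub>R p (rotate90 w))\<bar>)"
      using area_zonotope[OF F(1), of "\<lambda>v. (c v / 2) *\<^sub>R p (rotate90 v)"] by simp
    also have "\<dots> = 2 * (\<Sum>v\<in>F. \<Sum>w\<in>F. d v w * \<bar>det2 (p (rotate90 v)) (p (rotate90 w))\<bar>)"
      by (simp add: dd cong: sum.cong)
    finally have A: "4 * area (\<Phi> P) = 2 * (\<Sum>v\<in>F. \<Sum>w\<in>F. d v w * \<bar>det2 (p (rotate90 v)) (p (rotate90 w))\<bar>)"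
      using P by (simp add: convex_body_plus_self Phi_convex_bodies[OF \<Phi>] area_scaleR)
    have "area (P + uminus ` P) = 2 * (\<Sum>v\<in>F. \<Sum>w\<in>F. \<bar>det2 ((c v / 2) *\<^sub>R rotate90 v) ((c w / 2) *\<^sub>R rotate90 w)\<bar>)"
      using area_zonotope[OF F(1), of "\<lambda>v. (c v / 2) *\<^sub>R rotate90 v"] difference_body_zonotope[OF P w] by simp
    also have "\<dots> = 2 * (\<Sum>v\<in>F. \<Sum>w\<in>F. d v w * \<bar>det2 (rotate90 v) (rotate90 w)\<bar>)"
      by (simp only: dd cong: sum.cong)
    finally have B: "area (P + uminus ` P) = 2 * (\<Sum>v\<in>F. \<Sum>w\<in>F. d v w * \<bar>det2 (rotate90 v) (rotate90 w)\<bar>)" .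
    have mono: "(\<Sum>v\<in>F. \<Sum>w\<in>F. d v w * x v w) \<le> (\<Sum>v\<in>F. \<Sum>w\<in>F. d v w * y v w)"
      if "\<And>v w. v \<in> F \<Longrightarrow> w \<in> F \<Longrightarrow> x v w \<le> y v w" for x y
      using that by (intro sum_mono mult_left_mono d)
    have scale: "(\<Sum>v\<in>F. \<Sum>w\<in>F. d v w * (r * x v w)) = r * (\<Sum>v\<in>F. \<Sum>w\<in>F. d v w * x v w)" for r x
      by (simp add: sum_distrib_left mult.left_commute)
    have "a * area (P + uminus ` P) \<le> 4 * area (\<Phi> P)" "4 * area (\<Phi> P) \<le> b * area (P + uminus ` P)"
      using mono[of "\<lambda>v w. a * \<bar>det2 (rotate90 v) (rotate90 w)\<bar>" "\<lambda>v w. \<bar>det2 (p (rotate90 v)) (p (rotate90 w))\<bar>"]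
        mono[of "\<lambda>v w. \<bar>det2 (p (rotate90 v)) (p (rotate90 w))\<bar>" "\<lambda>v w. b * \<bar>det2 (rotate90 v) (rotate90 w)\<bar>"]
        ab(3)[of "rotate90 _" "rotate90 _"] F(3) unfolding A B scale by simp_all
    moreover have "a * area P \<le> a * area (P + uminus ` P)" "b * area (P + uminus ` P) \<le> b * (32 * area P)"
      using area_le_difference_body[OF P] area_difference_body_le[OF P] ab(1,2) by simp_all
    ultimately show "a / 4 * area P \<le> area (\<Phi> P)" "area (\<Phi> P) \<le> 8 * b * area P" by linarith+
  qed
  have "a / 4 * area K \<le> area (\<Phi> K) \<and> area (\<Phi> K) \<le> 8 * b * area K" if K: "K \<in> convex_bodies" for K
  proof -
    obtain P F c where P: "\<And>n. P n \<in> convex_bodies" "\<And>n. surface_weights (P n) (F n) (c n)"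
      "body_limit P K"
      by (rule polygon_sequence[OF K], rule that)
    have 1: "(\<lambda>n. area (P n)) \<longlonglongrightarrow> area K"
      by (rule tendsto_area[OF K P(1,3)])
    have 2: "(\<lambda>n. area (\<Phi> (P n))) \<longlonglongrightarrow> area (\<Phi> K)"
      by (rule tendsto_area[OF Phi_convex_bodies[OF \<Phi> K] Phi_convex_bodies[OF \<Phi> P(1)] Phi_tendsto[OF \<Phi> K P(1,3)]])
    have "a / 4 * area K \<le> area (\<Phi> K)"
      using poly(1)[OF P(1,2)] by (intro LIMSEQ_le[OF tendsto_mult_left[OF 1] 2]) blast
    moreover have "area (\<Phi> K) \<le> 8 * b * area K"
      using poly(2)[OF P(1,2)] by (intro LIMSEQ_le[OF 2 tendsto_mult_left[OF 1]]) blast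
    ultimately show ?thesis ..
  qed
  then show ?thesis
    unfolding VC_def using ab by (intro exI[of _ "a / 4"] exI[of _ "8 * b"] conjI) auto
qed

text \<open>\<open>p\<close> itself may jump between signs, but the absolute values of its
  coordinates are values of \<open>seg_support\<close>, and they determine the norm.\<close>

lemma segment_map_continuous_norm:
  assumes "segment_map \<Phi> p"
  shows "continuous_on (sphere 0 1) (\<lambda>e. norm (p e))"
proof -
  have "norm (p e) = sqrt ((seg_support \<Phi> e (vector [1, 0]))\<^sup>2 + (seg_support \<Phi> e (vector [0, 1]))\<^sup>2)"
    if "e \<in> sphere 0 1" for e
    using that segment_map_support[OF assms, of e]
    by (simp add: norm_eq_sqrt_inner inner_vec2 power2_eq_square)
  moreover have "continuous_on (sphere 0 1)
      (\<lambda>e. sqrt ((seg_support \<Phi> e (vector [1, 0]))\<^sup>2 + (seg_support \<Phi> e (vector [0, 1]))\<^sup>2))"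
    by (intro continuous_intros continuous_seg_support[OF \<Phi>])
  ultimately show ?thesis by (subst continuous_on_cong) auto
qed

lemma segment_map_bounds:
  assumes "segment_map \<Phi> p" "\<And>e. norm e = 1 \<Longrightarrow> p e \<noteq> 0"
  obtains m M where "0 < m" "0 < M" "\<And>e. norm e = 1 \<Longrightarrow> m \<le> norm (p e) \<and> norm (p e) \<le> M"
proof -
  have ne: "sphere (0 :: real^2) 1 \<noteq> {}"
    using norm_circle_point[of 0] by (metis empty_iff mem_sphere_0)
  note c = segment_map_continuous_norm[OF assms(1)]
  obtain x where x: "x \<in> sphere 0 1" "\<forall>y\<in>sphere 0 1. norm (p x) \<le> norm (p y)"
    using continuous_attains_inf[OF compact_sphere ne c] by blast
  obtain y where y: "y \<in> sphere 0 1" "\<forall>z\<in>sphere 0 1. norm (p z) \<le> norm (p y)"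
    using continuous_attains_sup[OF compact_sphere ne c] by blast
  show thesis
    by (rule that[of "norm (p x)" "norm (p y)"]) (use x y assms(2) in auto)
qed

end

lemma abs_det2_scaleR: "\<bar>det2 (s *\<^sub>R x) (t *\<^sub>R y)\<bar> = \<bar>s\<bar> * \<bar>t\<bar> * \<bar>det2 x y\<bar>"
proof -
  have "det2 (s *\<^sub>R x) (t *\<^sub>R y) = s * t * det2 x y" by (simp add: det2_def algebra_simps)
  then show ?thesis by (simp add: abs_mult)
qed

text \<open>Test with the perpendicular unit vector, whose determinant with \<open>e\<close> is
  1.\<close>

lemma det2_bi_Lipschitz_nonzero:
  assumes "det2_bi_Lipschitz p" "norm e = 1"
  shows "p e \<noteq> 0"
proof
  assume "p e = 0"
  obtain a where a: "0 < a" "\<And>e f. norm e = 1 \<Longrightarrow> norm f = 1 \<Longrightarrow> a * \<bar>det2 e f\<bar> \<le> \<bar>det2 (p e) (p f)\<bar>"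
    using assms(1) unfolding det2_bi_Lipschitz_def by blast
  have "det2 e (rotate90 e) = 1"
    using assms(2) inner_rotate90(1)[of e "rotate90 e"] by (simp add: dot_square_norm)
  moreover have "det2 (p e) (p (rotate90 e)) = 0" by (simp add: det2_def \<open>p e = 0\<close>)
  ultimately show False using a(2)[of e "rotate90 e"] a(1) assms(2) by simp
qed

subsection \<open>From segments to lines\<close>

lemma Gr_point_cases:
  fixes e s :: "real^2"
  assumes "norm e = 1" "s \<in> span {e}" "norm s = 1"
  shows "s = e \<or> s = - e"
proof -
  have "s \<in> span {e} \<inter> sphere 0 1" using assms by simp
  then show ?thesis unfolding span_sphere[OF assms(1)] by simp
qed

text \<open>With \<open>u = x\<close> and \<open>u = y\<close>, both squared norms equal the
  absolute value of \<open>x \<bullet> y\<close>.\<close>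

lemma norm_eq_if_abs_inner_eq:
  fixes x y :: "'a::real_inner"
  assumes "\<And>u. \<bar>u \<bullet> x\<bar> = \<bar>u \<bullet> y\<bar>"
  shows "norm x = norm y"
  using assms[of x] assms[of y] by (simp add: norm_eq inner_commute[of y x])

context
  fixes \<Phi> :: "(real^2) set \<Rightarrow> (real^2) set" and p :: "real^2 \<Rightarrow> real^2"
  assumes \<Phi>: "\<Phi> \<in> MAdd_s_plus" and p: "segment_map \<Phi> p" and lip: "det2_bi_Lipschitz p"
begin

text \<open>Makes constructions on lines independent of the chosen unit vector: \<open>e\<close> and
  \<open>- e\<close> give the same segment, although \<open>p\<close> may take opposite values
  there.\<close>

lemma segment_map_same_line:
  assumes "norm e = 1" "norm s = 1" "span {s} = span {e}"
  shows "\<bar>u \<bullet> p s\<bar> = \<bar>u \<bullet> p e\<bar>"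
proof -
  have "s \<in> span {e}" using assms(3) span_base[of s "{s}"] by simp
  then have "s = e \<or> s = - e" using assms by (intro Gr_point_cases)
  then have "seg_support \<Phi> s u = seg_support \<Phi> e u"
    using seg_support_uminus[OF \<Phi>] by auto
  then show ?thesis using segment_map_support[OF p] assms by simp
qed

lemma det2_image_eq_0_iff:
  assumes "norm e = 1" "norm f = 1"
  shows "det2 (p e) (p f) = 0 \<longleftrightarrow> det2 e f = 0"
proof -
  obtain a b where ab: "0 < a" "0 < b" "\<And>e f. norm e = 1 \<Longrightarrow> norm f = 1 \<Longrightarrow>
     a * \<bar>det2 e f\<bar> \<le> \<bar>det2 (p e) (p f)\<bar> \<and> \<bar>det2 (p e) (p f)\<bar> \<le> b * \<bar>det2 e f\<bar>"
    using lip unfolding det2_bi_Lipschitz_def by blast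
  show ?thesis
  proof
    assume "det2 (p e) (p f) = 0"
    then have "a * \<bar>det2 e f\<bar> \<le> 0" using ab(3)[OF assms] by simp
    then show "det2 e f = 0" using ab(1) by (simp add: mult_le_0_iff)
  next
    assume "det2 e f = 0"
    then show "det2 (p e) (p f) = 0" using ab(3)[OF assms] by simp
  qed
qed

lemma span_image_eq_iff:
  assumes "norm e = 1" "norm f = 1"
  shows "span {p e} = span {p f} \<longleftrightarrow> span {e} = span {f}"
proof -
  have nz: "p e \<noteq> 0" "p f \<noteq> 0" "e \<noteq> 0" "f \<noteq> 0"
    using det2_bi_Lipschitz_nonzero[OF lip] assms by auto
  have "span {p e} = span {p f} \<longleftrightarrow> det2 (p e) (p f) = 0" "span {e} = span {f} \<longleftrightarrow> det2 e f = 0"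
    using nz det2_eq_0_imp_span det2_span_eq_0 by metis+
  then show ?thesis using det2_image_eq_0_iff[OF assms] by simp
qed

text \<open>
  If the line \<open>L = span {l}\<close> were missed, then the cotangent of the angle between \<open>L\<close> and the
  image of the line with angle \<open>t\<close> would be continuous and injective for \<open>t \<in> [0, \<pi>)\<close>
  with the same value at \<open>0\<close> and \<open>\<pi>\<close>.
\<close>

lemma segment_map_surj:
  assumes "L \<in> Gr"
  obtains e where "norm e = 1" "span {p e} = L"
proof (rule ccontr)
  assume "\<not> thesis"
  then have none: "\<forall>e. norm e = 1 \<longrightarrow> span {p e} \<noteq> L" using that by blast
  obtain l where l: "norm l = 1" "L = span {l}" using Gr_obtain_unit[OF assms] .
  have l0: "l \<noteq> 0" using l by auto
  have ll: "l $ 1 * l $ 1 + l $ 2 * l $ 2 = 1"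
    using l(1) by (simp add: norm_eq_sqrt_inner inner_vec2)
  have nz: "rotate90 l \<bullet> p e \<noteq> 0" if "norm e = 1" for e
    using none[rule_format, OF that] det2_eq_0_imp_span[of "p e" l] det2_eq_0_imp_span[of l "p e"] l0 l(2)
      det2_bi_Lipschitz_nonzero[OF lip that] by (metis inner_rotate90(1))
  \<comment> \<open>The cotangent \<open>(l \<bullet> p e) / (rotate90 l \<bullet> p e)\<close>,
    written by polarization in terms of \<open>seg_support\<close>, so that it is visibly continuous
    and even in \<open>e\<close>.\<close>
  define g where "g e = ((seg_support \<Phi> e (l + rotate90 l))\<^sup>2 - (seg_support \<Phi> e (l - rotate90 l))\<^sup>2)
      / (4 * (seg_support \<Phi> e (rotate90 l))\<^sup>2)" for e
  have g: "g e = (l \<bullet> p e) / (rotate90 l \<bullet> p e)" if "norm e = 1" for e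
  proof -
    have "g e = (4 * ((l \<bullet> p e) * (rotate90 l \<bullet> p e))) / (4 * (rotate90 l \<bullet> p e)\<^sup>2)"
      unfolding g_def segment_map_support[OF p that] power2_abs
      by (simp add: inner_add_left inner_diff_left power2_eq_square algebra_simps)
    then show ?thesis using nz[OF that] by (simp add: power2_eq_square)
  qed
  have inj: "det2 e f = 0" if "norm e = 1" "norm f = 1" "g e = g f" for e f
  proof -
    have "(l \<bullet> p e) * (rotate90 l \<bullet> p f) = (l \<bullet> p f) * (rotate90 l \<bullet> p e)"
      using that nz g by (simp add: frac_eq_eq)
    moreover have "(l \<bullet> p e) * (rotate90 l \<bullet> p f) - (l \<bullet> p f) * (rotate90 l \<bullet> p e)
        = (l $ 1 * l $ 1 + l $ 2 * l $ 2) * det2 (p e) (p f)"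
      by (simp add: inner_vec2 det2_def algebra_simps)
    ultimately have "det2 (p e) (p f) = 0" using ll by simp
    then show ?thesis using det2_image_eq_0_iff that by simp
  qed
  define f where "f t = g (circle_point t)" for t
  have gc: "continuous_on (sphere 0 1) g"
    unfolding g_def
    by (intro continuous_on_divide continuous_on_diff continuous_on_mult continuous_on_power continuous_on_const
        continuous_seg_support[OF \<Phi>] ballI) (use nz segment_map_support[OF p] in auto)
  have cont: "continuous_on A f" for A
    unfolding f_def by (rule continuous_on_compose2[OF gc continuous_circle_point]) auto
  have "circle_point pi = - circle_point 0" by (simp add: circle_point_def vec2_eq_iff)
  then have f_pi: "f pi = f 0"
    unfolding f_def g_def by (simp add: seg_support_uminus[OF \<Phi>])
  have f_inj: "\<not> (0 < s - t \<and> s - t < pi)" if "f s = f t" for s t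
  proof -
    have "det2 (circle_point t) (circle_point s) = sin (s - t)"
      by (simp add: det2_def circle_point_def sin_diff)
    then show ?thesis
      using inj[of "circle_point t" "circle_point s"] that sin_gt_zero[of "s - t"] by (auto simp: f_def)
  qed
  \<comment> \<open>The midpoint of the values at 0 and \<open>pi / 2\<close> is attained strictly
    between these parameters and again between \<open>pi / 2\<close> and \<open>pi\<close>; the two
    parameters differ by less than \<open>pi\<close>, against injectivity.\<close>
  define y where "y = (f 0 + f (pi / 2)) / 2"
  have "f (pi / 2) \<noteq> f 0" using f_inj[of "pi / 2" 0] by auto
  then have y: "y \<noteq> f 0" "y \<noteq> f (pi / 2)" by (auto simp: y_def)
  have y_seg: "y \<in> closed_segment (f 0) (f (pi / 2))" "y \<in> closed_segment (f (pi / 2)) (f pi)"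
    using midpoint_in_closed_segment[of "f 0" "f (pi / 2)"]
    by (simp_all add: y_def midpoint_def f_pi closed_segment_commute[of "f (pi / 2)"] scaleR_conv_of_real)
  obtain t where t: "t \<in> closed_segment 0 (pi / 2)" "f t = y"
    using IVT'_closed_segment_real[OF y_seg(1) cont] by blast
  obtain s where s: "s \<in> closed_segment (pi / 2) pi" "f s = y"
    using IVT'_closed_segment_real[OF y_seg(2) cont] by blast
  have "0 \<le> t" "t \<le> pi / 2" "pi / 2 \<le> s" "s \<le> pi"
    using t(1) s(1) pi_gt_zero by (auto simp: closed_segment_eq_real_ivl split: if_splits)
  moreover have "t \<noteq> 0" "t \<noteq> pi / 2" using t(2) y by metis+
  ultimately show False using f_inj[of s t] t(2) s(2) by auto
qed

lemma segment_map_imp_formula: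
  "\<exists>(\<rho> :: (real^2) set \<Rightarrow> real) (\<pi> :: (real^2) set \<Rightarrow> (real^2) set).
       continuous_map (mtopology_of Gr_metric) euclideanreal \<rho> \<and> (\<forall>E\<in>Gr. 0 < \<rho> E) \<and>
       bij_betw \<pi> Gr Gr \<and> bi_Lipschitz \<pi> \<and>
       (\<forall>K\<in>convex_bodies. \<forall>u\<in>sphere 0 1.
          h (\<Phi> K) u =
            (\<integral>v. \<rho> (span {rotate90 v}) *
                 line_length (\<pi> (span {rotate90 v}))
                   (orth_projection (seg u) (\<pi> (span {rotate90 v})))
             \<partial>surface_area_measure K))"
proof -
  define dir where "dir E = (SOME w :: real^2. w \<in> E \<and> norm w = 1)" for E
  have dir: "norm (dir E) = 1" "span {dir E} = E" if "E \<in> Gr" for E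
    using Gr_unit_vector[OF that] by (simp_all add: dir_def)
  \<comment> \<open>The kernel is \<open>seg_support / 4\<close> and the projection has length
    \<open>2 * \<bar>u \<bullet> w\<bar>\<close> for a unit vector \<open>w\<close>, so the norm of
    \<open>p\<close> is divided by 8.\<close>
  define \<rho> where "\<rho> E = norm (p (dir E)) / 8" for E
  define \<pi> where "\<pi> E = span {p (dir E)}" for E
  have nz: "p (dir E) \<noteq> 0" if "E \<in> Gr" for E
    using det2_bi_Lipschitz_nonzero[OF lip] dir[OF that] by blast
  have sp: "span {v} \<in> Gr" if "norm v = 1" for v :: "real^2" using that by (intro span_Gr) auto
  have \<pi>_Gr: "\<pi> E \<in> Gr" if "E \<in> Gr" for E
    unfolding \<pi>_def using nz[OF that] by (rule span_Gr)
  have abs_dir: "\<bar>u \<bullet> p (dir (span {v}))\<bar> = \<bar>u \<bullet> p v\<bar>" if "norm v = 1" for u v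
    using that dir[OF sp[OF that]] by (intro segment_map_same_line) auto
  have \<rho>_span: "\<rho> (span {v}) = norm (p v) / 8" if "norm v = 1" for v
    using norm_eq_if_abs_inner_eq[OF abs_dir[OF that]] by (simp add: \<rho>_def)
  have cont: "continuous_map (mtopology_of Gr_metric) euclideanreal \<rho>"
  proof (rule continuous_map_Gr)
    show "continuous_on (sphere 0 1) (\<lambda>v. norm (p v) / 8)"
      by (intro continuous_on_divide continuous_on_const segment_map_continuous_norm[OF \<Phi> p]) simp
  qed (rule \<rho>_span)
  have pos: "0 < \<rho> E" if "E \<in> Gr" for E using nz[OF that] by (simp add: \<rho>_def)
  have bij: "bij_betw \<pi> Gr Gr"
  proof (rule bij_betw_imageI)
    show "inj_on \<pi> Gr"
    proof (rule inj_onI)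
      fix E F assume EF: "E \<in> Gr" "F \<in> Gr" "\<pi> E = \<pi> F"
      then have "span {dir E} = span {dir F}"
        using span_image_eq_iff[of "dir E" "dir F"] dir(1) by (simp add: \<pi>_def)
      then show "E = F" using dir(2) EF(1,2) by simp
    qed
    show "\<pi> ` Gr = Gr"
    proof (intro equalityI subsetI)
      fix L assume "L \<in> \<pi> ` Gr" then show "L \<in> Gr" using \<pi>_Gr by auto
    next
      fix L assume "L \<in> Gr"
      then obtain e where e: "norm e = 1" "span {p e} = L" by (rule segment_map_surj)
      have "\<pi> (span {e}) = L"
        using span_image_eq_iff[of "dir (span {e})" e] dir[OF sp[OF e(1)]] e by (simp add: \<pi>_def)
      then show "L \<in> \<pi> ` Gr" using sp[OF e(1)] by blast
    qed
  qed
  obtain m M where mM: "0 < m" "0 < M" "\<And>e. norm e = 1 \<Longrightarrow> m \<le> norm (p e) \<and> norm (p e) \<le> M"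
    using segment_map_bounds[OF \<Phi> p det2_bi_Lipschitz_nonzero[OF lip]] by blast
  obtain a b where ab: "0 < a" "0 < b" "\<And>e f. norm e = 1 \<Longrightarrow> norm f = 1 \<Longrightarrow>
     a * \<bar>det2 e f\<bar> \<le> \<bar>det2 (p e) (p f)\<bar> \<and> \<bar>det2 (p e) (p f)\<bar> \<le> b * \<bar>det2 e f\<bar>"
    using lip unfolding det2_bi_Lipschitz_def by blast
  \<comment> \<open>Normalizing \<open>p\<close> changes determinants by factors between
    \<open>1 / M\<^sup>2\<close> and \<open>1 / m\<^sup>2\<close>; each 2 is the loss in
    \<open>Gr_dist_det2\<close>.\<close>
  have "\<forall>E\<in>Gr. \<forall>F\<in>Gr. a / (2 * M\<^sup>2) * Gr_dist E F \<le> Gr_dist (\<pi> E) (\<pi> F) \<and>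
      Gr_dist (\<pi> E) (\<pi> F) \<le> 2 * b / m\<^sup>2 * Gr_dist E F"
  proof (intro conjI ballI)
    fix E F assume EF: "E \<in> Gr" "F \<in> Gr"
    define e where "e = dir E"
    define f where "f = dir F"
    have ef: "norm e = 1" "norm f = 1" "span {e} = E" "span {f} = F"
      using dir EF by (simp_all add: e_def f_def)
    have pe: "0 < norm (p e)" "0 < norm (p f)" using mM(1) mM(3)[OF ef(1)] mM(3)[OF ef(2)] by linarith+
    define D where "D = \<bar>det2 (p e /\<^sub>R norm (p e)) (p f /\<^sub>R norm (p f))\<bar>"
    have D: "D = \<bar>det2 (p e) (p f)\<bar> / (norm (p e) * norm (p f))"
      by (simp add: D_def abs_det2_scaleR divide_inverse)
    have unit: "norm (p e /\<^sub>R norm (p e)) = 1" "norm (p f /\<^sub>R norm (p f)) = 1" using pe by simp_all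
    have spn: "span {p e /\<^sub>R norm (p e)} = \<pi> E" "span {p f /\<^sub>R norm (p f)} = \<pi> F"
      using pe det2_eq_0_imp_span[of "p e /\<^sub>R norm (p e)" "p e"] det2_eq_0_imp_span[of "p f /\<^sub>R norm (p f)" "p f"]
      by (simp_all add: \<pi>_def e_def f_def det2_def)
    have d1: "D \<le> Gr_dist (\<pi> E) (\<pi> F)" "Gr_dist (\<pi> E) (\<pi> F) \<le> 2 * D"
      using Gr_dist_det2[OF unit] unfolding spn D_def by auto
    have d2: "\<bar>det2 e f\<bar> \<le> Gr_dist E F" "Gr_dist E F \<le> 2 * \<bar>det2 e f\<bar>"
      using Gr_dist_det2[OF ef(1,2)] unfolding ef by auto
    have prod: "m\<^sup>2 \<le> norm (p e) * norm (p f)" "norm (p e) * norm (p f) \<le> M\<^sup>2"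
      unfolding power2_eq_square using mM ef by (intro mult_mono; force)+
    have "a / (2 * M\<^sup>2) * Gr_dist E F \<le> a / (2 * M\<^sup>2) * (2 * \<bar>det2 e f\<bar>)"
      using d2 ab mM by (intro mult_left_mono) auto
    also have "\<dots> = a * \<bar>det2 e f\<bar> / M\<^sup>2" by simp
    also have "\<dots> \<le> \<bar>det2 (p e) (p f)\<bar> / (norm (p e) * norm (p f))"
      using ab(3)[OF ef(1,2)] prod pe by (intro frac_le) auto
    also have "\<dots> \<le> Gr_dist (\<pi> E) (\<pi> F)" using d1 D by simp
    finally show "a / (2 * M\<^sup>2) * Gr_dist E F \<le> Gr_dist (\<pi> E) (\<pi> F)" .
    have "Gr_dist (\<pi> E) (\<pi> F) \<le> 2 * (\<bar>det2 (p e) (p f)\<bar> / (norm (p e) * norm (p f)))"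
      using d1 D by simp
    also have "\<dots> \<le> 2 * (b * \<bar>det2 e f\<bar> / m\<^sup>2)"
      using ab(3)[OF ef(1,2)] prod mM(1) by (intro mult_left_mono frac_le) auto
    also have "\<dots> = 2 * b / m\<^sup>2 * \<bar>det2 e f\<bar>" by simp
    also have "\<dots> \<le> 2 * b / m\<^sup>2 * Gr_dist E F"
      using d2 ab mM by (intro mult_left_mono) auto
    finally show "Gr_dist (\<pi> E) (\<pi> F) \<le> 2 * b / m\<^sup>2 * Gr_dist E F" .
  qed
  moreover have "0 < a / (2 * M\<^sup>2)" "0 < 2 * b / m\<^sup>2" using ab mM by simp_all
  ultimately have "bi_Lipschitz \<pi>"
    unfolding bi_Lipschitz_def by blast
  moreover have "h (\<Phi> K) u =
      (\<integral>v. \<rho> (span {rotate90 v}) * line_length (\<pi> (span {rotate90 v}))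
         (orth_projection (seg u) (\<pi> (span {rotate90 v}))) \<partial>surface_area_measure K)"
    if K: "K \<in> convex_bodies" for K u
  proof -
    \<comment> \<open>The two integrands are compared only on the circle, so the space of the
      measure must be known.\<close>
    have "sets (surface_area_measure K) = sets circle_borel"
      using Phi_support_integral[OF \<Phi> K, of u] by (simp add: is_surface_area_measure_def)
    then have space: "space (surface_area_measure K) = sphere 0 1"
      using sets_eq_imp_space_eq[of "surface_area_measure K" circle_borel] by (simp add: space_restrict_space)
    have "h (\<Phi> K) u = (\<integral>v. seg_support \<Phi> (rotate90 v) u / 4 \<partial>surface_area_measure K)"
      using Phi_support_integral[OF \<Phi> K] by simp
    also have "\<dots> = (\<integral>v. \<rho> (span {rotate90 v}) * line_length (\<pi> (span {rotate90 v}))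
         (orth_projection (seg u) (\<pi> (span {rotate90 v}))) \<partial>surface_area_measure K)"
    proof (rule Bochner_Integration.integral_cong[OF refl])
      fix v assume "v \<in> space (surface_area_measure K)"
      then have v: "norm (rotate90 v) = 1" by (simp add: space)
      let ?E = "span {rotate90 v}"
      let ?q = "p (dir ?E)"
      have E: "?E \<in> Gr" using sp[OF v] .
      have q: "0 < norm ?q" using nz[OF E] by simp
      have "?q /\<^sub>R norm ?q \<in> \<pi> ?E" unfolding \<pi>_def by (intro span_scale span_base) simp
      then have "line_length (\<pi> ?E) (orth_projection (seg u) (\<pi> ?E)) = 2 * \<bar>u \<bullet> (?q /\<^sub>R norm ?q)\<bar>"
        using \<pi>_Gr[OF E] q by (intro line_length_projection) auto
      also have "\<dots> = 2 * \<bar>u \<bullet> ?q\<bar> / norm ?q" by (simp add: abs_mult divide_inverse)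
      also have "\<bar>u \<bullet> ?q\<bar> = seg_support \<Phi> (rotate90 v) u"
        using abs_dir[OF v, of u] segment_map_support[OF p v, of u] by simp
      finally show "seg_support \<Phi> (rotate90 v) u / 4 = \<rho> ?E * line_length (\<pi> ?E)
          (orth_projection (seg u) (\<pi> ?E))"
        using q by (simp add: \<rho>_def)
    qed
    finally show ?thesis .
  qed
  ultimately show ?thesis using cont pos bij by blast
qed

end

lemma rotate90_neq_uminus:
  assumes "norm e = 1"
  shows "rotate90 e \<noteq> - rotate90 e"
proof
  assume "rotate90 e = - rotate90 e"
  then have "rotate90 e = 0" by (simp add: vec2_eq_iff)
  then show False using assms norm_rotate90[of e] by simp
qed

lemma surface_weights_sym_segment:
  assumes "norm e = 1"
  shows "surface_weights (seg e) {rotate90 e, - rotate90 e} (\<lambda>_. 2)"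
proof -
  show ?thesis
    using assms rotate90_neq_uminus[OF assms] mixed_area_sym_segment[of _ e] mixed_area_commute[of _ "seg e"]
    by (auto simp: surface_weights_def)
qed

text \<open>\<open>x\<close> and \<open>y\<close> are fixed only up to sign; the absolute values
  allow the comparison with whichever of \<open>y\<close> and \<open>- y\<close> is nearer to
  \<open>x\<close>.\<close>

lemma line_direction_lipschitz:
  assumes E: "E \<in> Gr" "F \<in> Gr" and x: "x \<in> E" "norm x = 1" and y: "y \<in> F" "norm y = 1"
  shows "\<bar>\<bar>u \<bullet> x\<bar> - \<bar>u \<bullet> y\<bar>\<bar> \<le> norm u * Gr_dist E F"
proof -
  have span: "span {z} = L" if zL: "L \<in> Gr" "z \<in> L" "norm z = 1" for z :: "real^2" and L
  proof -
    obtain w where w: "norm w = 1" "L = span {w}" using Gr_obtain_unit[OF zL(1)] .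
    then have "z = w \<or> z = - w" using zL by (intro Gr_point_cases) simp_all
    then show ?thesis using w(2) span_uminus_singleton[of w] by metis
  qed
  have "Gr_dist E F = min (norm (x - y)) (norm (x + y))"
    using Gr_dist_span[OF x(2) y(2)] span[OF E(1) x] span[OF E(2) y] by simp
  moreover have "\<bar>\<bar>u \<bullet> x\<bar> - \<bar>u \<bullet> y\<bar>\<bar> \<le> \<bar>u \<bullet> (x - y)\<bar>" "\<bar>\<bar>u \<bullet> x\<bar> - \<bar>u \<bullet> y\<bar>\<bar> \<le> \<bar>u \<bullet> (x + y)\<bar>"
    by (simp_all add: inner_diff_right inner_add_right)
  moreover have "\<bar>u \<bullet> (x - y)\<bar> \<le> norm u * norm (x - y)" "\<bar>u \<bullet> (x + y)\<bar> \<le> norm u * norm (x + y)"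
    by (rule Cauchy_Schwarz_ineq2)+
  ultimately show ?thesis by (auto simp: min_def)
qed

text \<open>The formula is evaluated on segments only. Their surface area measures consist of two
  opposite atoms, on which the integrand takes the same value.\<close>

lemma formula_imp_segment_map:
  fixes \<rho> :: "(real^2) set \<Rightarrow> real" and \<pi> :: "(real^2) set \<Rightarrow> (real^2) set"
  assumes \<Phi>: "\<Phi> \<in> MAdd_s_plus"
    and \<rho>: "continuous_map (mtopology_of Gr_metric) euclideanreal \<rho>" "\<forall>E\<in>Gr. 0 < \<rho> E"
    and \<pi>: "bij_betw \<pi> Gr Gr" "bi_Lipschitz \<pi>"
    and formula: "\<forall>K\<in>convex_bodies. \<forall>u\<in>sphere 0 1.
          h (\<Phi> K) u =
            (\<integral>v. \<rho> (span {rotate90 v}) *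
                 line_length (\<pi> (span {rotate90 v}))
                   (orth_projection (seg u) (\<pi> (span {rotate90 v})))
             \<partial>surface_area_measure K)"
  obtains p where "segment_map \<Phi> p" "det2_bi_Lipschitz p"
proof -
  define dir where "dir E = (SOME w :: real^2. w \<in> E \<and> norm w = 1)" for E
  have dir: "dir E \<in> E" "norm (dir E) = 1" "span {dir E} = E" if "E \<in> Gr" for E
    using Gr_unit_vector[OF that] by (simp_all add: dir_def)
  have sp: "span {v} \<in> Gr" if "norm v = 1" for v :: "real^2" using that by (intro span_Gr) auto
  have \<pi>_Gr: "\<pi> E \<in> Gr" if "E \<in> Gr" for E using \<pi>(1) that by (auto simp: bij_betw_def)
  obtain c C where cC: "0 < c" "0 < C" "\<And>E F. E \<in> Gr \<Longrightarrow> F \<in> Gr \<Longrightarrow>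
      c * Gr_dist E F \<le> Gr_dist (\<pi> E) (\<pi> F) \<and> Gr_dist (\<pi> E) (\<pi> F) \<le> C * Gr_dist E F"
    using \<pi>(2) unfolding bi_Lipschitz_def by blast
  define q where "q e = dir (\<pi> (span {e}))" for e
  have q: "q e \<in> \<pi> (span {e})" "norm (q e) = 1" "span {q e} = \<pi> (span {e})" if "norm e = 1" for e
    using dir \<pi>_Gr sp that by (simp_all add: q_def)
  \<comment> \<open>The 8 collects two atoms, mass 2 each, and the 2 in the length of the
    projection.\<close>
  define p where "p e = (8 * \<rho> (span {e})) *\<^sub>R q e" for e
  define f where "f u v = \<rho> (span {rotate90 v}) * (2 * \<bar>u \<bullet> q (rotate90 v)\<bar>)" for u v
  have f_eq: "\<rho> (span {rotate90 v}) * line_length (\<pi> (span {rotate90 v}))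
      (orth_projection (seg u) (\<pi> (span {rotate90 v}))) = f u v" if "v \<in> sphere 0 1" for u v
    using that q[of "rotate90 v"] \<pi>_Gr[OF sp[of "rotate90 v"]]
    by (simp add: f_def line_length_projection)
  have q_lip: "\<bar>\<bar>u \<bullet> q e\<bar> - \<bar>u \<bullet> q e'\<bar>\<bar> \<le> norm u * C * norm (e - e')" if "norm e = 1" "norm e' = 1" for u e e'
  proof -
    have "\<bar>\<bar>u \<bullet> q e\<bar> - \<bar>u \<bullet> q e'\<bar>\<bar> \<le> norm u * Gr_dist (\<pi> (span {e})) (\<pi> (span {e'}))"
      by (intro line_direction_lipschitz \<pi>_Gr sp q that)
    also have "\<dots> \<le> norm u * (C * Gr_dist (span {e}) (span {e'}))"
      using cC(3) sp that by (intro mult_left_mono) auto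
    also have "\<dots> \<le> norm u * (C * norm (e - e'))"
      using cC(2) Gr_dist_span[OF that] by (intro mult_left_mono) auto
    finally show ?thesis by (simp add: mult.assoc)
  qed
  \<comment> \<open>\<open>q\<close> may change sign abruptly, its absolute inner products cannot.
    Continuity of the integrand is what \<open>integral_discrete_measure\<close> asks for.\<close>
  have q_cont: "continuous_on (sphere 0 1) (\<lambda>e. \<bar>u \<bullet> q e\<bar>)" for u
  proof (rule lipschitz_on_continuous_on[OF lipschitz_onI])
    fix x y :: "real^2" assume "x \<in> sphere 0 1" "y \<in> sphere 0 1"
    then show "dist \<bar>u \<bullet> q x\<bar> \<bar>u \<bullet> q y\<bar> \<le> (norm u * C) * dist x y"
      using q_lip[of x y u] by (simp add: dist_norm)
  qed (use cC in simp)
  have f_cont: "continuous_on (sphere 0 1) (f u)" for u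
    unfolding f_def
    by (intro continuous_on_mult continuous_on_const continuous_rotate90
        continuous_on_compose2[OF continuous_on_span[OF \<rho>(1)]] continuous_on_compose2[OF q_cont]) auto
  have "segment_map \<Phi> p"
    unfolding segment_map_def
  proof (intro allI impI sym_segment_eqI Phi_convex_bodies[OF \<Phi>] convex_bodies_segment)
    fix e u :: "real^2" assume e: "norm e = 1" and u: "u \<in> sphere 0 1"
    let ?I = "seg e" and ?F = "{rotate90 e, - rotate90 e}"
    have w: "surface_weights ?I ?F (\<lambda>_. 2)" using e by (rule surface_weights_sym_segment)
    have S: "surface_area_measure ?I = discrete_measure ?F (\<lambda>_. 2)"
      by (intro surface_area_measure_eqI surface_weights_is_surface_area_measure w)
    have space: "space (surface_area_measure ?I) = sphere 0 1"
      unfolding S by (simp add: discrete_measure_def space_restrict_space)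
    note rotate90_neq_uminus[OF e]
    moreover have "h (\<Phi> ?I) u = (\<integral>v. f u v \<partial>surface_area_measure ?I)"
      unfolding formula[rule_format, OF convex_bodies_segment u]
      by (rule Bochner_Integration.integral_cong[OF refl]) (simp add: space f_eq)
    moreover have "(\<integral>v. f u v \<partial>surface_area_measure ?I) = (\<Sum>v\<in>?F. 2 * f u v)"
      unfolding S by (rule integral_discrete_measure) (use e f_cont in auto)
    moreover have "f u (rotate90 e) = f u (- rotate90 e)"
      by (simp add: f_def q_def span_uminus_singleton)
    ultimately have "h (\<Phi> ?I) u = 4 * f u (- rotate90 e)" by simp
    also have "\<dots> = \<bar>u \<bullet> p e\<bar>"
      using bspec[OF \<rho>(2) sp[OF e]] by (simp add: f_def p_def abs_mult)
    finally show "h (\<Phi> ?I) u = \<bar>u \<bullet> p e\<bar>" .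
  qed
  have norm_p: "norm (p e) = 8 * \<rho> (span {e})" "0 < \<rho> (span {e})" if "norm e = 1" for e
    using bspec[OF \<rho>(2) sp[OF that]] q(2)[OF that] by (simp_all add: p_def)
  have nz: "p e \<noteq> 0" if "norm e = 1" for e using norm_p[OF that] by auto
  obtain m M where mM: "0 < m" "0 < M" "\<And>e. norm e = 1 \<Longrightarrow> m \<le> norm (p e) \<and> norm (p e) \<le> M"
    using segment_map_bounds[OF \<Phi> \<open>segment_map \<Phi> p\<close> nz] by blast
  \<comment> \<open>\<open>m\<close> and \<open>M\<close> bound the norms of \<open>p\<close>,
    \<open>c\<close> and \<open>C\<close> are the constants of \<open>\<pi>\<close>, and the factors
    2 come from \<open>Gr_dist_det2\<close>.\<close>
  have "m\<^sup>2 * (c / 2) * \<bar>det2 e f\<bar> \<le> \<bar>det2 (p e) (p f)\<bar> \<and> \<bar>det2 (p e) (p f)\<bar> \<le> M\<^sup>2 * (2 * C) * \<bar>det2 e f\<bar>"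
    if e: "norm e = 1" and f: "norm f = 1" for e f
  proof -
    have prod: "m\<^sup>2 \<le> norm (p e) * norm (p f)" "norm (p e) * norm (p f) \<le> M\<^sup>2"
      unfolding power2_eq_square using mM e f by (intro mult_mono; force)+
    have det: "\<bar>det2 (p e) (p f)\<bar> = norm (p e) * norm (p f) * \<bar>det2 (q e) (q f)\<bar>"
      unfolding norm_p(1)[OF e] norm_p(1)[OF f] p_def[of e] p_def[of f] abs_det2_scaleR
      using norm_p(2)[OF e] norm_p(2)[OF f] q(2)[OF e] q(2)[OF f] by simp
    have d1: "\<bar>det2 (q e) (q f)\<bar> \<le> Gr_dist (\<pi> (span {e})) (\<pi> (span {f}))"
      "Gr_dist (\<pi> (span {e})) (\<pi> (span {f})) \<le> 2 * \<bar>det2 (q e) (q f)\<bar>"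
      using Gr_dist_det2[of "q e" "q f"] q[OF e] q[OF f] by simp_all
    note d2 = Gr_dist_det2[OF e f]
    note d3 = cC(3)[OF sp[OF e] sp[OF f]]
    have "c * \<bar>det2 e f\<bar> \<le> 2 * \<bar>det2 (q e) (q f)\<bar>"
      using d1 d3 mult_left_mono[OF d2(1), of c] cC(1) by linarith
    then have "m\<^sup>2 * (c / 2 * \<bar>det2 e f\<bar>) \<le> (norm (p e) * norm (p f)) * \<bar>det2 (q e) (q f)\<bar>"
      using prod cC(1) by (intro mult_mono) auto
    moreover have "\<bar>det2 (q e) (q f)\<bar> \<le> 2 * C * \<bar>det2 e f\<bar>"
      using d1 d3 mult_left_mono[OF d2(2), of C] cC(2) by linarith
    then have "(norm (p e) * norm (p f)) * \<bar>det2 (q e) (q f)\<bar> \<le> M\<^sup>2 * (2 * C * \<bar>det2 e f\<bar>)"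
      using prod by (intro mult_mono) auto
    ultimately show ?thesis unfolding det by (simp add: mult.assoc)
  qed
  moreover have "0 < m\<^sup>2 * (c / 2)" "0 < M\<^sup>2 * (2 * C)" using mM cC by simp_all
  ultimately have "det2_bi_Lipschitz p" unfolding det2_bi_Lipschitz_def by blast
  with \<open>segment_map \<Phi> p\<close> show thesis by (rule that)
qed

theorem theorem1p4:
  fixes \<Phi> :: "(real^2) set \<Rightarrow> (real^2) set"
  assumes "\<Phi> \<in> MAdd_s_plus"
  shows "VC \<Phi> \<longleftrightarrow>
    (\<exists>(\<rho> :: (real^2) set \<Rightarrow> real) (\<pi> :: (real^2) set \<Rightarrow> (real^2) set).
       continuous_map (mtopology_of Gr_metric) euclideanreal \<rho> \<and> (\<forall>E\<in>Gr. 0 < \<rho> E) \<and>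
       bij_betw \<pi> Gr Gr \<and> bi_Lipschitz \<pi> \<and>
       (\<forall>K\<in>convex_bodies. \<forall>u\<in>sphere 0 1.
          support_function (\<Phi> K) u =
            (\<integral>v. \<rho> (span {rotate90 v}) *
                 line_length (\<pi> (span {rotate90 v}))
                   (orth_projection (closed_segment (- u) u) (\<pi> (span {rotate90 v})))
             \<partial>surface_area_measure K)))"
proof (rule iffI, goal_cases)
  case 1
  then obtain p where "segment_map \<Phi> p" "det2_bi_Lipschitz p"
    by (rule VC_imp_segment_map[OF assms])
  then show ?case by (rule segment_map_imp_formula[OF assms])
next
  case 2
  then obtain p where "segment_map \<Phi> p" "det2_bi_Lipschitz p"
    by (elim exE conjE) (rule formula_imp_segment_map[OF assms])
  then show ?case by (rule segment_map_imp_VC[OF assms])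
qed

end
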